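(* Let $(M,\Omega)$ be a compact symplectic manifold of dimension $2n$. The map $\Gamma:\mathbb T(M,\Omega)\to\mathscr L(\mathscr F)^*$ defined by $\Gamma(\nabla)=\mathcal C\wedge\Omega_{n-1}$, where $\mathcal C$ is the curvature of $\nabla$ viewed as an $\mathscr L(\mathscr F)$-valued two-form, i.e. $$\langle\!\langle\Gamma(\nabla),\alpha\rangle\!\rangle=\int_M\mathrm{tr}(\mathcal C\alpha)\wedge\Omega_{n-1},\qquad\alpha\in\mathscr L(\mathscr F),$$ is a moment map for the action of the gauge group $\mathscr G(\mathscr F)$ on the symplectic affine space $(\mathbb T(M,\Omega),\mathbb\Omega)$.
   Context: $\Omega_k=\frac1{k!}\Omega^k$. Abstract indices and the summation convention are used. $\Omega^{ij}$ is defined by $\Omega^{ip}\Omega_{pj}=-\delta_j{}^i$; indices are raised/lowered by $X^i=\Omega^{ip}X_p$, $X_i=X^p\Omega_{pi}$, keeping horizontal position. $\mathbb T(M,\Omega)$ is the space of affine connections $\nabla$ on $M$, possibly with torsion, such that $\nabla\Omega=0$; it is an affine space modeled on $\Gamma(T^*M\otimes S^2(T^*M))$, with $\nabla+\Pi$ meaning $\nabla+\Pi_{ij}{}^k$, $\Pi_{ijk}=\Pi_{i(jk)}$. Its symplectic form is $\mathbb\Omega(\alpha,\beta)=\int_M\alpha_{ijk}\beta^{ijk}\,\Omega_n$. The curvature $R_{ijk}{}^l$ and torsion $\tau_{ij}{}^k$ are defined by $2\nabla_{[i}\nabla_{j]}X^k=R_{ijp}{}^kX^p-\tau_{ij}{}^p\nabla_pX^k$.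 $\mathscr F\to M$ is the linear symplectic frame bundle, a principal $Sp(2n,\mathbb R)$-bundle. Its gauge group $\mathscr G(\mathscr F)$ (bundle automorphisms covering the identity) is identified with the sections $g_i{}^j$ of $\mathrm{End}(TM)$ such that $g_i{}^pg_j{}^q\Omega_{pq}=\Omega_{ij}$, and its Lie algebra $\mathscr L(\mathscr F)$ with the sections $\alpha_i{}^j$ of $\mathrm{End}(TM)$ with $\alpha_{[ij]}=0$, i.e. with $\alpha_{ij}\in\Gamma(S^2(T^*M))$. The gauge group acts on $\mathbb T(M,\Omega)$ (a right action, by pullback) by $g\cdot\nabla=\nabla+(g^{-1})_p{}^k\nabla_ig_j{}^p$. The two-form $\mathrm{tr}(\mathcal C\alpha)$ is $R_{ijp}{}^q\alpha_q{}^p$. Moment map means: (i) for each $\alpha\in\mathscr L(\mathscr F)$, the function $F_\alpha(\nabla)=\langle\!\langle\Gamma(\nabla),\alpha\rangle\!\rangle$ has as Hamiltonian vector field the vector field $\mathbb X^\alpha(\nabla)=\frac{d}{dt}|_{t=0}\exp(-t\alpha)\cdot\nabla$, where the Hamiltonian vector field $\mathbb H_F$ of $F$ is defined by $\mathbb\Omega(\Pi,\mathbb H_F)=\frac{d}{dt}|_{t=0}F(\nabla+t\Pi)$ for all $\Pi$; and (ii) $\Gamma$ is equivariant for the given action and the coadjoint action, i.e. (the action on connections being a right action) $\langle\!\langle\Gamma(g\cdot\nabla),\alpha\rangle\!\rangle=\langle\!\langle\Gamma(\nabla),g\alpha g^{-1}\rangle\!\rangle$, the products being compositions of endomorphisms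 of $TM$. *)

theory Defs
  imports "HOL-Analysis.Analysis"
begin

section \<open>Smooth manifolds\<close>

definition pd :: "'m::finite \<Rightarrow> (real^'m \<Rightarrow> real) \<Rightarrow> real^'m \<Rightarrow> real" where
  "pd i f x = frechet_derivative f (at x) (axis i 1)"

fun Ck_on :: "nat \<Rightarrow> (real^'m::finite) set \<Rightarrow> (real^'m \<Rightarrow> real) \<Rightarrow> bool" where
  "Ck_on 0 S f \<longleftrightarrow> continuous_on S f"
| "Ck_on (Suc k) S f \<longleftrightarrow> (\<forall>x\<in>S. f differentiable (at x)) \<and> (\<forall>i. Ck_on k S (pd i f))"

text \<open>Only used for open \<open>S\<close>.\<close>
definition smooth_on :: "(real^'m::finite) set \<Rightarrow> (real^'m \<Rightarrow> real) \<Rightarrow> bool" where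
  "smooth_on S f \<longleftrightarrow> (\<forall>k. Ck_on k S f)"

text \<open>A chart is a pair of its domain and its coordinate map; the values of the coordinate map
  outside the domain are irrelevant.\<close>
type_synonym ('a,'m) chart = "'a set \<times> ('a \<Rightarrow> real^'m)"

definition coords :: "('a,'m::finite) chart \<Rightarrow> (real^'m) set" where
  "coords c = snd c ` fst c"

definition chart_inv :: "('a,'m::finite) chart \<Rightarrow> real^'m \<Rightarrow> 'a" where
  "chart_inv c = inv_into (fst c) (snd c)"

definition transition :: "('a,'m::finite) chart \<Rightarrow> ('a,'m) chart \<Rightarrow> real^'m \<Rightarrow> real^'m" where
  "transition c d x = snd d (chart_inv c x)"

text \<open>With \<open>x\<close> the coordinates of \<open>c\<close> and \<open>y\<close> those of \<open>d\<close>: \<open>jac c d x k i\<close> is the derivative of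
  \<open>y\<^sup>k\<close> with respect to \<open>x\<^sup>i\<close>.\<close>
definition jac :: "('a,'m::finite) chart \<Rightarrow> ('a,'m) chart \<Rightarrow> real^'m \<Rightarrow> 'm \<Rightarrow> 'm \<Rightarrow> real" where
  "jac c d x k i = pd i (\<lambda>z. transition c d z $ k) x"

definition smooth_manifold :: "'a topology \<Rightarrow> ('a,'m::finite) chart set \<Rightarrow> bool" where
  "smooth_manifold X A \<longleftrightarrow>
     Hausdorff_space X \<and> second_countable X \<and> topspace X = (\<Union>c\<in>A. fst c) \<and>
     (\<forall>c\<in>A. openin X (fst c) \<and> open (coords c) \<and>
        homeomorphic_map (subtopology X (fst c)) (top_of_set (coords c)) (snd c)) \<and>
     (\<forall>c\<in>A. \<forall>d\<in>A. \<forall>k. smooth_on (snd c ` (fst c \<inter> fst d)) (\<lambda>x. transition c d x $ k))"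


section \<open>Tensor fields and affine connections\<close>

text \<open>A field assigns to every chart the component functions on the coordinate domain of the
  chart. The first index list holds the upper indices, the second the lower indices in their order
  of appearance: \<open>T c x [k] [i,j]\<close> is the component \<open>T\<^sub>i\<^sub>j\<^sup>k\<close> at the point with coordinates \<open>x\<close>.
  Only charts of the atlas, points of \<open>coords c\<close> and index lists of the lengths given by the type of
  the field are relevant.\<close>
type_synonym ('a,'m) tfield = "('a,'m) chart \<Rightarrow> real^'m \<Rightarrow> 'm list \<Rightarrow> 'm list \<Rightarrow> real"

definition tensor_field ::
  "('a,'m::finite) chart set \<Rightarrow> nat \<Rightarrow> nat \<Rightarrow> ('a,'m) tfield \<Rightarrow> bool" where
  "tensor_field A r s T \<longleftrightarrow>
     (\<forall>c\<in>A. \<forall>us ls. length us = r \<longrightarrow> length ls = s \<longrightarrow>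
        smooth_on (coords c) (\<lambda>x. T c x us ls)) \<and>
     (\<forall>c\<in>A. \<forall>d\<in>A. \<forall>p\<in>fst c \<inter> fst d. \<forall>us ls. length us = r \<longrightarrow> length ls = s \<longrightarrow>
        T d (snd d p) us ls =
          (\<Sum>us' | length us' = r. \<Sum>ls' | length ls' = s.
             (\<Prod>a<r. jac c d (snd c p) (us ! a) (us' ! a)) *
             (\<Prod>b<s. jac d c (snd d p) (ls' ! b) (ls ! b)) *
             T c (snd c p) us' ls'))"

text \<open>An affine connection is given by its connection coefficients, with the convention
  \<open>\<nabla>\<^sub>i X\<^sup>k = \<partial>\<^sub>i X\<^sup>k + D\<^sub>i\<^sub>p\<^sup>k X\<^sup>p\<close>; no symmetry in \<open>i, p\<close> is required.\<close>
definition affine_connection :: "('a,'m::finite) chart set \<Rightarrow> ('a,'m) tfield \<Rightarrow> bool" where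
  "affine_connection A D \<longleftrightarrow>
     (\<forall>c\<in>A. \<forall>i j k. smooth_on (coords c) (\<lambda>x. D c x [k] [i,j])) \<and>
     (\<forall>c\<in>A. \<forall>d\<in>A. \<forall>p\<in>fst c \<inter> fst d. \<forall>i j k.
        D d (snd d p) [k] [i,j] =
          (\<Sum>k'\<in>UNIV. jac c d (snd c p) k k' *
             ((\<Sum>i'\<in>UNIV. \<Sum>j'\<in>UNIV.
                 jac d c (snd d p) i' i * jac d c (snd d p) j' j * D c (snd c p) [k'] [i',j'])
              + pd i (\<lambda>y. jac d c y k' j) (snd d p))))"

text \<open>Covariant derivative of a tensor field of any type; the index of differentiation comes first:
  \<open>cov D T c x us (i # ls)\<close> is \<open>\<nabla>\<^sub>i T\<close> with upper indices \<open>us\<close> and lower indices \<open>ls\<close>.\<close>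
definition cov :: "('a,'m::finite) tfield \<Rightarrow> ('a,'m) tfield \<Rightarrow> ('a,'m) tfield" where
  "cov D T c x us ls0 = (let i = hd ls0; ls = tl ls0 in
     pd i (\<lambda>y. T c y us ls) x
     + (\<Sum>a<length us. \<Sum>p\<in>UNIV. D c x [us ! a] [i,p] * T c x (us[a := p]) ls)
     - (\<Sum>b<length ls. \<Sum>p\<in>UNIV. D c x [p] [i, ls ! b] * T c x us (ls[b := p])))"

text \<open>\<open>R c x [k] [i,j,p]\<close> is \<open>R\<^sub>i\<^sub>j\<^sub>p\<^sup>k\<close> and \<open>\<tau> c x [p] [i,j]\<close> is \<open>\<tau>\<^sub>i\<^sub>j\<^sup>p\<close>. The identity
  \<open>\<nabla>\<^sub>i\<nabla>\<^sub>j X\<^sup>k - \<nabla>\<^sub>j\<nabla>\<^sub>i X\<^sup>k = R\<^sub>i\<^sub>j\<^sub>p\<^sup>k X\<^sup>p - \<tau>\<^sub>i\<^sub>j\<^sup>p \<nabla>\<^sub>p X\<^sup>k\<close> is required of all local vector fields \<open>X\<close>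
  on chart domains.\<close>
definition has_curvature_torsion ::
  "('a,'m::finite) chart set \<Rightarrow> ('a,'m) tfield \<Rightarrow> ('a,'m) tfield \<Rightarrow> ('a,'m) tfield \<Rightarrow> bool" where
  "has_curvature_torsion A D R \<tau> \<longleftrightarrow>
     tensor_field A 1 3 R \<and> tensor_field A 1 2 \<tau> \<and>
     (\<forall>c\<in>A. \<forall>V. (\<forall>k. smooth_on (coords c) (\<lambda>x. V c x [k] [])) \<longrightarrow>
        (\<forall>x\<in>coords c. \<forall>i j k.
           cov D (cov D V) c x [k] [i,j] - cov D (cov D V) c x [k] [j,i] =
             (\<Sum>p\<in>UNIV. R c x [k] [i,j,p] * V c x [p] [])
             - (\<Sum>p\<in>UNIV. \<tau> c x [p] [i,j] * cov D V c x [k] [p])))"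

text \<open>Any two choices agree in all charts of the atlas.\<close>
definition curvature :: "('a,'m::finite) chart set \<Rightarrow> ('a,'m) tfield \<Rightarrow> ('a,'m) tfield" where
  "curvature A D = (SOME R. \<exists>\<tau>. has_curvature_torsion A D R \<tau>)"


section \<open>Differential forms and integration\<close>

text \<open>A \<open>k\<close>-form is an alternating tensor field with \<open>k\<close> lower indices; \<open>\<omega> c x [] [i\<^sub>1,\<dots>,i\<^sub>k]\<close> is
  its value on coordinate vector fields.\<close>

definition ext_deriv :: "('a,'m::finite) tfield \<Rightarrow> ('a,'m) tfield" where
  "ext_deriv \<omega> c x us ls =
     (\<Sum>a<length ls. (-1)^a * pd (ls ! a) (\<lambda>y. \<omega> c y us (take a ls @ drop (Suc a) ls)) x)"

text \<open>Wedge product of a \<open>p\<close>-form and a \<open>q\<close>-form, normalized such that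
  \<open>(\<alpha> \<and> \<beta>)\<^sub>i\<^sub>j = \<alpha>\<^sub>i \<beta>\<^sub>j - \<alpha>\<^sub>j \<beta>\<^sub>i\<close> for one-forms.\<close>
definition wedge ::
  "nat \<Rightarrow> nat \<Rightarrow> ('a,'m::finite) tfield \<Rightarrow> ('a,'m) tfield \<Rightarrow> ('a,'m) tfield" where
  "wedge p q \<alpha> \<beta> c x us ls =
     (\<Sum>\<sigma> | \<sigma> permutes {..<p+q}. of_int (sign \<sigma>) *
        \<alpha> c x [] (take p (permute_list \<sigma> ls)) * \<beta> c x [] (drop p (permute_list \<sigma> ls)))
     / (fact p * fact q)"

fun wedge_power :: "('a,'m::finite) tfield \<Rightarrow> nat \<Rightarrow> ('a,'m) tfield" where
  "wedge_power \<Omega> 0 = (\<lambda>c x us ls. 1)"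
| "wedge_power \<Omega> (Suc k) = wedge 2 (2*k) \<Omega> (wedge_power \<Omega> k)"

definition divided_power :: "('a,'m::finite) tfield \<Rightarrow> nat \<Rightarrow> ('a,'m) tfield" where
  "divided_power \<Omega> k c x us ls = wedge_power \<Omega> k c x us ls / fact k"

text \<open>Finite partitions of unity, as appropriate for compact manifolds.\<close>
definition partition_of_unity ::
  "'a topology \<Rightarrow> ('a,'m::finite) chart set \<Rightarrow> ('a,'m) chart set \<Rightarrow>
   (('a,'m) chart \<Rightarrow> 'a \<Rightarrow> real) \<Rightarrow> bool" where
  "partition_of_unity X A C \<rho> \<longleftrightarrow>
     finite C \<and> C \<subseteq> A \<and>
     (\<forall>c\<in>C. (\<forall>p\<in>topspace X. \<rho> c p \<ge> 0) \<and>
        X closure_of {p \<in> topspace X. \<rho> c p \<noteq> 0} \<subseteq> fst c \<and>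
        (\<forall>d\<in>A. smooth_on (coords d) (\<lambda>x. \<rho> c (chart_inv d x)))) \<and>
     (\<forall>p\<in>topspace X. (\<Sum>c\<in>C. \<rho> c p) = 1)"

text \<open>Integral of a top-degree form \<open>\<omega>\<close> over a compact manifold oriented by the nowhere vanishing
  top-degree form \<open>vol\<close>. The list \<open>e\<close> enumerates the coordinates. The factor \<open>sgn (vol c x [] e)\<close> is
  the orientation of the coordinate frame in this order, so charts need not be oriented and
  the order is irrelevant. The value does not depend on the partition of unity.\<close>
definition form_integral ::
  "'a topology \<Rightarrow> ('a,'m::finite) chart set \<Rightarrow> ('a,'m) tfield \<Rightarrow> ('a,'m) tfield \<Rightarrow> real" where
  "form_integral X A vol \<omega> =
     (let e = (SOME e. distinct e \<and> set e = (UNIV :: 'm set));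
          (C, \<rho>) = (SOME (C, \<rho>). partition_of_unity X A C \<rho>)
      in \<Sum>c\<in>C. integral (coords c)
           (\<lambda>x. \<rho> c (chart_inv c x) * sgn (vol c x [] e) * \<omega> c x [] e))"


section \<open>Symplectic manifolds and symplectic connections\<close>

definition symplectic_form :: "('a,'m::finite) chart set \<Rightarrow> ('a,'m) tfield \<Rightarrow> bool" where
  "symplectic_form A \<Omega> \<longleftrightarrow>
     tensor_field A 0 2 \<Omega> \<and>
     (\<forall>c\<in>A. \<forall>x\<in>coords c.
        (\<forall>i j. \<Omega> c x [] [i,j] = - \<Omega> c x [] [j,i]) \<and>
        invertible (\<chi> i j. \<Omega> c x [] [i,j]) \<and>
        (\<forall>i j k. ext_deriv \<Omega> c x [] [i,j,k] = 0))"

definition compact_symplectic_manifold ::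
  "'a topology \<Rightarrow> ('a,'m::finite) chart set \<Rightarrow> nat \<Rightarrow> ('a,'m) tfield \<Rightarrow> bool" where
  "compact_symplectic_manifold X A n \<Omega> \<longleftrightarrow>
     smooth_manifold X A \<and> compact_space X \<and> CARD('m) = 2 * n \<and> symplectic_form A \<Omega>"

text \<open>\<open>\<Omega>\<^sup>i\<^sup>j\<close>, see \<open>inv_symp_contract\<close> below for the sign.\<close>
definition inv_symp ::
  "('a,'m::finite) tfield \<Rightarrow> ('a,'m) chart \<Rightarrow> real^'m \<Rightarrow> 'm \<Rightarrow> 'm \<Rightarrow> real" where
  "inv_symp \<Omega> c x i j = (- matrix_inv (\<chi> i j. \<Omega> c x [] [i,j])) $ i $ j"

lemma inv_symp_contract:
  assumes "symplectic_form A \<Omega>" "c \<in> A" "x \<in> coords c"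
  shows "(\<Sum>p\<in>UNIV. inv_symp \<Omega> c x i p * \<Omega> c x [] [p,j]) = - (if i = j then 1 else 0)"
proof -
  let ?W = "\<chi> i j. \<Omega> c x [] [i,j]"
  have "invertible ?W"
    using assms unfolding symplectic_form_def by blast
  then have "?W ** matrix_inv ?W = mat 1 \<and> matrix_inv ?W ** ?W = mat 1"
    unfolding invertible_def matrix_inv_def by (rule someI_ex)
  then have "matrix_inv ?W ** ?W = mat 1" ..
  then have "(matrix_inv ?W ** ?W) $ i $ j = (if i = j then 1 else 0)"
    by (simp only: mat_def vec_lambda_beta)
  then have "(\<Sum>p\<in>UNIV. matrix_inv ?W $ i $ p * \<Omega> c x [] [p,j]) = (if i = j then 1 else 0)"
    by (simp only: matrix_matrix_mult_def vec_lambda_beta)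
  then show ?thesis
    by (simp only: inv_symp_def vector_uminus_component mult_minus_left sum_negf)
qed

text \<open>Lowering of the single upper index, which becomes the last lower index:
  \<open>\<Pi>\<^sub>i\<^sub>j\<^sub>k = \<Pi>\<^sub>i\<^sub>j\<^sup>p \<Omega>\<^sub>p\<^sub>k\<close> and \<open>\<alpha>\<^sub>i\<^sub>j = \<alpha>\<^sub>i\<^sup>p \<Omega>\<^sub>p\<^sub>j\<close>.\<close>
definition lower_index :: "('a,'m::finite) tfield \<Rightarrow> ('a,'m) tfield \<Rightarrow> ('a,'m) tfield" where
  "lower_index \<Omega> T c x us ls =
     (\<Sum>p\<in>UNIV. T c x [p] (butlast ls) * \<Omega> c x [] [p, last ls])"

text \<open>The space \<open>\<bbbT>(M,\<Omega>)\<close>.\<close>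
definition symp_connections ::
  "('a,'m::finite) chart set \<Rightarrow> ('a,'m) tfield \<Rightarrow> ('a,'m) tfield set" where
  "symp_connections A \<Omega> =
     {D. affine_connection A D \<and>
         (\<forall>c\<in>A. \<forall>x\<in>coords c. \<forall>i j k. cov D \<Omega> c x [] [i,j,k] = 0)}"

text \<open>Its model space: the fields \<open>\<Pi>\<^sub>i\<^sub>j\<^sup>k\<close> with \<open>\<Pi>\<^sub>i\<^sub>j\<^sub>k = \<Pi>\<^sub>i\<^sub>k\<^sub>j\<close>.\<close>
definition symp_model ::
  "('a,'m::finite) chart set \<Rightarrow> ('a,'m) tfield \<Rightarrow> ('a,'m) tfield set" where
  "symp_model A \<Omega> =
     {P. tensor_field A 1 2 P \<and>
         (\<forall>c\<in>A. \<forall>x\<in>coords c. \<forall>i j k.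
            lower_index \<Omega> P c x [] [i,j,k] = lower_index \<Omega> P c x [] [i,k,j])}"

definition translate ::
  "('a,'m) tfield \<Rightarrow> real \<Rightarrow> ('a,'m) tfield \<Rightarrow> ('a,'m) tfield" where
  "translate D t P = (\<lambda>c x us ls. D c x us ls + t * P c x us ls)"

text \<open>The function \<open>\<alpha>\<^sub>i\<^sub>j\<^sub>k \<beta>\<^sup>i\<^sup>j\<^sup>k\<close>.\<close>
definition symp_contract ::
  "('a,'m::finite) tfield \<Rightarrow> ('a,'m) tfield \<Rightarrow> ('a,'m) tfield \<Rightarrow>
   ('a,'m) chart \<Rightarrow> real^'m \<Rightarrow> real" where
  "symp_contract \<Omega> \<alpha> \<beta> c x =
     (\<Sum>i\<in>UNIV. \<Sum>j\<in>UNIV. \<Sum>k\<in>UNIV. lower_index \<Omega> \<alpha> c x [] [i,j,k] *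
        (\<Sum>a\<in>UNIV. \<Sum>b\<in>UNIV. \<Sum>d\<in>UNIV.
           inv_symp \<Omega> c x i a * inv_symp \<Omega> c x j b * inv_symp \<Omega> c x k d *
           lower_index \<Omega> \<beta> c x [] [a,b,d]))"

text \<open>The symplectic form on the space of symplectic connections.\<close>
definition conn_symp ::
  "'a topology \<Rightarrow> ('a,'m::finite) chart set \<Rightarrow> nat \<Rightarrow> ('a,'m) tfield \<Rightarrow>
   ('a,'m) tfield \<Rightarrow> ('a,'m) tfield \<Rightarrow> real" where
  "conn_symp X A n \<Omega> \<alpha> \<beta> =
     form_integral X A (divided_power \<Omega> n)
       (\<lambda>c x us ls. symp_contract \<Omega> \<alpha> \<beta> c x * divided_power \<Omega> n c x us ls)"


section \<open>The gauge group\<close>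

text \<open>Endomorphism fields are tensor fields \<open>g\<^sub>i\<^sup>j\<close>, mapping \<open>X\<^sup>j\<close> to \<open>g\<^sub>i\<^sup>j X\<^sup>i\<close>. In the matrix of such
  an endomorphism the upper index is the row index, so that composition is the matrix product.\<close>
definition endo_matrix :: "('a,'m::finite) tfield \<Rightarrow> ('a,'m) chart \<Rightarrow> real^'m \<Rightarrow> real^'m^'m" where
  "endo_matrix g c x = (\<chi> j i. g c x [j] [i])"

definition endo_of_matrix ::
  "(('a,'m::finite) chart \<Rightarrow> real^'m \<Rightarrow> real^'m^'m) \<Rightarrow> ('a,'m) tfield" where
  "endo_of_matrix G = (\<lambda>c x us ls. G c x $ hd us $ hd ls)"

definition endo_comp :: "('a,'m::finite) tfield \<Rightarrow> ('a,'m) tfield \<Rightarrow> ('a,'m) tfield" where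
  "endo_comp g h = endo_of_matrix (\<lambda>c x. endo_matrix g c x ** endo_matrix h c x)"

definition endo_inv :: "('a,'m::finite) tfield \<Rightarrow> ('a,'m) tfield" where
  "endo_inv g = endo_of_matrix (\<lambda>c x. matrix_inv (endo_matrix g c x))"

definition matrix_exp :: "real^'m^'m \<Rightarrow> real^('m::finite)^'m" where
  "matrix_exp B = (\<Sum>k. (1 / fact k) *\<^sub>R (((**) B ^^ k) (mat 1)))"

definition endo_exp :: "('a,'m::finite) tfield \<Rightarrow> ('a,'m) tfield" where
  "endo_exp \<alpha> = endo_of_matrix (\<lambda>c x. matrix_exp (endo_matrix \<alpha> c x))"

definition gauge_group ::
  "('a,'m::finite) chart set \<Rightarrow> ('a,'m) tfield \<Rightarrow> ('a,'m) tfield set" where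
  "gauge_group A \<Omega> =
     {g. tensor_field A 1 1 g \<and>
         (\<forall>c\<in>A. \<forall>x\<in>coords c. \<forall>i j.
            (\<Sum>p\<in>UNIV. \<Sum>q\<in>UNIV. g c x [p] [i] * g c x [q] [j] * \<Omega> c x [] [p,q])
            = \<Omega> c x [] [i,j])}"

definition gauge_algebra ::
  "('a,'m::finite) chart set \<Rightarrow> ('a,'m) tfield \<Rightarrow> ('a,'m) tfield set" where
  "gauge_algebra A \<Omega> =
     {\<alpha>. tensor_field A 1 1 \<alpha> \<and>
         (\<forall>c\<in>A. \<forall>x\<in>coords c. \<forall>i j.
            lower_index \<Omega> \<alpha> c x [] [i,j] = lower_index \<Omega> \<alpha> c x [] [j,i])}"

text \<open>\<open>g \<cdot> \<nabla> = \<nabla> + (g\<^sup>-\<^sup>1)\<^sub>p\<^sup>k \<nabla>\<^sub>i g\<^sub>j\<^sup>p\<close>.\<close>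
definition gauge_act :: "('a,'m::finite) tfield \<Rightarrow> ('a,'m) tfield \<Rightarrow> ('a,'m) tfield" where
  "gauge_act g D = (\<lambda>c x us ls.
     D c x us ls + (\<Sum>p\<in>UNIV. endo_inv g c x us [p] * cov D g c x [p] ls))"

text \<open>The vector field \<open>\<bbbX>\<^sup>\<alpha>\<close> on the space of connections; the derivative is taken pointwise
  on \<open>M\<close>.\<close>
definition gauge_vector_field ::
  "('a,'m::finite) tfield \<Rightarrow> ('a,'m) tfield \<Rightarrow> ('a,'m) tfield" where
  "gauge_vector_field \<alpha> D = (\<lambda>c x us ls.
     deriv (\<lambda>t. gauge_act (endo_exp (\<lambda>c x us ls. - t * \<alpha> c x us ls)) D c x us ls) 0)"


section \<open>Moment maps\<close>

definition is_hamiltonian_vector_field ::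
  "'a topology \<Rightarrow> ('a,'m::finite) chart set \<Rightarrow> nat \<Rightarrow> ('a,'m) tfield \<Rightarrow>
   (('a,'m) tfield \<Rightarrow> real) \<Rightarrow> (('a,'m) tfield \<Rightarrow> ('a,'m) tfield) \<Rightarrow> bool" where
  "is_hamiltonian_vector_field X A n \<Omega> F H \<longleftrightarrow>
     (\<forall>D\<in>symp_connections A \<Omega>. H D \<in> symp_model A \<Omega> \<and>
        (\<forall>P\<in>symp_model A \<Omega>.
           ((\<lambda>t. F (translate D t P)) has_real_derivative conn_symp X A n \<Omega> P (H D)) (at 0)))"

text \<open>\<open>\<Gamma> D \<alpha>\<close> is the pairing of \<open>\<Gamma> D\<close> with \<open>\<alpha>\<close>. The first clause says that \<open>\<Gamma>\<close> takes values in
  the dual of the gauge algebra. The action on connections is a right action.\<close>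
definition is_moment_map ::
  "'a topology \<Rightarrow> ('a,'m::finite) chart set \<Rightarrow> nat \<Rightarrow> ('a,'m) tfield \<Rightarrow>
   (('a,'m) tfield \<Rightarrow> ('a,'m) tfield \<Rightarrow> real) \<Rightarrow> bool" where
  "is_moment_map X A n \<Omega> \<Gamma> \<longleftrightarrow>
     (\<forall>D\<in>symp_connections A \<Omega>. \<forall>\<alpha>\<in>gauge_algebra A \<Omega>. \<forall>\<beta>\<in>gauge_algebra A \<Omega>. \<forall>a b.
        \<Gamma> D (\<lambda>c x us ls. a * \<alpha> c x us ls + b * \<beta> c x us ls) = a * \<Gamma> D \<alpha> + b * \<Gamma> D \<beta>) \<and>
     (\<forall>\<alpha>\<in>gauge_algebra A \<Omega>.
        is_hamiltonian_vector_field X A n \<Omega> (\<lambda>D. \<Gamma> D \<alpha>) (gauge_vector_field \<alpha>)) \<and>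
     (\<forall>D\<in>symp_connections A \<Omega>. \<forall>g\<in>gauge_group A \<Omega>. \<forall>\<alpha>\<in>gauge_algebra A \<Omega>.
        \<Gamma> (gauge_act g D) \<alpha> = \<Gamma> D (endo_comp (endo_comp g \<alpha>) (endo_inv g)))"

text \<open>The two-form \<open>tr(\<C>\<alpha>)\<^sub>i\<^sub>j = R\<^sub>i\<^sub>j\<^sub>p\<^sup>q \<alpha>\<^sub>q\<^sup>p\<close>.\<close>
definition trace_form :: "('a,'m::finite) tfield \<Rightarrow> ('a,'m) tfield \<Rightarrow> ('a,'m) tfield" where
  "trace_form R \<alpha> = (\<lambda>c x us ls.
     \<Sum>p\<in>UNIV. \<Sum>q\<in>UNIV. R c x [q] (ls @ [p]) * \<alpha> c x [p] [q])"

definition curvature_pairing ::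
  "'a topology \<Rightarrow> ('a,'m::finite) chart set \<Rightarrow> nat \<Rightarrow> ('a,'m) tfield \<Rightarrow>
   ('a,'m) tfield \<Rightarrow> ('a,'m) tfield \<Rightarrow> real" where
  "curvature_pairing X A n \<Omega> D \<alpha> =
     form_integral X A (divided_power \<Omega> n)
       (wedge 2 (2 * (n - 1)) (trace_form (curvature A D) \<alpha>) (divided_power \<Omega> (n - 1)))"

end

theory Submission
  imports Defs
begin

text \<open>Write \<open>D\<^sub>i\<close> for the matrices of a connection \<open>\<nabla>\<close> in a chart. Its curvature has the matrices
  \<open>R\<^sub>i\<^sub>j = \<partial>\<^sub>i D\<^sub>j - \<partial>\<^sub>j D\<^sub>i + D\<^sub>i D\<^sub>j - D\<^sub>j D\<^sub>i\<close> (\<open>curvature_eq\<close>), and for a two-form \<open>\<beta>\<close> the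
  product \<open>\<beta> \<and> \<Omega>\<^sub>n\<^sub>-\<^sub>1\<close> is \<open>1/2 \<Omega>\<^sup>i\<^sup>j \<beta>\<^sub>i\<^sub>j \<Omega>\<^sub>n\<close> (\<open>wedge_divided_power\<close>, from an expansion of the
  Pfaffian in \<open>pfm_eq_trace\<close>). The pairing is therefore the integral of \<open>1/2 \<Omega>\<^sup>i\<^sup>j tr(R\<^sub>i\<^sub>j \<alpha>)\<close> against
  the Liouville measure. All three properties of a moment map are read off from this formula.

  Along \<open>\<nabla> + t\<Pi>\<close> the pairing is a quadratic polynomial in \<open>t\<close> whose linear coefficient is the integral
  of \<open>\<Omega>\<^sup>i\<^sup>j tr((\<nabla>\<^sub>i \<Pi>\<^sub>j) \<alpha>)\<close>, where \<open>\<nabla>\<^sub>i\<close> differentiates each \<open>\<Pi>\<^sub>j\<close> as an endomorphism. By the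
  product rule the integrand is \<open>\<Omega>\<^sup>i\<^sup>j \<partial>\<^sub>i tr(\<Pi>\<^sub>j \<alpha>) - \<Omega>\<^sup>i\<^sup>j tr(\<Pi>\<^sub>j \<nabla>\<^sub>i \<alpha>)\<close>. The first term is the
  divergence of the vector field \<open>\<Omega>\<^sup>i\<^sup>j tr(\<Pi>\<^sub>j \<alpha>)\<close>, because \<open>d\<Omega> = 0\<close> makes \<open>\<Omega>\<^sup>i\<^sup>j\<close> divergence free for
  the Liouville measure (\<open>N_divergence_free\<close>), and it integrates to zero (\<open>divergence_theorem\<close>). The
  second term is the full symplectic contraction of \<open>\<Pi>\<close> with \<open>- \<nabla>\<alpha>\<close> (\<open>symp_contract_trace\<close>). Since
  \<open>exp(-t\<alpha>) = 1 - t\<alpha> + O(t\<^sup>2)\<close>, the gauge action moves \<open>\<nabla>\<close> exactly in the direction \<open>- \<nabla>\<alpha>\<close>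
  (\<open>gauge_vector_field_eq\<close>), so the Hamiltonian vector field is the required one.

  Equivariance holds pointwise: \<open>g\<close> acts on connection matrices by
  \<open>D\<^sub>i \<mapsto> g\<^sup>-\<^sup>1 D\<^sub>i g + g\<^sup>-\<^sup>1 \<partial>\<^sub>i g\<close>, hence on the curvature by conjugation (\<open>curv_gauge\<close>), and the trace
  is invariant under cyclic permutations. The same computation, with a Jacobian matrix in place of
  \<open>g\<close>, shows that the coordinate formula for the curvature defines a tensor.

  The analysis behind this consists of smooth partitions of unity on compact manifolds, integration by
  parts in a chart, and a change of variables between two charts. The latter applies because the
  density of the Liouville measure, the absolute value of a Pfaffian, is multiplied by the absolute
  value of the Jacobian determinant (\<open>pf_congruence\<close>).\<close>


section \<open>Partial derivatives\<close>

lemma pd_eqI: "(f has_derivative f') (at x) \<Longrightarrow> pd i f x = f' (axis i 1)"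
  unfolding pd_def by (metis frechet_derivative_at)

lemma has_derivative_pd:
  fixes f :: "real^'m::finite \<Rightarrow> real"
  assumes "f differentiable (at x)"
  shows "(f has_derivative (\<lambda>h. \<Sum>i\<in>UNIV. h $ i * pd i f x)) (at x)"
proof -
  have d: "(f has_derivative frechet_derivative f (at x)) (at x)"
    using assms frechet_derivative_works by blast
  have "frechet_derivative f (at x) h = (\<Sum>i\<in>UNIV. h $ i * pd i f x)" for h
  proof -
    interpret linear "frechet_derivative f (at x)"
      by (rule has_derivative_linear[OF d])
    have "frechet_derivative f (at x) h = frechet_derivative f (at x) (\<Sum>i\<in>UNIV. h $ i *\<^sub>R axis i 1)"
      using basis_expansion[of h] by (simp add: scalar_mult_eq_scaleR)
    also have "\<dots> = (\<Sum>i\<in>UNIV. h $ i * pd i f x)"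
      by (simp add: sum scale pd_def)
    finally show ?thesis .
  qed
  then have "frechet_derivative f (at x) = (\<lambda>h. \<Sum>i\<in>UNIV. h $ i * pd i f x)"
    by (rule ext)
  with d show ?thesis by simp
qed

lemma has_derivative_cong_open:
  assumes "open S" "x \<in> S" "\<And>y. y \<in> S \<Longrightarrow> f y = g y"
  shows "(f has_derivative f') (at x) \<longleftrightarrow> (g has_derivative f') (at x)"
  using assms by (metis has_derivative_transform_within_open)

lemma differentiable_cong_open:
  assumes "open S" "x \<in> S" "\<And>y. y \<in> S \<Longrightarrow> f y = g y"
  shows "f differentiable (at x) \<longleftrightarrow> g differentiable (at x)"
  unfolding differentiable_def by (subst has_derivative_cong_open[OF assms]) simp_all

lemma pd_cong:
  assumes "open S" "x \<in> S" "\<And>y. y \<in> S \<Longrightarrow> f y = g y"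
  shows "pd i f x = pd i g x"
  unfolding pd_def frechet_derivative_def by (subst has_derivative_cong_open[OF assms]) simp_all

lemma pd_const [simp]: "pd i (\<lambda>x. c) x = 0"
  by (rule trans[OF pd_eqI[OF has_derivative_const]]) simp

lemma pd_component: "pd i (\<lambda>x. x $ k) x = (if k = i then 1 else 0)"
  by (subst pd_eqI[OF bounded_linear.has_derivative[OF bounded_linear_vec_nth has_derivative_ident]])
     (auto simp: axis_def)

lemma pd_add:
  assumes "f differentiable (at x)" "g differentiable (at x)"
  shows "pd i (\<lambda>y. f y + g y) x = pd i f x + pd i g x"
  using assms unfolding frechet_derivative_works
  by (subst pd_eqI[OF has_derivative_add]) (auto simp: pd_def)

lemma pd_diff:
  assumes "f differentiable (at x)" "g differentiable (at x)"
  shows "pd i (\<lambda>y. f y - g y) x = pd i f x - pd i g x"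
  using assms unfolding frechet_derivative_works
  by (subst pd_eqI[OF has_derivative_diff]) (auto simp: pd_def)

lemma pd_mult:
  fixes f g :: "real^'m::finite \<Rightarrow> real"
  assumes "f differentiable (at x)" "g differentiable (at x)"
  shows "pd i (\<lambda>y. f y * g y) x = pd i f x * g x + f x * pd i g x"
  using assms unfolding frechet_derivative_works
  by (subst pd_eqI[OF has_derivative_mult]) (auto simp: pd_def)

lemma pd_cmult:
  fixes f :: "real^'m::finite \<Rightarrow> real"
  assumes "f differentiable (at x)"
  shows "pd i (\<lambda>y. c * f y) x = c * pd i f x"
  using pd_mult[of "\<lambda>_. c" x f i] assms by simp

lemma pd_uminus:
  fixes f :: "real^'m::finite \<Rightarrow> real"
  assumes "f differentiable (at x)"
  shows "pd i (\<lambda>y. - f y) x = - pd i f x"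
  using pd_cmult[OF assms, of i "-1"] by simp

lemma pd_sum:
  assumes "\<And>a. a \<in> I \<Longrightarrow> f a differentiable (at x)"
  shows "pd i (\<lambda>y. \<Sum>a\<in>I. f a y) x = (\<Sum>a\<in>I. pd i (f a) x)"
  using assms unfolding frechet_derivative_works
  by (subst pd_eqI[OF has_derivative_sum]) (auto simp: pd_def)

lemma differentiable_prod:
  fixes f :: "'b \<Rightarrow> real^'m::finite \<Rightarrow> real"
  assumes "\<And>a. a \<in> I \<Longrightarrow> f a differentiable (at x within S)"
  shows "(\<lambda>y. \<Prod>a\<in>I. f a y) differentiable (at x within S)"
proof (cases "finite I")
  case True
  then show ?thesis using assms
    by (induction I rule: finite_induct) (auto intro: differentiable_mult)
qed simp

lemma pd_prod:
  fixes f :: "'b \<Rightarrow> real^'m::finite \<Rightarrow> real"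
  assumes "finite I" "\<And>a. a \<in> I \<Longrightarrow> f a differentiable (at x)"
  shows "pd i (\<lambda>y. \<Prod>a\<in>I. f a y) x = (\<Sum>a\<in>I. pd i (f a) x * (\<Prod>b\<in>I-{a}. f b x))"
  using assms
proof (induction I rule: finite_induct)
  case (insert a I)
  have "(\<Sum>b\<in>I. pd i (f b) x * (\<Prod>c\<in>insert a I - {b}. f c x))
      = (\<Sum>b\<in>I. f a x * (pd i (f b) x * (\<Prod>c\<in>I - {b}. f c x)))"
  proof (rule sum.cong[OF refl])
    fix b assume "b \<in> I"
    then have "insert a I - {b} = insert a (I - {b})" "a \<notin> I - {b}" "finite (I - {b})"
      using insert by auto
    then show "pd i (f b) x * (\<Prod>c\<in>insert a I - {b}. f c x)
      = f a x * (pd i (f b) x * (\<Prod>c\<in>I - {b}. f c x))" by simp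
  qed
  moreover have "insert a I - {a} = I" using insert by auto
  ultimately show ?case
    using insert by (simp add: pd_mult differentiable_prod sum_distrib_left)
qed simp

lemma differentiable_components:
  fixes T :: "'a::real_normed_vector \<Rightarrow> real^'m::finite"
  assumes "\<And>k. (\<lambda>y. T y $ k) differentiable (at x)"
  shows "(T has_derivative (\<lambda>h. \<chi> k. frechet_derivative (\<lambda>y. T y $ k) (at x) h)) (at x)"
proof (rule has_derivative_componentwise_within[THEN iffD2], rule ballI)
  fix b :: "real^'m" assume "b \<in> Basis"
  then obtain k where k: "b = axis k 1" by (auto simp: Basis_vec_def)
  show "((\<lambda>y. T y \<bullet> b) has_derivative
      (\<lambda>h. (\<chi> k. frechet_derivative (\<lambda>y. T y $ k) (at x) h) \<bullet> b)) (at x)"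
    using assms[of k] unfolding k by (simp add: inner_axis frechet_derivative_works)
qed

lemma pd_chain:
  fixes T :: "real^'m::finite \<Rightarrow> real^'n::finite" and f :: "real^'n \<Rightarrow> real"
  assumes f: "f differentiable (at (T y))" and T: "\<And>k. (\<lambda>y. T y $ k) differentiable (at y)"
  shows "pd i (\<lambda>y. f (T y)) y = (\<Sum>k\<in>UNIV. pd k f (T y) * pd i (\<lambda>y. T y $ k) y)"
    and "(\<lambda>y. f (T y)) differentiable (at y)"
proof -
  have "((\<lambda>y. f (T y)) has_derivative
    (\<lambda>h. \<Sum>k\<in>UNIV. (\<chi> k. frechet_derivative (\<lambda>y. T y $ k) (at y) h) $ k * pd k f (T y))) (at y)"
    by (rule has_derivative_compose[OF differentiable_components[OF T] has_derivative_pd[OF f]])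
  from pd_eqI[OF this, of i] this
  show "pd i (\<lambda>y. f (T y)) y = (\<Sum>k\<in>UNIV. pd k f (T y) * pd i (\<lambda>y. T y $ k) y)"
    and "(\<lambda>y. f (T y)) differentiable (at y)"
    by (auto simp: pd_def mult.commute differentiable_def)
qed

lemma pd_compose_real:
  fixes u :: "real^'m::finite \<Rightarrow> real" and f :: "real \<Rightarrow> real"
  assumes "(f has_real_derivative f') (at (u x))" and "u differentiable (at x)"
  shows "pd i (\<lambda>y. f (u y)) x = f' * pd i u x" and "(\<lambda>y. f (u y)) differentiable (at x)"
proof -
  have "((\<lambda>y. f (u y)) has_derivative (\<lambda>h. f' * frechet_derivative u (at x) h)) (at x)"
    using has_derivative_compose[of u "frechet_derivative u (at x)" x UNIV f "\<lambda>h. f' * h"] assms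
    by (simp add: frechet_derivative_works has_field_derivative_def)
  from pd_eqI[OF this, of i] this
  show "pd i (\<lambda>y. f (u y)) x = f' * pd i u x" and "(\<lambda>y. f (u y)) differentiable (at x)"
    by (auto simp: pd_def differentiable_def)
qed


section \<open>Smooth functions\<close>

lemma Ck_on_cong:
  assumes "open S" "\<And>x. x \<in> S \<Longrightarrow> f x = g x"
  shows "Ck_on k S f \<longleftrightarrow> Ck_on k S g"
  using assms(2)
proof (induction k arbitrary: f g)
  case (Suc k)
  have "Ck_on k S (pd i f) \<longleftrightarrow> Ck_on k S (pd i g)" for i
    by (rule Suc.IH) (use Suc.prems assms(1) pd_cong in blast)
  moreover have "f differentiable (at x) \<longleftrightarrow> g differentiable (at x)" if "x \<in> S" for x
    using Suc.prems assms(1) that differentiable_cong_open by blast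
  ultimately show ?case by auto
qed (auto intro: continuous_on_eq)

lemma Ck_on_SucD: "Ck_on (Suc k) S f \<Longrightarrow> Ck_on k S f"
proof (induction k arbitrary: f)
  case 0
  then show ?case
    by (auto intro!: continuous_at_imp_continuous_on differentiable_imp_continuous_within)
qed auto

lemma Ck_on_Union:
  assumes "\<And>T. T \<in> \<T> \<Longrightarrow> open T" "\<And>T. T \<in> \<T> \<Longrightarrow> Ck_on k T f"
  shows "Ck_on k (\<Union>\<T>) f"
  using assms(2)
proof (induction k arbitrary: f)
  case 0 then show ?case using assms(1) by (auto intro: continuous_on_open_Union)
qed auto

lemma Ck_on_const [simp]: "Ck_on k S (\<lambda>x. c)"
proof (induction k arbitrary: c)
  case (Suc k)
  have "pd i (\<lambda>x::real^'a. c) = (\<lambda>x. 0)" for i by (simp add: fun_eq_iff)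
  then show ?case using Suc by simp
qed simp

lemma Ck_on_component: "Ck_on k S (\<lambda>x. x $ i)"
proof (cases k)
  case (Suc j)
  have "pd l (\<lambda>x::real^'a. x $ i) = (\<lambda>x. if i = l then 1 else 0)" for l
    by (simp add: fun_eq_iff pd_component)
  then show ?thesis using Suc by (simp add: bounded_linear_imp_differentiable bounded_linear_vec_nth)
qed (simp add: continuous_intros)

lemma Ck_on_add:
  assumes "open S" "Ck_on k S f" "Ck_on k S g"
  shows "Ck_on k S (\<lambda>x. f x + g x)"
  using assms(2,3)
proof (induction k arbitrary: f g)
  case (Suc k)
  have "Ck_on k S (pd i (\<lambda>x. f x + g x))" for i
    by (subst Ck_on_cong[OF assms(1), where g="\<lambda>x. pd i f x + pd i g x"])
       (use Suc in \<open>auto simp: pd_add\<close>)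
  then show ?case using Suc.prems by auto
qed (auto intro: continuous_on_add)

lemma Ck_on_mult:
  assumes "open S" "Ck_on k S f" "Ck_on k S g"
  shows "Ck_on k S (\<lambda>x. f x * g x)"
  using assms(2,3)
proof (induction k arbitrary: f g)
  case (Suc k)
  have "Ck_on k S (pd i (\<lambda>x. f x * g x))" for i
    using Suc.prems Ck_on_SucD[OF Suc.prems(1)] Ck_on_SucD[OF Suc.prems(2)]
    by (subst Ck_on_cong[OF assms(1), where g="\<lambda>x. pd i f x * g x + f x * pd i g x"])
       (auto simp: pd_mult intro!: Ck_on_add[OF assms(1)] Suc.IH)
  then show ?case using Suc.prems by (auto intro: differentiable_mult)
qed (auto intro: continuous_on_mult)

lemma Ck_on_inverse:
  assumes "open S" "Ck_on k S f" "\<And>x. x \<in> S \<Longrightarrow> f x \<noteq> 0"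
  shows "Ck_on k S (\<lambda>x. inverse (f x))"
  using assms(2)
proof (induction k)
  case (Suc k)
  have d: "((\<lambda>z. inverse z) has_real_derivative - (inverse (f x))\<^sup>2) (at (f x))" if "x \<in> S" for x
    using assms(3)[OF that] by (auto intro!: derivative_eq_intros simp: power2_eq_square)
  have 1: "pd i (\<lambda>x. inverse (f x)) x = ((-1) * (inverse (f x) * inverse (f x))) * pd i f x"
      "(\<lambda>x. inverse (f x)) differentiable (at x)" if "x \<in> S" for x i
    using pd_compose_real[where f=inverse and u=f, OF d[OF that]] that Suc.prems by (auto simp: power2_eq_square)
  have "Ck_on k S (pd i (\<lambda>x. inverse (f x)))" for i
    using Suc Ck_on_SucD[OF Suc.prems]
    by (subst Ck_on_cong[OF assms(1), where g="\<lambda>x. ((-1) * (inverse (f x) * inverse (f x))) * pd i f x"])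
       (rule 1(1), assumption, intro Ck_on_mult[OF assms(1)] Ck_on_const, simp_all)
  then show ?case using 1(2) by auto
qed (use assms in \<open>auto intro: continuous_on_inverse\<close>)

lemma Ck_on_sum:
  assumes "open S" "\<And>a. a \<in> I \<Longrightarrow> Ck_on k S (f a)"
  shows "Ck_on k S (\<lambda>x. \<Sum>a\<in>I. f a x)"
  using assms(2)
  by (induction I rule: infinite_finite_induct) (auto intro: Ck_on_add[OF assms(1)])

lemma Ck_on_prod:
  assumes "open S" "\<And>a. a \<in> I \<Longrightarrow> Ck_on k S (f a)"
  shows "Ck_on k S (\<lambda>x. \<Prod>a\<in>I. f a x)"
  using assms(2)
  by (induction I rule: infinite_finite_induct) (auto intro: Ck_on_mult[OF assms(1)])

lemma smooth_on_imp_Ck: "smooth_on S f \<Longrightarrow> Ck_on k S f"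
  by (simp add: smooth_on_def)

lemma smooth_on_differentiable: "smooth_on S f \<Longrightarrow> x \<in> S \<Longrightarrow> f differentiable (at x)"
  using smooth_on_imp_Ck[of S f 1] by simp

lemma smooth_on_continuous: "smooth_on S f \<Longrightarrow> continuous_on S f"
  using smooth_on_imp_Ck[of S f 0] by simp

lemma smooth_on_pd: "smooth_on S f \<Longrightarrow> smooth_on S (pd i f)"
  unfolding smooth_on_def by (metis Ck_on.simps(2))

lemma smooth_on_cong:
  "open S \<Longrightarrow> (\<And>x. x \<in> S \<Longrightarrow> f x = g x) \<Longrightarrow> smooth_on S f \<longleftrightarrow> smooth_on S g"
  unfolding smooth_on_def using Ck_on_cong by blast

lemma smooth_on_Union:
  "(\<And>T. T \<in> \<T> \<Longrightarrow> open T) \<Longrightarrow> (\<And>T. T \<in> \<T> \<Longrightarrow> smooth_on T f) \<Longrightarrow> smooth_on (\<Union>\<T>) f"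
  unfolding smooth_on_def using Ck_on_Union by blast

lemma smooth_on_const [simp]: "smooth_on S (\<lambda>x. c)"
  by (simp add: smooth_on_def)

lemma smooth_on_component: "smooth_on S (\<lambda>x. x $ i)"
  by (simp add: smooth_on_def Ck_on_component)

lemma smooth_on_add:
  "open S \<Longrightarrow> smooth_on S f \<Longrightarrow> smooth_on S g \<Longrightarrow> smooth_on S (\<lambda>x. f x + g x)"
  by (simp add: smooth_on_def Ck_on_add)

lemma smooth_on_mult:
  "open S \<Longrightarrow> smooth_on S f \<Longrightarrow> smooth_on S g \<Longrightarrow> smooth_on S (\<lambda>x. f x * g x)"
  by (simp add: smooth_on_def Ck_on_mult)

lemma smooth_on_uminus: "open S \<Longrightarrow> smooth_on S f \<Longrightarrow> smooth_on S (\<lambda>x. - f x)"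
  using smooth_on_mult[of S "\<lambda>_. -1" f] by simp

lemma smooth_on_diff:
  "open S \<Longrightarrow> smooth_on S f \<Longrightarrow> smooth_on S g \<Longrightarrow> smooth_on S (\<lambda>x. f x - g x)"
  using smooth_on_add[of S f "\<lambda>x. - g x"] smooth_on_uminus[of S g] by simp

lemma smooth_on_sum:
  "open S \<Longrightarrow> (\<And>a. a \<in> I \<Longrightarrow> smooth_on S (f a)) \<Longrightarrow> smooth_on S (\<lambda>x. \<Sum>a\<in>I. f a x)"
  by (simp add: smooth_on_def Ck_on_sum)

lemma smooth_on_prod:
  "open S \<Longrightarrow> (\<And>a. a \<in> I \<Longrightarrow> smooth_on S (f a)) \<Longrightarrow> smooth_on S (\<lambda>x. \<Prod>a\<in>I. f a x)"
  by (simp add: smooth_on_def Ck_on_prod)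

lemma smooth_on_divide:
  "open S \<Longrightarrow> smooth_on S f \<Longrightarrow> smooth_on S g \<Longrightarrow> (\<And>x. x \<in> S \<Longrightarrow> g x \<noteq> 0)
    \<Longrightarrow> smooth_on S (\<lambda>x. f x / g x)"
  by (simp add: divide_inverse smooth_on_def Ck_on_mult Ck_on_inverse)

lemmas smooth_intros = smooth_on_add smooth_on_mult smooth_on_uminus smooth_on_diff smooth_on_sum
  smooth_on_prod smooth_on_divide smooth_on_component smooth_on_const smooth_on_pd


section \<open>Symmetry of second derivatives\<close>

lemma has_real_derivative_along_axis:
  fixes f :: "real^'m::finite \<Rightarrow> real"
  assumes "f differentiable (at (a + t *\<^sub>R axis i 1))"
  shows "((\<lambda>t. f (a + t *\<^sub>R axis i 1)) has_real_derivative pd i f (a + t *\<^sub>R axis i 1)) (at t)"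
proof -
  have "((\<lambda>t. a + t *\<^sub>R axis i 1) has_derivative (\<lambda>s. s *\<^sub>R axis i 1)) (at t)"
    by (auto intro!: derivative_eq_intros)
  then have "((\<lambda>t. f (a + t *\<^sub>R axis i 1)) has_derivative
      (\<lambda>s. frechet_derivative f (at (a + t *\<^sub>R axis i 1)) (s *\<^sub>R axis i 1))) (at t)"
    using assms unfolding frechet_derivative_works by (rule has_derivative_compose)
  moreover have "frechet_derivative f (at (a + t *\<^sub>R axis i 1)) (s *\<^sub>R axis i 1)
      = pd i f (a + t *\<^sub>R axis i 1) * s" for s
    using linear_frechet_derivative[OF assms] by (simp add: pd_def linear_scale)
  ultimately show ?thesis by (simp add: has_field_derivative_def)
qed

text \<open>Applying the mean value theorem twice to the second difference of \<open>f\<close> over a small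
  parallelogram, once in each order, produces both mixed derivatives at nearby points.\<close>

lemma second_difference_mean_value:
  fixes f :: "real^'m::finite \<Rightarrow> real"
  assumes f: "\<And>y. y \<in> ball x r \<Longrightarrow> f differentiable (at y)"
    and df: "\<And>y. y \<in> ball x r \<Longrightarrow> pd i f differentiable (at y)"
    and s: "0 < s" "2 * s < r"
  obtains \<xi> where "dist x \<xi> \<le> 2 * s"
    "f (x + s *\<^sub>R axis i 1 + s *\<^sub>R axis j 1) - f (x + s *\<^sub>R axis i 1)
      - f (x + s *\<^sub>R axis j 1) + f x = s * s * pd j (pd i f) \<xi>"
proof -
  let ?p = "\<lambda>a b. x + a *\<^sub>R axis i 1 + b *\<^sub>R axis j 1 :: real^'m"
  have dist: "dist x (?p a b) \<le> 2 * s" if "0 \<le> a" "a \<le> s" "0 \<le> b" "b \<le> s" for a b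
  proof -
    have "dist x (?p a b) = norm (a *\<^sub>R axis i 1 + b *\<^sub>R axis j (1::real))"
      by (subst dist_commute) (simp add: dist_norm)
    also have "\<dots> \<le> norm (a *\<^sub>R axis i (1::real)) + norm (b *\<^sub>R axis j (1::real))"
      by (rule norm_triangle_ineq)
    also have "\<dots> \<le> 2 * s" using that by simp
    finally show ?thesis .
  qed
  have inb: "?p a b \<in> ball x r" if "0 \<le> a" "a \<le> s" "0 \<le> b" "b \<le> s" for a b
    using dist[OF that] s by simp
  have eq: "?p a b = (x + b *\<^sub>R axis j 1) + a *\<^sub>R axis i 1" for a b by simp
  let ?g = "\<lambda>a. f (?p a s) - f (?p a 0)"
  have "(?g has_real_derivative pd i f (?p a s) - pd i f (?p a 0)) (at a)" if "0 \<le> a" "a \<le> s" for a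
    using has_real_derivative_along_axis[of f "x + s *\<^sub>R axis j 1" a i]
      has_real_derivative_along_axis[of f "x + 0 *\<^sub>R axis j 1" a i] f[OF inb[of a s]] f[OF inb[of a 0]]
      that s unfolding eq by (intro derivative_intros) auto
  from MVT2[OF s(1) this] obtain a where a: "0 < a" "a < s"
    "?g s - ?g 0 = (s - 0) * (pd i f (?p a s) - pd i f (?p a 0))" by blast
  have "((\<lambda>b. pd i f (?p a b)) has_real_derivative pd j (pd i f) (?p a b)) (at b)"
    if "0 \<le> b" "b \<le> s" for b
    using has_real_derivative_along_axis[of "pd i f" "x + a *\<^sub>R axis i 1" b j] df[OF inb[of a b]] a that
    by auto
  from MVT2[OF s(1) this] obtain b where b: "0 < b" "b < s"
    "pd i f (?p a s) - pd i f (?p a 0) = (s - 0) * pd j (pd i f) (?p a b)" by blast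
  show ?thesis
    by (rule that[of "?p a b"]) (use dist[of a b] a b in \<open>auto simp: algebra_simps\<close>)
qed

lemma pd_commute:
  fixes f :: "real^'m::finite \<Rightarrow> real"
  assumes "open S" "x \<in> S" "Ck_on 2 S f"
  shows "pd i (pd j f) x = pd j (pd i f) x"
proof (rule ccontr)
  assume ne: "pd i (pd j f) x \<noteq> pd j (pd i f) x"
  define e where "e = \<bar>pd i (pd j f) x - pd j (pd i f) x\<bar> / 2"
  have "e > 0" using ne by (simp add: e_def)
  have S: "\<And>y. y \<in> S \<Longrightarrow> f differentiable (at y)" "\<And>y i. y \<in> S \<Longrightarrow> pd i f differentiable (at y)"
    "\<And>i j. continuous_on S (pd j (pd i f))"
    using assms(3) by (auto simp: numeral_2_eq_2)
  obtain r0 where r0: "r0 > 0" "ball x r0 \<subseteq> S" using assms openE by blast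
  have ex: "\<exists>r>0. \<forall>y\<in>S. dist y x < r \<longrightarrow> dist (pd j (pd i f) y) (pd j (pd i f) x) < e"
    for i j
    using S(3)[of j i] \<open>x \<in> S\<close> \<open>e > 0\<close> unfolding continuous_on_iff by blast
  obtain r1 where r1: "r1 > 0"
    "\<And>y. y \<in> S \<Longrightarrow> dist y x < r1 \<Longrightarrow> dist (pd j (pd i f) y) (pd j (pd i f) x) < e"
    using ex[of j i] by blast
  obtain r2 where r2: "r2 > 0"
    "\<And>y. y \<in> S \<Longrightarrow> dist y x < r2 \<Longrightarrow> dist (pd i (pd j f) y) (pd i (pd j f) x) < e"
    using ex[of i j] by blast
  define s where "s = min r0 (min r1 r2) / 3"
  have s: "0 < s" "2 * s < r0" "2 * s < r1" "2 * s < r2"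
    using r0 r1(1) r2(1) by (auto simp: s_def min_def)
  have db: "f differentiable (at y)" "pd k f differentiable (at y)" if "y \<in> ball x r0" for y k
    using S r0 that by auto
  obtain \<xi> where xi: "dist x \<xi> \<le> 2 * s"
    "f (x + s *\<^sub>R axis i 1 + s *\<^sub>R axis j 1) - f (x + s *\<^sub>R axis i 1)
      - f (x + s *\<^sub>R axis j 1) + f x = s * s * pd j (pd i f) \<xi>"
    using second_difference_mean_value[OF db s(1,2)] by metis
  obtain \<eta> where eta: "dist x \<eta> \<le> 2 * s"
    "f (x + s *\<^sub>R axis j 1 + s *\<^sub>R axis i 1) - f (x + s *\<^sub>R axis j 1)
      - f (x + s *\<^sub>R axis i 1) + f x = s * s * pd i (pd j f) \<eta>"
    using second_difference_mean_value[OF db s(1,2)] by metis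
  have "s * s * pd j (pd i f) \<xi> = s * s * pd i (pd j f) \<eta>"
    using xi(2) eta(2) by (simp add: algebra_simps)
  then have "pd j (pd i f) \<xi> = pd i (pd j f) \<eta>" using s by simp
  moreover have "dist (pd j (pd i f) \<xi>) (pd j (pd i f) x) < e"
    using r1(2)[of \<xi>] xi(1) s r0 by (auto simp: dist_commute subset_iff)
  moreover have "dist (pd i (pd j f) \<eta>) (pd i (pd j f) x) < e"
    using r2(2)[of \<eta>] eta(1) s r0 by (auto simp: dist_commute subset_iff)
  ultimately show False unfolding e_def dist_real_def by (auto simp: abs_if field_simps split: if_splits)
qed

section \<open>Integration of compactly supported functions\<close>

lemma integral_compact_support:
  fixes f :: "'a::euclidean_space \<Rightarrow> real"
  assumes K: "compact K" "K \<subseteq> S" and f: "continuous_on K f" "\<And>x. x \<in> S - K \<Longrightarrow> f x = 0"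
  shows "f integrable_on S" and "integral S f = (LINT x|lborel. indicator K x * f x)"
    and "integral S f = integral K f"
proof -
  have "set_integrable lborel K f"
    using borel_integrable_compact[OF K(1) f(1)] by (simp add: set_integrable_def)
  from set_borel_integral_eq_integral[OF this]
  have int: "f integrable_on K" and eq: "(LINT x|lborel. indicator K x * f x) = integral K f"
    by (auto simp: set_lebesgue_integral_def)
  have n1: "negligible {x \<in> K - S. f x \<noteq> 0}" and n2: "negligible {x \<in> S - K. f x \<noteq> 0}"
    using K f(2) by (auto intro!: negligible_subset[OF negligible_empty])
  have "(f has_integral integral K f) S"
    using has_integral_spike_set_eq[of K S f "integral K f"] n1 n2 integrable_integral[OF int] by simp
  then show "f integrable_on S" "integral S f = (LINT x|lborel. indicator K x * f x)"
    "integral S f = integral K f"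
    by (auto simp: integrable_on_def eq integral_unique)
qed

lemma integral_lborel_translate:
  fixes f :: "'a::euclidean_space \<Rightarrow> real"
  assumes "f \<in> borel_measurable borel"
  shows "(LINT x|lborel. f (c + x)) = (LINT x|lborel. f x)"
  by (subst (2) lborel_distr_plus[of c, symmetric], subst integral_distr) (use assms in auto)

text \<open>The difference quotients of a compactly supported function have integral zero, since Lebesgue
  measure is translation invariant, and they converge dominatedly to the partial derivative.\<close>

lemma lborel_integral_pd_eq_0:
  fixes F :: "real^'m::finite \<Rightarrow> real"
  assumes F: "\<And>x. F differentiable (at x)" and cont: "continuous_on UNIV (pd i F)"
    and K: "compact K" and F0: "\<And>x. x \<notin> K \<Longrightarrow> F x = 0"
  shows "(LINT x|lborel. pd i F x) = 0"
proof -
  have dF0: "pd i F x = 0" if "x \<notin> K" for x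
    using pd_cong[of "- K" x F "\<lambda>_. 0" i] that F0 compact_imp_closed[OF K] by auto
  have Fc: "continuous_on UNIV F"
    using F by (intro continuous_at_imp_continuous_on ballI differentiable_imp_continuous_within)
  have intF: "integrable lborel F"
  proof -
    have "(\<lambda>x. indicator K x *\<^sub>R F x) = F" using F0 by (fastforce simp: indicator_def)
    then show ?thesis using borel_integrable_compact[OF K continuous_on_subset[OF Fc]] by simp
  qed
  have "bounded (pd i F ` K)"
    using K cont continuous_on_subset by (intro compact_imp_bounded compact_continuous_image) blast+
  then obtain B0 where B0: "\<And>x. x \<in> K \<Longrightarrow> \<bar>pd i F x\<bar> \<le> B0"
    unfolding bounded_iff by auto
  define B where "B = max B0 0"
  have B: "\<bar>pd i F x\<bar> \<le> B" "0 \<le> B" for x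
    using B0[of x] dF0[of x] by (cases "x \<in> K"; force simp: B_def)+
  obtain R where R: "\<And>x. x \<in> K \<Longrightarrow> norm x \<le> R"
    using compact_imp_bounded[OF K] unfolding bounded_iff by auto
  let ?e = "axis i 1 :: real^'m"
  define q where "q n x = (F (inverse (real (Suc n)) *\<^sub>R ?e + x) - F x) / inverse (real (Suc n))" for n x
  have mvt: "\<exists>\<xi>. F (h *\<^sub>R ?e + x) - F x = h * pd i F \<xi>" if "h > 0" for h x
  proof -
    have "((\<lambda>t. F (x + t *\<^sub>R ?e)) has_real_derivative pd i F (x + t *\<^sub>R ?e)) (at t)" for t
      by (rule has_real_derivative_along_axis[OF F])
    from MVT2[OF that this] obtain t where
      "F (x + h *\<^sub>R ?e) - F (x + 0 *\<^sub>R ?e) = (h - 0) * pd i F (x + t *\<^sub>R ?e)" by blast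
    then show ?thesis by (auto simp: add.commute)
  qed
  have meas: "F \<in> borel_measurable borel" "pd i F \<in> borel_measurable borel"
    using Fc cont by (auto intro: borel_measurable_continuous_onI)
  have "(\<lambda>n. LINT x|lborel. q n x) \<longlonglongrightarrow> (LINT x|lborel. pd i F x)"
  proof (rule integral_dominated_convergence[where w="\<lambda>x. indicator (cball 0 (R + 1)) x *\<^sub>R B"])
    show "pd i F \<in> borel_measurable lborel" using meas by simp
    show "q n \<in> borel_measurable lborel" for n
      unfolding q_def using meas by simp
    show "integrable lborel (\<lambda>x::real^'m. indicator (cball 0 (R + 1)) x *\<^sub>R B)"
      by (rule borel_integrable_compact) auto
    show "AE x in lborel. (\<lambda>n. q n x) \<longlonglongrightarrow> pd i F x"
    proof (rule AE_I2)
      fix x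
      have "((\<lambda>t. F (x + t *\<^sub>R ?e)) has_real_derivative pd i F (x + 0 *\<^sub>R ?e)) (at 0)"
        by (rule has_real_derivative_along_axis[OF F])
      then have l: "((\<lambda>h. (F (x + h *\<^sub>R ?e) - F x) / h) \<longlongrightarrow> pd i F x) (at 0)"
        by (simp add: DERIV_def)
      have "(\<lambda>n. inverse (real (Suc n))) \<longlonglongrightarrow> 0" by (rule LIMSEQ_inverse_real_of_nat)
      then have "filterlim (\<lambda>n. inverse (real (Suc n))) (at 0) sequentially"
        by (auto simp: filterlim_at)
      from filterlim_compose[OF l this] show "(\<lambda>n. q n x) \<longlonglongrightarrow> pd i F x"
        by (simp add: q_def add.commute)
    qed
    show "AE x in lborel. norm (q n x) \<le> indicator (cball 0 (R + 1)) x *\<^sub>R B" for n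
    proof (rule AE_I2)
      fix x
      define h where "h = inverse (real (Suc n))"
      have h: "0 < h" "h \<le> 1" by (auto simp: h_def field_simps)
      show "norm (q n x) \<le> indicator (cball 0 (R + 1)) x *\<^sub>R B"
      proof (cases "x \<in> cball 0 (R + 1)")
        case True
        obtain \<xi> where "F (h *\<^sub>R ?e + x) - F x = h * pd i F \<xi>" using mvt h by blast
        then have "q n x = pd i F \<xi>" using h unfolding q_def h_def[symmetric] by simp
        then show ?thesis using True B by simp
      next
        case False
        have "norm (h *\<^sub>R ?e + x) \<ge> norm x - norm (h *\<^sub>R ?e)"
          by (metis add.commute norm_diff_ineq)
        then have "x \<notin> K" "h *\<^sub>R ?e + x \<notin> K" using R False h by fastforce+
        then show ?thesis using F0 False unfolding q_def h_def by simp
      qed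
    qed
  qed
  moreover have "(LINT x|lborel. q n x) = 0" for n
  proof -
    have "integrable lborel (\<lambda>x. F (inverse (real (Suc n)) *\<^sub>R ?e + x))"
      using intF meas by (subst (asm) lborel_distr_plus[of "inverse (real (Suc n)) *\<^sub>R ?e", symmetric])
        (auto simp: integrable_distr_eq)
    then show ?thesis
      unfolding q_def using intF integral_lborel_translate[OF meas(1)] by simp
  qed
  ultimately have "(\<lambda>n::nat. 0) \<longlonglongrightarrow> (LINT x|lborel. pd i F x)" by (simp only:)
  then show ?thesis by (simp only: LIMSEQ_const_iff)
qed

text \<open>The extension of \<open>f\<close> by zero is continuously differentiable on the whole space, because \<open>S\<close> and the
  complement of \<open>K\<close> form an open cover.\<close>

lemma integral_pd_eq_0:
  fixes f :: "real^'m::finite \<Rightarrow> real"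
  assumes S: "open S" and f: "\<And>x. x \<in> S \<Longrightarrow> f differentiable (at x)" and cont: "continuous_on S (pd i f)"
    and K: "compact K" "K \<subseteq> S" and f0: "\<And>x. x \<in> S - K \<Longrightarrow> f x = 0"
  shows "integral S (pd i f) = 0"
proof -
  define F where "F x = (if x \<in> S then f x else 0)" for x
  have oK: "open (- K)" using K(1) by (simp add: compact_imp_closed open_Compl)
  have FS: "F x = f x" if "x \<in> S" for x using that by (simp add: F_def)
  have FK: "F x = 0" if "x \<in> - K" for x using that f0 by (simp add: F_def)
  have cases: "x \<in> S \<or> x \<in> - K" for x using K(2) by auto
  have dF: "F differentiable (at x)" for x
    using cases[of x] f differentiable_cong_open[OF S, of x F f]
      differentiable_cong_open[OF oK, of x F "\<lambda>_. 0"] FS FK by auto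
  have pS: "pd i F x = pd i f x" if "x \<in> S" for x
    by (rule pd_cong[OF S that FS])
  have pK: "pd i F x = 0" if "x \<in> - K" for x
    using pd_cong[OF oK that FK] by simp
  have "continuous_on (S \<union> - K) (pd i F)"
  proof (rule continuous_on_open_Un[OF S oK])
    show "continuous_on S (pd i F)" using cont pS continuous_on_cong by metis
    show "continuous_on (- K) (pd i F)" using pK continuous_on_cong[OF refl] continuous_on_const by metis
  qed
  then have cF: "continuous_on UNIV (pd i F)" using cases
    by (metis Un_iff UNIV_I continuous_on_subset subsetI)
  have "integral S (pd i f) = (LINT x|lborel. indicator K x * pd i f x)"
  proof (rule integral_compact_support(2)[OF K])
    show "continuous_on K (pd i f)" using cont K(2) continuous_on_subset by blast
    show "pd i f x = 0" if "x \<in> S - K" for x using pS[of x] pK[of x] that by simp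
  qed
  also have "(\<lambda>x. indicator K x * pd i f x) = pd i F"
    using pS pK K(2) by (fastforce simp: indicator_def)
  also have "(LINT x|lborel. pd i F x) = 0"
    by (rule lborel_integral_pd_eq_0[OF dF cF K(1)]) (simp add: FK)
  finally show ?thesis .
qed


section \<open>Change of variables\<close>

text \<open>The change of variables formula over an arbitrary finite index type is reduced to well-ordered index
  types: this copy of the type carries a well-order, and renaming the coordinates preserves Lebesgue
  measure and determinants.\<close>

typedef ('m::finite) ordered_copy = "{..<CARD('m)}"
  by (rule exI[of _ 0]) simp

instantiation ordered_copy :: (finite) wellorder
begin

definition less_eq_ordered_copy :: "'a ordered_copy \<Rightarrow> 'a ordered_copy \<Rightarrow> bool" where
  "less_eq_ordered_copy a b \<longleftrightarrow> Rep_ordered_copy a \<le> Rep_ordered_copy b"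

definition less_ordered_copy :: "'a ordered_copy \<Rightarrow> 'a ordered_copy \<Rightarrow> bool" where
  "less_ordered_copy a b \<longleftrightarrow> Rep_ordered_copy a < Rep_ordered_copy b"

instance
proof
  fix P :: "'a ordered_copy \<Rightarrow> bool" and a
  assume IH: "\<And>x. (\<And>y. y < x \<Longrightarrow> P y) \<Longrightarrow> P x"
  show "P a"
    by (rule measure_induct_rule[of Rep_ordered_copy P a], rule IH) (simp add: less_ordered_copy_def)
qed (auto simp: less_eq_ordered_copy_def less_ordered_copy_def Rep_ordered_copy_inject)

end

instance ordered_copy :: (finite) finite
  by standard (simp add: type_definition.univ[OF type_definition_ordered_copy])

lemma card_ordered_copy: "CARD('m::finite ordered_copy) = CARD('m)"
  by (simp add: type_definition.card[OF type_definition_ordered_copy])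

definition reindex :: "('a::finite \<Rightarrow> 'b::finite) \<Rightarrow> real^'b \<Rightarrow> real^'a" where
  "reindex e x = (\<chi> a. x $ e a)"

lemma reindex_inverse:
  assumes "bij e"
  shows "reindex e (reindex (inv e) x) = x" and "reindex (inv e) (reindex e y) = y"
  using assms by (simp_all add: reindex_def vec_eq_iff bij_is_inj bij_is_surj surj_f_inv_f)

lemma bounded_linear_reindex: "bounded_linear (reindex e)"
  unfolding linear_conv_bounded_linear[symmetric] by (rule linearI) (simp_all add: reindex_def vec_eq_iff)

lemma prod_Basis_vec:
  fixes g :: "real^'n::finite \<Rightarrow> real"
  shows "(\<Prod>b\<in>Basis. g b) = (\<Prod>i\<in>UNIV. g (axis i 1))"
proof -
  have B: "(Basis :: (real^'n) set) = range (\<lambda>i. axis i 1)" by (auto simp: Basis_vec_def)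
  have "inj (\<lambda>i. axis i 1 :: real^'n)" by (simp add: inj_on_def axis_eq_axis)
  then show ?thesis by (simp add: B prod.reindex)
qed

lemma distr_reindex:
  fixes e :: "'a::finite \<Rightarrow> 'b::finite"
  assumes e: "bij e"
  shows "distr lborel borel (reindex e) = (lborel :: (real^'a) measure)"
proof (rule lborel_eqI[symmetric])
  fix l u :: "real^'a" assume le: "\<And>b. b \<in> Basis \<Longrightarrow> l \<bullet> b \<le> u \<bullet> b"
  have le': "l $ a \<le> u $ a" for a using le[of "axis a 1"] by (simp add: inner_axis)
  have meas: "reindex e \<in> borel_measurable borel"
    by (intro borel_measurable_continuous_onI linear_continuous_on bounded_linear_reindex)
  have "reindex e -` box l u = box (reindex (inv e) l) (reindex (inv e) u)"
    unfolding box_def Basis_vec_def using e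
    by (auto simp: inner_axis reindex_def) (metis bij_inv_eq_iff)+
  then have "emeasure (distr lborel borel (reindex e)) (box l u)
      = emeasure lborel (box (reindex (inv e) l) (reindex (inv e) u))"
    using meas by (simp add: emeasure_distr)
  also have "\<dots> = (\<Prod>b\<in>Basis. (reindex (inv e) u - reindex (inv e) l) \<bullet> b)"
    by (rule emeasure_lborel_box) (auto simp: Basis_vec_def inner_axis reindex_def le')
  also have "(\<Prod>b\<in>Basis. (reindex (inv e) u - reindex (inv e) l) \<bullet> b)
      = (\<Prod>i\<in>UNIV. u $ inv e i - l $ inv e i)"
    by (simp add: prod_Basis_vec inner_axis reindex_def)
  also have "\<dots> = (\<Prod>a\<in>UNIV. u $ a - l $ a)"
    by (rule prod.reindex_bij_betw) (use e bij_imp_bij_inv in blast)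
  also have "\<dots> = (\<Prod>b\<in>Basis. (u - l) \<bullet> b)"
    by (simp add: prod_Basis_vec inner_axis)
  finally show "emeasure (distr lborel borel (reindex e)) (box l u) = (\<Prod>b\<in>Basis. (u - l) \<bullet> b)" .
qed simp

lemma integral_reindex:
  fixes e :: "'a::finite \<Rightarrow> 'b::finite" and f :: "real^'a \<Rightarrow> real"
  assumes e: "bij e" and K: "compact K" and f: "continuous_on (reindex e ` K) f"
  shows "integral K (\<lambda>x. f (reindex e x)) = integral (reindex e ` K) f"
proof -
  have c: "continuous_on S (reindex e)" for S
    by (intro linear_continuous_on bounded_linear_reindex)
  have K': "compact (reindex e ` K)" by (rule compact_continuous_image[OF c K])
  have meas: "(\<lambda>x. indicator (reindex e ` K) x * f x) \<in> borel_measurable borel"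
    using borel_measurable_continuous_on_indicator[OF borel_compact[OF K'] f] by simp
  have inj: "inj (reindex e)" using reindex_inverse[OF e] by (metis injI)
  have "integral K (\<lambda>x. f (reindex e x)) = (LINT x|lborel. indicator K x * f (reindex e x))"
    by (rule integral_compact_support(2)[OF K]) (auto intro: continuous_on_compose2[OF f c])
  also have "\<dots> = (LINT x|lborel. indicator (reindex e ` K) (reindex e x) * f (reindex e x))"
    by (simp add: indicator_def inj_image_mem_iff[OF inj])
  also have "\<dots> = (LINT x|distr lborel borel (reindex e). indicator (reindex e ` K) x * f x)"
    using meas c by (subst integral_distr) (auto intro: borel_measurable_continuous_onI)
  also have "\<dots> = integral (reindex e ` K) f"
    unfolding distr_reindex[OF e] by (rule integral_compact_support(2)[symmetric, OF K' order_refl f]) simp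
  finally show ?thesis .
qed

lemma det_reindex:
  fixes A :: "real^'b::finite^'b" and e :: "'a::finite \<Rightarrow> 'b"
  assumes e: "bij e"
  shows "det (\<chi> i j. A $ e i $ e j) = det A"
proof -
  have eb: "bij_betw e UNIV UNIV" using e by simp
  let ?m = "map_permutation UNIV e"
  have inj: "inj e" using e by (rule bij_is_inj)
  have "bij_betw ?m {p. p permutes UNIV} {p. p permutes UNIV}"
  proof (rule bij_betw_byWitness[where f'="map_permutation UNIV (inv e)"])
    show "\<forall>a\<in>{p. p permutes UNIV}. map_permutation UNIV (inv e) (?m a) = a"
      using e by (auto intro!: map_permutation_compose_inv[where B=UNIV] simp: bij_is_inj)
    show "\<forall>a\<in>{p. p permutes UNIV}. ?m (map_permutation UNIV (inv e) a) = a"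
      using e bij_imp_bij_inv[OF e]
      by (auto intro!: map_permutation_compose_inv[where B=UNIV] simp: bij_is_surj surj_f_inv_f)
    show "?m ` {p. p permutes UNIV} \<subseteq> {p. p permutes UNIV}"
      using map_permutation_permutes[OF eb] by blast
    show "map_permutation UNIV (inv e) ` {p. p permutes UNIV} \<subseteq> {p. p permutes UNIV}"
      using map_permutation_permutes[OF bij_imp_bij_inv[OF e]] by blast
  qed
  then have "det A = (\<Sum>p | p permutes UNIV. of_int (sign (?m p)) * (\<Prod>i\<in>UNIV. A $ i $ ?m p i))"
    unfolding det_def by (rule sum.reindex_bij_betw[symmetric])
  also have "\<dots> = (\<Sum>p | p permutes UNIV. of_int (sign p) * (\<Prod>i\<in>UNIV. A $ e i $ e (p i)))"
  proof (intro sum.cong[OF refl])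
    fix p :: "'a \<Rightarrow> 'a" assume "p \<in> {p. p permutes UNIV}"
    then have "sign (?m p) = sign p" using inj by (simp add: sign_map_permutation)
    moreover have "(\<Prod>i\<in>UNIV. A $ i $ ?m p i) = (\<Prod>i\<in>UNIV. A $ e i $ ?m p (e i))"
      by (rule prod.reindex_bij_betw[OF eb, symmetric])
    moreover have "?m p (e i) = e (p i)" for i by (rule map_permutation_apply[OF inj]) simp
    ultimately show "of_int (sign (?m p)) * (\<Prod>i\<in>UNIV. A $ i $ ?m p i)
      = of_int (sign p) * (\<Prod>i\<in>UNIV. A $ e i $ e (p i))" by simp
  qed
  finally show ?thesis by (simp add: det_def)
qed

lemma integral_change_of_variables_compact:
  fixes f :: "real^'m::finite \<Rightarrow> real" and g :: "real^'m \<Rightarrow> real^'m"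
  assumes K: "compact K" and g: "\<And>x. x \<in> K \<Longrightarrow> (g has_derivative g' x) (at x within K)"
    and inj: "inj_on g K" and f: "continuous_on (g ` K) f"
    and d: "continuous_on K (\<lambda>x. det (matrix (g' x)))"
  shows "integral K (\<lambda>x. \<bar>det (matrix (g' x))\<bar> * f (g x)) = integral (g ` K) f"
proof -
  obtain e :: "'m ordered_copy \<Rightarrow> 'm" where e: "bij e"
    by (rule exE[OF finite_same_card_bij[OF finite finite card_ordered_copy]])
  define L where "L = reindex e"
  define L' where "L' = reindex (inv e)"
  have LL': "L (L' x) = x" and L'L: "L' (L y) = y" for x y
    using reindex_inverse[OF e] by (auto simp: L_def L'_def)
  have ie: "bij (inv e)" using e by (rule bij_imp_bij_inv)
  have cL: "continuous_on S L" "continuous_on T L'" for S T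
    unfolding L_def L'_def by (intro linear_continuous_on bounded_linear_reindex)+
  have dL: "(L has_derivative L) F" "(L' has_derivative L') G" for F G
    unfolding L_def L'_def
    by (intro bounded_linear.has_derivative[OF bounded_linear_reindex, OF has_derivative_ident])+
  let ?K = "L ` K" and ?g = "\<lambda>x. L (g (L' x))" and ?g' = "\<lambda>x h. L (g' (L' x) (L' h))"
  have K': "compact ?K" by (rule compact_continuous_image[OF cL(1) K])
  have img: "L' ` ?K = K" using L'L by (simp add: image_image)
  have gc: "continuous_on K g" using g has_derivative_continuous_on by blast
  have der: "(?g has_derivative ?g' x) (at x within ?K)" if "x \<in> ?K" for x
  proof -
    have "(g has_derivative g' (L' x)) (at (L' x) within L' ` ?K)"
      using g[of "L' x"] that img by force
    from has_derivative_in_compose[OF dL(2) this]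
    have "((\<lambda>x. g (L' x)) has_derivative (\<lambda>h. g' (L' x) (L' h))) (at x within ?K)" .
    from has_derivative_compose[OF this dL(1)] show ?thesis .
  qed
  have inj': "inj_on ?g ?K"
    using inj L'L LL' by (auto simp: inj_on_def) metis
  have det: "det (matrix (?g' x)) = det (matrix (g' (L' x)))" for x
  proof -
    have "matrix (?g' x) = (\<chi> i j. matrix (g' (L' x)) $ e i $ e j)"
    proof -
      have ax: "L' (axis j 1) = axis (e j) 1" for j
        using e by (auto simp: L'_def reindex_def vec_eq_iff axis_def) (metis bij_inv_eq_iff)+
      show ?thesis by (simp add: matrix_def vec_eq_iff L_def reindex_def ax)
    qed
    then show ?thesis using det_reindex[OF e] by simp
  qed
  have gK: "?g ` ?K = L ` g ` K" using L'L by (simp add: image_image)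
  have fL: "continuous_on (?g ` ?K) (\<lambda>x. f (L' x))"
    unfolding gK by (rule continuous_on_compose2[OF f cL(2)]) (auto simp: L'L)
  have gK': "compact (?g ` ?K)"
    unfolding gK by (intro compact_continuous_image cL gc K)
  have "(\<lambda>x. f (L' x)) absolutely_integrable_on (?g ` ?K)"
    using borel_integrable_compact[OF gK' fL] unfolding set_integrable_def
    by (subst integrable_completion) auto
  then have "integral ?K (\<lambda>x. \<bar>det (matrix (?g' x))\<bar> * f (L' (?g x))) = integral (?g ` ?K) (\<lambda>x. f (L' x))"
    using has_absolute_integral_change_of_variables_compact[OF K' der inj',
      of "\<lambda>x. vec (f (L' x)) :: real^1" "vec (integral (?g ` ?K) (\<lambda>x. f (L' x)))"]
    unfolding absolutely_integrable_on_1_iff integral_on_1_eq by (auto simp: vec_eq_iff)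
  moreover have "integral (?g ` ?K) (\<lambda>x. f (L' x)) = integral (L' ` ?g ` ?K) f"
  proof (rule integral_reindex[OF ie gK', folded L'_def])
    have "L' ` ?g ` ?K = g ` K" using L'L by (simp add: image_image)
    then show "continuous_on (L' ` ?g ` ?K) f" using f by simp
  qed
  moreover have "L' ` ?g ` ?K = g ` K" using L'L by (simp add: image_image)
  moreover have "integral ?K (\<lambda>x. \<bar>det (matrix (?g' x))\<bar> * f (L' (?g x)))
      = integral ?K (\<lambda>x. (\<lambda>z. \<bar>det (matrix (g' z))\<bar> * f (g z)) (L' x))"
    by (simp add: det L'L)
  moreover have "\<dots> = integral (L' ` ?K) (\<lambda>z. \<bar>det (matrix (g' z))\<bar> * f (g z))"
  proof (rule integral_reindex[OF ie K', folded L'_def])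
    have "continuous_on K (\<lambda>z. \<bar>det (matrix (g' z))\<bar> * f (g z))"
      by (intro continuous_intros d continuous_on_compose2[OF f gc]) auto
    then show "continuous_on (L' ` ?K) (\<lambda>z. \<bar>det (matrix (g' z))\<bar> * f (g z))"
      using img by simp
  qed
  ultimately show ?thesis using img by simp
qed

section \<open>Charts and transition maps\<close>

definition overlap :: "('a,'m::finite) chart \<Rightarrow> ('a,'m) chart \<Rightarrow> (real^'m) set" where
  "overlap c d = snd c ` (fst c \<inter> fst d)"

definition jacm :: "('a,'m::finite) chart \<Rightarrow> ('a,'m) chart \<Rightarrow> real^'m \<Rightarrow> real^'m^'m" where
  "jacm c d x = (\<chi> k i. jac c d x k i)"

locale manifold =
  fixes X :: "'a topology" and A :: "('a,'m::finite) chart set"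
  assumes smooth_manifold: "smooth_manifold X A"
begin

lemma chart_facts:
  assumes "c \<in> A"
  shows open_domain: "openin X (fst c)" and open_coords: "open (coords c)"
    and chart_homeo: "homeomorphic_map (subtopology X (fst c)) (top_of_set (coords c)) (snd c)"
    and domain_subset: "fst c \<subseteq> topspace X"
    and topspace_chart: "topspace (subtopology X (fst c)) = fst c"
    and chart_inj: "inj_on (snd c) (fst c)"
proof -
  show o: "openin X (fst c)" and "open (coords c)"
    and h: "homeomorphic_map (subtopology X (fst c)) (top_of_set (coords c)) (snd c)"
    using smooth_manifold assms by (auto simp: smooth_manifold_def)
  show s: "fst c \<subseteq> topspace X" using o by (rule openin_subset)
  then show t: "topspace (subtopology X (fst c)) = fst c" by auto
  show "inj_on (snd c) (fst c)"
    using homeomorphic_imp_injective_map[OF h] t by simp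
qed

lemma topspace_charts: "topspace X = (\<Union>c\<in>A. fst c)"
  using smooth_manifold by (simp add: smooth_manifold_def)

lemma chart_inv_eq: "c \<in> A \<Longrightarrow> p \<in> fst c \<Longrightarrow> chart_inv c (snd c p) = p"
  unfolding chart_inv_def by (rule inv_into_f_f[OF chart_inj])

lemma chart_inv_in: "x \<in> coords c \<Longrightarrow> chart_inv c x \<in> fst c"
  unfolding chart_inv_def coords_def by (rule inv_into_into)

lemma chart_of_chart_inv: "x \<in> coords c \<Longrightarrow> snd c (chart_inv c x) = x"
  unfolding chart_inv_def coords_def by (rule f_inv_into_f)

lemma open_chart_image:
  assumes "c \<in> A" "openin X U" "U \<subseteq> fst c"
  shows "open (snd c ` U)"
proof -
  have "openin (subtopology X (fst c)) U"
    using assms open_domain openin_open_subtopology by blast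
  then have "openin (top_of_set (coords c)) (snd c ` U)"
    using homeomorphic_map_openness_eq[OF chart_homeo[OF assms(1)]] by blast
  then show ?thesis using open_coords[OF assms(1)] openin_open_eq by blast
qed

lemma open_chart_preimage:
  assumes "c \<in> A" "open V" "V \<subseteq> coords c"
  shows "openin X {p \<in> fst c. snd c p \<in> V}"
proof -
  have "snd c ` {p \<in> fst c. snd c p \<in> V} = V"
    using assms(3) by (auto simp: coords_def)
  moreover have "openin (top_of_set (coords c)) V"
    using assms open_coords openin_open_eq by blast
  ultimately have "openin (subtopology X (fst c)) {p \<in> fst c. snd c p \<in> V}"
    using homeomorphic_map_openness_eq[OF chart_homeo[OF assms(1)]] topspace_chart[OF assms(1)] by auto
  then show ?thesis
    using assms(1) open_domain openin_open_subtopology by blast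
qed

lemma compact_chart_image:
  assumes "c \<in> A" "compactin X K" "K \<subseteq> fst c"
  shows "compact (snd c ` K)"
proof -
  have "compactin (subtopology X (fst c)) K"
    using assms by (simp add: compactin_subtopology)
  then have "compactin (top_of_set (coords c)) (snd c ` K)"
    using homeomorphic_map_compactness_eq[OF chart_homeo[OF assms(1)]] by blast
  then show ?thesis by (simp add: compactin_subtopology)
qed

lemma compact_chart_preimage:
  assumes "c \<in> A" "compact L" "L \<subseteq> coords c"
  shows "compactin X {p \<in> fst c. snd c p \<in> L}"
proof -
  have "snd c ` {p \<in> fst c. snd c p \<in> L} = L"
    using assms(3) by (auto simp: coords_def)
  moreover have "compactin (top_of_set (coords c)) L"
    using assms by (simp add: compactin_subtopology)
  ultimately have "compactin (subtopology X (fst c)) {p \<in> fst c. snd c p \<in> L}"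
    using homeomorphic_map_compactness_eq[OF chart_homeo[OF assms(1)]] topspace_chart[OF assms(1)] by auto
  then show ?thesis by (simp add: compactin_subtopology)
qed

lemma Hausdorff: "Hausdorff_space X"
  using smooth_manifold by (simp add: smooth_manifold_def)

lemma overlap_subset: "overlap c d \<subseteq> coords c"
  by (auto simp: overlap_def coords_def)

lemma open_overlap: "c \<in> A \<Longrightarrow> d \<in> A \<Longrightarrow> open (overlap c d)"
  unfolding overlap_def by (rule open_chart_image) (auto intro: open_domain)

lemma overlapI: "p \<in> fst c \<Longrightarrow> p \<in> fst d \<Longrightarrow> snd c p \<in> overlap c d"
  by (auto simp: overlap_def)

lemma overlapE:
  assumes "x \<in> overlap c d" "c \<in> A"
  obtains p where "p \<in> fst c" "p \<in> fst d" "x = snd c p" "chart_inv c x = p" "transition c d x = snd d p"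
proof -
  obtain p where p: "p \<in> fst c" "p \<in> fst d" "x = snd c p"
    using assms(1) by (auto simp: overlap_def)
  have i: "chart_inv c x = p" using chart_inv_eq[OF assms(2) p(1)] p(3) by simp
  show ?thesis by (rule that[OF p i]) (simp add: transition_def i)
qed

lemma transition_in_overlap:
  assumes "c \<in> A" "x \<in> overlap c d" shows "transition c d x \<in> overlap d c"
  using assms(2,1) by (rule overlapE) (simp add: overlapI)

lemma chart_inv_transition:
  assumes "c \<in> A" "d \<in> A" "x \<in> overlap c d"
  shows "chart_inv d (transition c d x) = chart_inv c x"
  using assms(3,1) by (rule overlapE) (simp add: chart_inv_eq[OF assms(2)])

lemma transition_transition:
  assumes "c \<in> A" "d \<in> A" "x \<in> overlap c d"
  shows "transition d c (transition c d x) = x"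
  using assms(3,1) by (rule overlapE) (simp add: transition_def[of d c] chart_inv_eq[OF assms(2)])

lemma smooth_transition:
  "c \<in> A \<Longrightarrow> d \<in> A \<Longrightarrow> smooth_on (overlap c d) (\<lambda>x. transition c d x $ k)"
  using smooth_manifold by (simp add: smooth_manifold_def overlap_def)

lemma transition_differentiable:
  "c \<in> A \<Longrightarrow> d \<in> A \<Longrightarrow> x \<in> overlap c d \<Longrightarrow> (\<lambda>x. transition c d x $ k) differentiable (at x)"
  using smooth_transition smooth_on_differentiable by blast

lemma smooth_jac: "c \<in> A \<Longrightarrow> d \<in> A \<Longrightarrow> smooth_on (overlap c d) (\<lambda>x. jac c d x k i)"
  unfolding jac_def using smooth_on_pd[OF smooth_transition] by simp

lemma has_derivative_transition:
  assumes "c \<in> A" "d \<in> A" "x \<in> overlap c d"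
  shows "(transition c d has_derivative (\<lambda>h. jacm c d x *v h)) (at x)"
proof -
  have "(transition c d has_derivative
      (\<lambda>h. \<chi> k. frechet_derivative (\<lambda>y. transition c d y $ k) (at x) h)) (at x)"
    by (rule differentiable_components) (use transition_differentiable assms in blast)
  moreover have "frechet_derivative (\<lambda>y. transition c d y $ k) (at x) h = (jacm c d x *v h) $ k" for k h
    using frechet_derivative_at[OF has_derivative_pd[OF transition_differentiable[OF assms]], of k]
    by (simp add: jacm_def jac_def matrix_vector_mult_def mult.commute fun_eq_iff)
  ultimately show ?thesis by simp
qed

lemma pd_pullback:
  assumes "c \<in> A" "d \<in> A" "x \<in> overlap c d" "f differentiable (at (transition c d x))"
  shows "pd i (\<lambda>x. f (transition c d x)) x = (\<Sum>k\<in>UNIV. jac c d x k i * pd k f (transition c d x))"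
    and "(\<lambda>x. f (transition c d x)) differentiable (at x)"
  using pd_chain[where f=f and T="transition c d" and y=x] transition_differentiable[OF assms(1-3)] assms(4)
  by (auto simp: jac_def mult.commute)

lemma jacm_inverse:
  assumes "c \<in> A" "d \<in> A" "x \<in> overlap c d"
  shows "jacm d c (transition c d x) ** jacm c d x = mat 1"
proof -
  have "(jacm d c (transition c d x) ** jacm c d x) $ k $ i = mat 1 $ k $ i" for k i
  proof -
    have "pd i (\<lambda>x. transition d c (transition c d x) $ k) x
        = (\<Sum>l\<in>UNIV. jac c d x l i * jac d c (transition c d x) k l)"
      using pd_pullback(1)[OF assms, where f="\<lambda>y. transition d c y $ k" and i=i]
        transition_differentiable[OF assms(2,1) transition_in_overlap[OF assms(1,3)]]
      by (simp add: jac_def)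
    moreover have "pd i (\<lambda>x. transition d c (transition c d x) $ k) x = pd i (\<lambda>x. x $ k) x"
      by (rule pd_cong[OF open_overlap[OF assms(1,2)] assms(3)])
         (simp add: transition_transition assms(1,2))
    ultimately show ?thesis
      by (simp add: matrix_matrix_mult_def jacm_def mat_def pd_component mult.commute)
  qed
  then show ?thesis by (simp add: vec_eq_iff)
qed


section \<open>Partitions of unity\<close>

definition smooth_function :: "('a \<Rightarrow> real) \<Rightarrow> bool" where
  "smooth_function f \<longleftrightarrow> (\<forall>d\<in>A. smooth_on (coords d) (\<lambda>x. f (chart_inv d x)))"

end

text \<open>The functions \<open>t\<^sup>-\<^sup>j exp (-1/t)\<close>, continued by zero: differentiation maps their span into itself,
  so that smoothness of all of them follows by a single induction.\<close>

definition flat :: "nat \<Rightarrow> real \<Rightarrow> real" where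
  "flat j t = (if t > 0 then (1 / t) ^ j * exp (- (1 / t)) else 0)"

lemma flat_tendsto_0: "(flat j \<longlongrightarrow> 0) (at 0)"
proof (rule filterlim_split_at)
  show "(flat j \<longlongrightarrow> 0) (at_left 0)"
    by (rule tendsto_eventually) (auto simp: flat_def eventually_at_filter)
  have "((\<lambda>t. (1 / t) ^ j / exp (1 / t)) \<longlongrightarrow> 0) (at_right (0::real))"
    using filterlim_compose[OF tendsto_power_div_exp_0[of j] filterlim_inverse_at_top_right]
    by (simp add: inverse_eq_divide)
  then show "(flat j \<longlongrightarrow> 0) (at_right 0)"
    by (rule Lim_transform_eventually) (auto simp: flat_def eventually_at_filter exp_minus field_simps)
qed

lemma flat_deriv: "(flat j has_real_derivative flat (j + 2) t - real j * flat (j + 1) t) (at t)"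
proof -
  consider "t > 0" | "t < 0" | "t = 0" by linarith
  then show ?thesis
  proof cases
    case 1
    have "((\<lambda>t. (1 / t) ^ j * exp (- (1 / t))) has_real_derivative
        flat (j + 2) t - real j * flat (j + 1) t) (at t)"
      using 1 by (auto intro!: derivative_eq_intros simp: flat_def)
        (cases j; simp add: field_simps power2_eq_square)
    then show ?thesis
      by (rule DERIV_cong_ev[THEN iffD1, rotated 3])
        (use 1 in \<open>auto simp: flat_def eventually_nhds_metric dist_real_def intro!: exI[of _ t]\<close>)
  next
    case 2
    have "((\<lambda>t. 0) has_real_derivative flat (j + 2) t - real j * flat (j + 1) t) (at t)"
      using 2 by (simp add: flat_def)
    then show ?thesis
      by (rule DERIV_cong_ev[THEN iffD1, rotated 3])
        (use 2 in \<open>auto simp: flat_def eventually_nhds_metric dist_real_def intro!: exI[of _ "-t"]\<close>)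
  next
    case 3
    have "((\<lambda>h. (flat j (0 + h) - flat j 0) / h) \<longlongrightarrow> 0) (at 0)"
      by (rule Lim_transform_eventually[OF flat_tendsto_0[of "Suc j"]])
        (auto simp: flat_def eventually_at_filter)
    then show ?thesis using 3 by (simp add: DERIV_def flat_def)
  qed
qed

lemma smooth_on_flat:
  assumes "open S" "smooth_on S u"
  shows "smooth_on S (\<lambda>x. flat j (u x))"
proof -
  have "Ck_on k S (\<lambda>x. flat j (u x))" for k
  proof (induction k arbitrary: j)
    case 0
    have "continuous_on UNIV (flat j)"
      by (intro continuous_at_imp_continuous_on ballI) (rule DERIV_isCont[OF flat_deriv])
    then show ?case
      using continuous_on_compose2[OF _ smooth_on_continuous[OF assms(2)]] by auto
  next
    case (Suc k)
    have "Ck_on k S (pd i (\<lambda>x. flat j (u x)))" for i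
    proof (subst Ck_on_cong[OF assms(1)])
      show "pd i (\<lambda>x. flat j (u x)) x
          = (flat (j + 2) (u x) + (- real j) * flat (j + 1) (u x)) * pd i u x" if "x \<in> S" for x
        using pd_compose_real(1)[OF flat_deriv smooth_on_differentiable[OF assms(2) that]] by simp
      show "Ck_on k S (\<lambda>x. (flat (j + 2) (u x) + (- real j) * flat (j + 1) (u x)) * pd i u x)"
        by (intro Ck_on_mult[OF assms(1)] Ck_on_add[OF assms(1)] Suc.IH Ck_on_const
            smooth_on_imp_Ck smooth_on_pd assms(2))
    qed
    moreover have "(\<lambda>x. flat j (u x)) differentiable (at x)" if "x \<in> S" for x
      by (rule pd_compose_real(2)[OF flat_deriv smooth_on_differentiable[OF assms(2) that]])
    ultimately show ?case by simp
  qed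
  then show ?thesis by (simp add: smooth_on_def)
qed

context manifold
begin

text \<open>The function is \<open>flat 0\<close> of \<open>r\<^sup>2 - |z - a|\<^sup>2\<close> in a chart around \<open>p\<close>, extended by zero. It is smooth
  everywhere because its support is compact, hence closed in the Hausdorff space \<open>X\<close>, so that its
  complement and the chart domain are an open cover.\<close>

lemma bump_function:
  assumes "p \<in> topspace X"
  shows "\<exists>c b U K. c \<in> A \<and> openin X U \<and> p \<in> U \<and> compactin X K \<and> K \<subseteq> fst c \<and>
    (\<forall>q. b q \<ge> 0) \<and> (\<forall>q\<in>U. b q > 0) \<and> (\<forall>q. q \<notin> K \<longrightarrow> b q = 0) \<and> smooth_function b"
proof -
  obtain c where c: "c \<in> A" "p \<in> fst c" using assms topspace_charts by auto
  let ?a = "snd c p"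
  have "?a \<in> coords c" using c by (auto simp: coords_def)
  then obtain r where r: "r > 0" "cball ?a r \<subseteq> coords c"
    using open_coords[OF c(1)] open_contains_cball by blast
  define u where "u z = r\<^sup>2 - (\<Sum>k\<in>UNIV. (z $ k - ?a $ k) * (z $ k - ?a $ k))" for z
  define b where "b q = (if q \<in> fst c then flat 0 (u (snd c q)) else 0)" for q
  have u_dist: "u z = r\<^sup>2 - (dist ?a z)\<^sup>2" for z
    by (subst dist_commute) (simp add: u_def dist_norm norm_vec_def L2_set_def sum_nonneg power2_eq_square)
  have u_pos: "u z > 0 \<longleftrightarrow> z \<in> ball ?a r" for z
    using r(1) by (simp add: u_dist power2_less_imp_less abs_le_square_iff[symmetric] linorder_not_le[symmetric])
  define U where "U = {q \<in> fst c. snd c q \<in> ball ?a r}"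
  define K where "K = {q \<in> fst c. snd c q \<in> cball ?a r}"
  have ball: "ball ?a r \<subseteq> coords c" using r(2) by auto
  have K: "compactin X K" "K \<subseteq> fst c"
    unfolding K_def using compact_chart_preimage[OF c(1) _ r(2)] by auto
  have U: "openin X U" "p \<in> U"
    unfolding U_def using open_chart_preimage[OF c(1) _ ball] c r by auto
  have bK: "b q = 0" if "q \<notin> K" for q
    using that u_pos[of "snd c q"] by (auto simp: b_def K_def flat_def)
  have "smooth_on (coords d) (\<lambda>x. b (chart_inv d x))" if d: "d \<in> A" for d
  proof -
    let ?V = "snd d ` (fst d - K)"
    have "openin X (fst d - K)"
      using compactin_imp_closedin[OF Hausdorff K(1)] open_domain[OF d] by blast
    then have V: "open ?V" by (rule open_chart_image[OF d]) auto
    have "smooth_on ?V (\<lambda>x. b (chart_inv d x)) \<longleftrightarrow> smooth_on ?V (\<lambda>x. 0)"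
      by (rule smooth_on_cong[OF V]) (auto simp: chart_inv_eq[OF d] bK)
    then have sV: "smooth_on ?V (\<lambda>x. b (chart_inv d x))" by simp
    let ?W = "overlap d c"
    have W: "open ?W" by (rule open_overlap[OF d c(1)])
    have "smooth_on ?W (\<lambda>x. flat 0 (u (transition d c x)))"
      unfolding u_def by (intro smooth_on_flat[OF W] smooth_intros smooth_transition W d c)
    moreover have "smooth_on ?W (\<lambda>x. b (chart_inv d x)) \<longleftrightarrow> smooth_on ?W (\<lambda>x. flat 0 (u (transition d c x)))"
      by (rule smooth_on_cong[OF W], erule overlapE[OF _ d]) (auto simp: b_def)
    ultimately have sW: "smooth_on ?W (\<lambda>x. b (chart_inv d x))" by simp
    have "coords d = \<Union>{?V, ?W}"
      using K(2) by (auto simp: coords_def overlap_def)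
    moreover have "smooth_on (\<Union>{?V, ?W}) (\<lambda>x. b (chart_inv d x))"
      by (rule smooth_on_Union) (use V W sV sW in auto)
    ultimately show ?thesis by (simp only:)
  qed
  then have "smooth_function b" by (simp add: smooth_function_def)
  moreover have "\<forall>q\<in>U. b q > 0" using u_pos by (auto simp: U_def b_def flat_def)
  moreover have "\<forall>q. b q \<ge> 0" by (auto simp: b_def flat_def)
  ultimately show ?thesis using c K U bK by blast
qed

text \<open>By compactness finitely many bump functions have a positive sum everywhere. They are grouped by the chart that
  contains their support and divided by their sum.\<close>

theorem partition_of_unity_exists:
  assumes "compact_space X"
  shows "\<exists>C \<rho>. partition_of_unity X A C \<rho>"
proof -
  define P where "P p c b U K \<longleftrightarrow> c \<in> A \<and> openin X U \<and> p \<in> U \<and> compactin X K \<and> K \<subseteq> fst c \<and>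
    (\<forall>q. b q \<ge> 0) \<and> (\<forall>q\<in>U. b q > 0) \<and> (\<forall>q. q \<notin> K \<longrightarrow> b q = 0) \<and> smooth_function b"
    for p and c :: "('a,'m) chart" and b U K
  have "\<forall>p\<in>topspace X. \<exists>c b U K. P p c b U K"
    unfolding P_def using bump_function by blast
  then obtain cc b U K where "\<And>p. p \<in> topspace X \<Longrightarrow> P p (cc p) (b p) (U p) (K p)" by metis
  then have P: "cc p \<in> A" "openin X (U p)" "p \<in> U p" "compactin X (K p)" "K p \<subseteq> fst (cc p)"
    "\<And>q. b p q \<ge> 0" "\<And>q. q \<in> U p \<Longrightarrow> b p q > 0" "\<And>q. q \<notin> K p \<Longrightarrow> b p q = 0"
    "smooth_function (b p)" if "p \<in> topspace X" for p
    using that unfolding P_def by blast+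
  have "compactin X (topspace X)" using assms by (simp add: compact_space_def)
  moreover have "\<forall>V\<in>U ` topspace X. openin X V" "topspace X \<subseteq> \<Union>(U ` topspace X)"
    using P by auto
  ultimately obtain \<F> where "finite \<F>" "\<F> \<subseteq> U ` topspace X" "topspace X \<subseteq> \<Union>\<F>"
    unfolding compactin_def by blast
  then obtain F where F: "finite F" "F \<subseteq> topspace X" "topspace X \<subseteq> \<Union>(U ` F)"
    using finite_subset_image by metis
  define S where "S q = (\<Sum>p\<in>F. b p q)" for q
  define \<rho> where "\<rho> c q = (\<Sum>p\<in>{p\<in>F. cc p = c}. b p q) / S q" for c q
  have S_pos: "S q > 0" if q: "q \<in> topspace X" for q
  proof -
    obtain p where p: "p \<in> F" "q \<in> U p" using F q by auto
    then have "b p q > 0" using P F by auto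
    then show ?thesis unfolding S_def
      using F p P(6) by (intro sum_pos2[of F p]) auto
  qed
  have topd: "chart_inv d x \<in> topspace X" if "d \<in> A" "x \<in> coords d" for d x
    using chart_inv_in[OF that(2)] domain_subset[OF that(1)] by auto
  have sm: "smooth_on (coords d) (\<lambda>x. b p (chart_inv d x))" if "d \<in> A" "p \<in> F" for d p
    using P(9)[of p] F that by (auto simp: smooth_function_def)
  have "partition_of_unity X A (cc ` F) \<rho>"
    unfolding partition_of_unity_def
  proof (intro conjI ballI)
    show "finite (cc ` F)" "cc ` F \<subseteq> A" using F P by auto
  next
    fix c q assume "q \<in> topspace X"
    then show "\<rho> c q \<ge> 0" unfolding \<rho>_def
      using S_pos[of q] F P(6) by (intro divide_nonneg_pos sum_nonneg) auto
  next
    fix c assume "c \<in> cc ` F"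
    let ?F = "{p\<in>F. cc p = c}"
    have "closedin X (\<Union>(K ` ?F))"
      using F P(4) compactin_imp_closedin[OF Hausdorff] by (intro closedin_Union) auto
    moreover have "{p \<in> topspace X. \<rho> c p \<noteq> 0} \<subseteq> \<Union>(K ` ?F)"
    proof
      fix q assume "q \<in> {p \<in> topspace X. \<rho> c p \<noteq> 0}"
      then have "(\<Sum>p\<in>?F. b p q) \<noteq> 0" by (auto simp: \<rho>_def)
      then obtain p where p: "p \<in> ?F" "b p q \<noteq> 0" by (meson sum.neutral)
      then have "q \<in> K p" using P(8)[of p q] F(2) by auto
      then show "q \<in> \<Union>(K ` ?F)" using p(1) by blast
    qed
    ultimately have "X closure_of {p \<in> topspace X. \<rho> c p \<noteq> 0} \<subseteq> \<Union>(K ` ?F)"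
      by (rule closure_of_minimal[rotated])
    also have "\<dots> \<subseteq> fst c" using P(5) F by blast
    finally show "X closure_of {p \<in> topspace X. \<rho> c p \<noteq> 0} \<subseteq> fst c" .
  next
    fix c d assume d: "d \<in> A"
    show "smooth_on (coords d) (\<lambda>x. \<rho> c (chart_inv d x))"
      unfolding \<rho>_def S_def
      using S_pos[OF topd[OF d], unfolded S_def] d sm
      by (intro smooth_intros open_coords) (auto simp: less_imp_neq[symmetric])
  next
    fix q assume q: "q \<in> topspace X"
    have "(\<Sum>c\<in>cc ` F. \<Sum>p\<in>{p\<in>F. cc p = c}. b p q) = S q"
      unfolding S_def using F(1) by (rule sum.image_gen[symmetric])
    then show "(\<Sum>c\<in>cc ` F. \<rho> c q) = 1"
      unfolding \<rho>_def sum_divide_distrib[symmetric] using S_pos[OF q] by simp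
  qed
  then show ?thesis by blast
qed

end

section \<open>Pfaffians and top-degree wedge products\<close>

lemma sum_permutations_compose:
  assumes "q permutes S"
  shows "(\<Sum>p | p permutes S. f (p \<circ> q)) = (\<Sum>p | p permutes S. f p)"
  by (rule sum_permutations_compose_right[OF assms, symmetric])

lemma sign_mult_permutes:
  assumes "p permutes S" "q permutes S" "finite S"
  shows "sign (p \<circ> q) = sign p * sign q"
  using assms by (meson permutation_permutes sign_compose)

text \<open>Lets \<open>\<tau>\<close> act on the positions \<open>2, \<dots>, m + 1\<close>, behind the two positions of the first factor.\<close>

definition shift2 :: "nat \<Rightarrow> (nat \<Rightarrow> nat) \<Rightarrow> nat \<Rightarrow> nat" where
  "shift2 m \<tau> = map_permutation {..<m} (\<lambda>i. i + 2) \<tau>"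

lemma shift2:
  assumes "\<tau> permutes {..<m}"
  shows "shift2 m \<tau> permutes {..<m + 2}" and "sign (shift2 m \<tau>) = sign \<tau>"
    and "i < m \<Longrightarrow> shift2 m \<tau> (i + 2) = \<tau> i + 2" and "i < 2 \<Longrightarrow> shift2 m \<tau> i = i"
proof -
  have inj: "inj_on (\<lambda>i. i + 2) {..<m}" by (simp add: inj_on_def)
  have "shift2 m \<tau> permutes (\<lambda>i. i + 2) ` {..<m}"
    unfolding shift2_def by (rule map_permutation_permutes[OF inj_on_imp_bij_betw[OF inj] assms])
  moreover from this show "i < 2 \<Longrightarrow> shift2 m \<tau> i = i" by (rule permutes_not_in) auto
  moreover have "(\<lambda>i. i + 2) ` {..<m} \<subseteq> {..<m + 2}" by auto
  ultimately show "shift2 m \<tau> permutes {..<m + 2}" by (blast intro: permutes_subset)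
  show "sign (shift2 m \<tau>) = sign \<tau>"
    unfolding shift2_def by (rule sign_map_permutation[OF inj assms]) simp
  show "i < m \<Longrightarrow> shift2 m \<tau> (i + 2) = \<tau> i + 2"
    unfolding shift2_def by (rule map_permutation_apply[OF inj]) simp
qed

text \<open>The permutations \<open>\<tau>\<close> of the last \<open>2k\<close> positions, over which the formula for \<open>\<Omega>\<^sup>k\<close> sums, are absorbed
  by the outer alternating sum. Their number cancels the factor \<open>(2k)!\<close> in the normalization of the
  wedge product. The formula for \<open>\<Omega>\<^sup>k\<close> is a hypothesis because the case \<open>\<beta> = \<Omega>\<close> is the step of the
  induction that proves it.\<close>

lemma wedge_with_power:
  fixes \<Omega> \<beta> :: "('a,'m::finite) tfield"
  assumes closed: "\<And>us ls. length ls = 2 * k \<Longrightarrow> wedge_power \<Omega> k c x us ls =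
      (\<Sum>\<sigma> | \<sigma> permutes {..<2*k}. of_int (sign \<sigma>) *
        (\<Prod>a<k. \<Omega> c x [] [ls ! \<sigma> (2*a), ls ! \<sigma> (2*a+1)])) / 2 ^ k"
    and len: "length ls = 2 * k + 2"
  shows "wedge 2 (2*k) \<beta> (wedge_power \<Omega> k) c x us ls =
      (\<Sum>\<sigma> | \<sigma> permutes {..<2*k+2}. of_int (sign \<sigma>) * (\<beta> c x [] [ls ! \<sigma> 0, ls ! \<sigma> 1] *
        (\<Prod>a<k. \<Omega> c x [] [ls ! \<sigma> (2*a+2), ls ! \<sigma> (2*a+3)]))) / 2 ^ (Suc k)"
proof -
  let ?P = "{\<sigma>. \<sigma> permutes {..<2*k+2}}" and ?T = "{\<tau>. \<tau> permutes {..<2*k}}"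
  let ?b = "\<lambda>\<sigma>. \<beta> c x [] [ls ! \<sigma> 0, ls ! \<sigma> 1]"
  let ?w = "\<lambda>\<sigma>. \<Prod>a<k. \<Omega> c x [] [ls ! \<sigma> (2*a+2), ls ! \<sigma> (2*a+3)]"
  let ?G = "\<Sum>\<sigma>\<in>?P. of_int (sign \<sigma>) * (?b \<sigma> * ?w \<sigma>)"
  have take: "take 2 (permute_list \<sigma> ls) = [ls ! \<sigma> 0, ls ! \<sigma> 1]" for \<sigma>
  proof -
    have "take 2 [0..<length ls] = [0, 1]"
      using take_upt[of 0 2 "length ls"] len by (simp add: upt_rec)
    then show ?thesis by (simp add: permute_list_def take_map)
  qed
  have drop: "drop 2 (permute_list \<sigma> ls) ! i = ls ! \<sigma> (i + 2)" if "i < 2*k" for \<sigma> i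
    using len that by (simp add: permute_list_def del: upt_Suc)
  have inner: "wedge_power \<Omega> k c x [] (drop 2 (permute_list \<sigma> ls)) =
      (\<Sum>\<tau>\<in>?T. of_int (sign \<tau>) * ?w (\<sigma> \<circ> shift2 (2*k) \<tau>)) / 2 ^ k" for \<sigma>
  proof -
    have "(\<Prod>a<k. \<Omega> c x [] [drop 2 (permute_list \<sigma> ls) ! \<tau> (2*a), drop 2 (permute_list \<sigma> ls) ! \<tau> (2*a+1)])
        = ?w (\<sigma> \<circ> shift2 (2*k) \<tau>)" if t: "\<tau> permutes {..<2*k}" for \<tau>
    proof (rule prod.cong[OF refl])
      fix a assume "a \<in> {..<k}"
      then have a: "2*a < 2*k" "2*a+1 < 2*k" by auto
      have "\<tau> (2*a) < 2*k" "\<tau> (2*a+1) < 2*k"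
        using permutes_in_image[OF t] a by (metis lessThan_iff)+
      moreover have "shift2 (2*k) \<tau> (2*a+3) = \<tau> (2*a+1) + 2"
        using shift2(3)[OF t a(2)] by (simp add: eval_nat_numeral)
      ultimately show "\<Omega> c x [] [drop 2 (permute_list \<sigma> ls) ! \<tau> (2*a), drop 2 (permute_list \<sigma> ls) ! \<tau> (2*a+1)]
        = \<Omega> c x [] [ls ! (\<sigma> \<circ> shift2 (2*k) \<tau>) (2*a+2), ls ! (\<sigma> \<circ> shift2 (2*k) \<tau>) (2*a+3)]"
        using shift2(3)[OF t a(1)] by (simp add: drop del: add_2_eq_Suc')
    qed
    then show ?thesis using len by (subst closed) (auto intro!: sum.cong arg_cong2[of _ _ _ _ "(/)"])
  qed
  have shifted: "(\<Sum>\<sigma>\<in>?P. of_int (sign \<sigma>) * of_int (sign \<tau>) * (?b \<sigma> * ?w (\<sigma> \<circ> shift2 (2*k) \<tau>))) = ?G"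
    if "\<tau> \<in> ?T" for \<tau>
  proof -
    have t: "\<tau> permutes {..<2*k}" using that by simp
    note s = shift2[OF t]
    have "(\<Sum>\<sigma>\<in>?P. of_int (sign \<sigma>) * of_int (sign \<tau>) * (?b \<sigma> * ?w (\<sigma> \<circ> shift2 (2*k) \<tau>)))
      = (\<Sum>\<sigma>\<in>?P. of_int (sign (\<sigma> \<circ> shift2 (2*k) \<tau>)) *
          (?b (\<sigma> \<circ> shift2 (2*k) \<tau>) * ?w (\<sigma> \<circ> shift2 (2*k) \<tau>)))"
      using s(4)[of 0] s(4)[of 1]
      by (intro sum.cong[OF refl]) (simp add: sign_mult_permutes[OF _ s(1)] s(2))
    also have "\<dots> = ?G" by (rule sum_permutations_compose[OF s(1)])
    finally show ?thesis .
  qed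
  have "wedge 2 (2*k) \<beta> (wedge_power \<Omega> k) c x us ls
      = (\<Sum>\<sigma>\<in>?P. of_int (sign \<sigma>) * ?b \<sigma> *
          ((\<Sum>\<tau>\<in>?T. of_int (sign \<tau>) * ?w (\<sigma> \<circ> shift2 (2*k) \<tau>)) / 2 ^ k)) / (2 * fact (2*k))"
    by (simp add: wedge_def take inner add.commute[of 2])
  also have "\<dots> = (\<Sum>\<sigma>\<in>?P. \<Sum>\<tau>\<in>?T. of_int (sign \<sigma>) * of_int (sign \<tau>) *
      (?b \<sigma> * ?w (\<sigma> \<circ> shift2 (2*k) \<tau>))) / (2 ^ Suc k * fact (2*k))"
    by (simp add: sum_divide_distrib sum_distrib_left field_simps)
  also have "\<dots> = (\<Sum>\<tau>\<in>?T. ?G) / (2 ^ Suc k * fact (2*k))"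
    by (subst sum.swap, simp only: shifted cong: sum.cong)
  also have "\<dots> = ?G / 2 ^ Suc k"
    using card_permutations[of "{..<2*k}" "2*k"] by simp
  finally show ?thesis .
qed

lemma wedge_power_eq_sum:
  fixes \<Omega> :: "('a,'m::finite) tfield"
  assumes "length ls = 2 * k"
  shows "wedge_power \<Omega> k c x us ls = (\<Sum>\<sigma> | \<sigma> permutes {..<2*k}. of_int (sign \<sigma>) *
      (\<Prod>a<k. \<Omega> c x [] [ls ! \<sigma> (2*a), ls ! \<sigma> (2*a+1)])) / 2 ^ k"
  using assms
proof (induction k arbitrary: us ls)
  case (Suc k)
  then have "length ls = 2 * k + 2" by simp
  from wedge_with_power[OF Suc.IH this] show ?case
    by (simp add: prod.lessThan_Suc_shift numeral_3_eq_3 del: prod.lessThan_Suc)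
qed simp

text \<open>With \<open>e\<close> as an enumeration of the index type, \<open>pf W\<close> is \<open>2\<^sup>n n!\<close> times the Pfaffian of \<open>W\<close>. In
  \<open>pfs f\<close> every pair of positions has a matrix of its own, and \<open>pfm \<beta> W\<close> is the polarization in which
  one of the \<open>n\<close> factors \<open>W\<close> is replaced by \<open>\<beta>\<close>.\<close>

locale pairing =
  fixes n :: nat and e :: "nat \<Rightarrow> 'm::finite"
  assumes n: "n \<ge> 1" and e: "bij_betw e {..<2*n} UNIV"
begin

definition pfs :: "(nat \<Rightarrow> 'm \<Rightarrow> 'm \<Rightarrow> real) \<Rightarrow> real" where
  "pfs f = (\<Sum>p | p permutes (UNIV::'m set). of_int (sign p) * (\<Prod>b<n. f b (p (e (2*b))) (p (e (2*b+1)))))"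

definition pfm :: "('m \<Rightarrow> 'm \<Rightarrow> real) \<Rightarrow> ('m \<Rightarrow> 'm \<Rightarrow> real) \<Rightarrow> real" where
  "pfm \<beta> W = pfs (\<lambda>b. if b = 0 then \<beta> else W)"

abbreviation pf :: "('m \<Rightarrow> 'm \<Rightarrow> real) \<Rightarrow> real" where
  "pf W \<equiv> pfs (\<lambda>b. W)"

lemma e_eq_iff: "a < 2*n \<Longrightarrow> b < 2*n \<Longrightarrow> e a = e b \<longleftrightarrow> a = b"
  using e by (auto simp: bij_betw_def inj_on_def)

lemma e_surj: obtains a where "a < 2*n" "i = e a"
  using e by (metis UNIV_I bij_betw_def imageE lessThan_iff)

lemma permutations_positions:
  "bij_betw (map_permutation {..<2*n} e) {\<sigma>. \<sigma> permutes {..<2*n}} {p. p permutes UNIV}"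
proof (rule bij_betw_byWitness[where f'="map_permutation UNIV (inv_into {..<2*n} e)"])
  have inj: "inj_on e {..<2*n}" and im: "e ` {..<2*n} = UNIV" using e by (auto simp: bij_betw_def)
  have ie: "bij_betw (inv_into {..<2*n} e) UNIV {..<2*n}" by (rule bij_betw_inv_into[OF e])
  show "\<forall>\<sigma>\<in>{\<sigma>. \<sigma> permutes {..<2*n}}.
      map_permutation UNIV (inv_into {..<2*n} e) (map_permutation {..<2*n} e \<sigma>) = \<sigma>"
    by (intro ballI map_permutation_compose_inv[OF e]) (use inj in auto)
  show "\<forall>p\<in>{p. p permutes UNIV}.
      map_permutation {..<2*n} e (map_permutation UNIV (inv_into {..<2*n} e) p) = p"
    by (intro ballI map_permutation_compose_inv[OF ie]) (simp_all add: f_inv_into_f im)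
  show "map_permutation {..<2*n} e ` {\<sigma>. \<sigma> permutes {..<2*n}} \<subseteq> {p. p permutes UNIV}"
    using map_permutation_permutes[OF e] by blast
  show "map_permutation UNIV (inv_into {..<2*n} e) ` {p. p permutes UNIV} \<subseteq> {\<sigma>. \<sigma> permutes {..<2*n}}"
    using map_permutation_permutes[OF ie] by blast
qed

lemma pfs_positions:
  "pfs f = (\<Sum>\<sigma> | \<sigma> permutes {..<2*n}. of_int (sign \<sigma>) * (\<Prod>b<n. f b (e (\<sigma> (2*b))) (e (\<sigma> (2*b+1)))))"
proof -
  have inj: "inj_on e {..<2*n}" using e by (auto simp: bij_betw_def)
  let ?m = "map_permutation {..<2*n} e"
  have "pfs f = (\<Sum>\<sigma> | \<sigma> permutes {..<2*n}. of_int (sign (?m \<sigma>)) *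
      (\<Prod>b<n. f b (?m \<sigma> (e (2*b))) (?m \<sigma> (e (2*b+1)))))"
    unfolding pfs_def by (rule sum.reindex_bij_betw[OF permutations_positions, symmetric])
  also have "\<dots> = (\<Sum>\<sigma> | \<sigma> permutes {..<2*n}. of_int (sign \<sigma>) * (\<Prod>b<n. f b (e (\<sigma> (2*b))) (e (\<sigma> (2*b+1)))))"
    by (intro sum.cong prod.cong arg_cong2[of _ _ _ _ "(*)"])
      (auto simp: sign_map_permutation[OF inj] map_permutation_apply[OF inj])
  finally show ?thesis .
qed

abbreviation swap_in_pair :: "nat \<Rightarrow> 'm \<Rightarrow> 'm" where
  "swap_in_pair a \<equiv> Transposition.transpose (e (2*a)) (e (2*a+1))"

definition swap_pairs :: "nat \<Rightarrow> nat \<Rightarrow> 'm \<Rightarrow> 'm" where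
  "swap_pairs a b = Transposition.transpose (e (2*a)) (e (2*b)) \<circ> Transposition.transpose (e (2*a+1)) (e (2*b+1))"

lemma swap_pairs:
  assumes "a < n" "b < n"
  shows "swap_pairs a b permutes UNIV" and "sign (swap_pairs a b) = 1"
    and "d < n \<Longrightarrow> swap_pairs a b (e (2*d)) = e (2 * Transposition.transpose a b d)"
    and "d < n \<Longrightarrow> swap_pairs a b (e (2*d+1)) = e (2 * Transposition.transpose a b d + 1)"
proof -
  have t: "Transposition.transpose i j permutes UNIV" for i j :: 'm by (simp add: permutes_swap_id)
  show "swap_pairs a b permutes UNIV"
    unfolding swap_pairs_def by (rule permutes_compose) (rule t)+
  show "sign (swap_pairs a b) = 1"
    unfolding swap_pairs_def sign_mult_permutes[OF t t finite]
    using assms by (simp add: sign_swap_id e_eq_iff)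
  have odd: "2*i \<noteq> Suc (2*j)" for i j :: nat by presburger
  show "d < n \<Longrightarrow> swap_pairs a b (e (2*d)) = e (2 * Transposition.transpose a b d)"
    using assms odd odd[THEN not_sym] unfolding swap_pairs_def
    by (auto simp: Transposition.transpose_def e_eq_iff)
  show "d < n \<Longrightarrow> swap_pairs a b (e (2*d+1)) = e (2 * Transposition.transpose a b d + 1)"
    using assms odd odd[THEN not_sym] unfolding swap_pairs_def
    by (auto simp: Transposition.transpose_def e_eq_iff)
qed

text \<open>Exchanging two pairs is an even permutation, so the order of the factors is irrelevant.\<close>

lemma pfs_summand_swap_pairs:
  assumes "a < n" "b < n" "p permutes UNIV"
  shows "of_int (sign (p \<circ> swap_pairs a b)) *
      (\<Prod>d<n. f d ((p \<circ> swap_pairs a b) (e (2*d))) ((p \<circ> swap_pairs a b) (e (2*d+1))))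
    = of_int (sign p) * (\<Prod>d<n. f (Transposition.transpose a b d) (p (e (2*d))) (p (e (2*d+1))) :: real)"
proof -
  note s = swap_pairs[OF assms(1,2)]
  have t: "Transposition.transpose a b permutes {..<n}" using assms by (simp add: permutes_swap_id)
  have "(\<Prod>d<n. f d ((p \<circ> swap_pairs a b) (e (2*d))) ((p \<circ> swap_pairs a b) (e (2*d+1))))
    = (\<Prod>d<n. f (Transposition.transpose a b (Transposition.transpose a b d)) (p (e (2 * Transposition.transpose a b d))) (p (e (2 * Transposition.transpose a b d + 1))))"
    using s(3,4) by (intro prod.cong[OF refl]) simp
  also have "\<dots> = (\<Prod>d<n. f (Transposition.transpose a b d) (p (e (2*d))) (p (e (2*d+1))))"
    using prod.permute[OF t, of "\<lambda>d. f (Transposition.transpose a b d) (p (e (2*d))) (p (e (2*d+1)))"]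
    by (simp add: o_def)
  finally show ?thesis using sign_mult_permutes[OF assms(3) s(1)] s(2) by simp
qed

lemma pfs_swap_pairs:
  assumes "a < n" "b < n" shows "pfs f = pfs (\<lambda>d. f (Transposition.transpose a b d))"
proof -
  have "pfs f = (\<Sum>p | p permutes UNIV. of_int (sign (p \<circ> swap_pairs a b)) *
      (\<Prod>d<n. f d ((p \<circ> swap_pairs a b) (e (2*d))) ((p \<circ> swap_pairs a b) (e (2*d+1)))))"
    unfolding pfs_def by (rule sum_permutations_compose[OF swap_pairs(1)[OF assms], symmetric])
  also have "\<dots> = pfs (\<lambda>d. f (Transposition.transpose a b d))"
    unfolding pfs_def using pfs_summand_swap_pairs[OF assms] by (intro sum.cong[OF refl]) blast
  finally show ?thesis .
qed

lemma pfs_one_factor: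
  assumes "a < n" shows "pfs (\<lambda>b. if b = a then \<beta> else W) = pfm \<beta> W"
proof -
  have "pfs (\<lambda>b. if b = a then \<beta> else W) = pfs (\<lambda>d. if Transposition.transpose 0 a d = a then \<beta> else W)"
    using n assms by (intro pfs_swap_pairs) auto
  also have "\<dots> = pfm \<beta> W"
    unfolding pfm_def by (rule arg_cong[of _ _ pfs]) (auto simp: Transposition.transpose_def fun_eq_iff)
  finally show ?thesis .
qed

lemma prod_pairs: "(\<Prod>b<n. z (e (2*b)) * z (e (2*b+1))) = (\<Prod>i\<in>UNIV. z i :: real)"
proof -
  have "(\<Prod>b<m. z (e (2*b)) * z (e (2*b+1))) = (\<Prod>r<2*m. z (e r))" for m
    by (induction m) (simp_all add: mult_ac)
  then show ?thesis using prod.reindex_bij_betw[OF e, of z] by simp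
qed

lemma pfm_expand: "pfm \<beta> W = (\<Sum>p | p permutes UNIV. of_int (sign p) *
    (\<beta> (p (e 0)) (p (e 1)) * (\<Prod>b\<in>{1..<n}. W (p (e (2*b))) (p (e (2*b+1))))))"
proof -
  have n0: "{..<n} = insert 0 {1..<n}" using n by auto
  have "(\<Prod>b<n. (if b = 0 then \<beta> else W) (p (e (2*b))) (p (e (2*b+1))))
    = \<beta> (p (e 0)) (p (e 1)) * (\<Prod>b\<in>{1..<n}. W (p (e (2*b))) (p (e (2*b+1))))" for p
    unfolding n0 by (subst prod.insert) (auto intro!: prod.cong)
  then show ?thesis unfolding pfm_def pfs_def by simp
qed

lemma pfm_linear:
  "pfm (\<lambda>i j. \<Sum>s\<in>S. c s * \<beta> s i j) W = (\<Sum>s\<in>S. c s * pfm (\<beta> s) W)"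
proof -
  let ?w = "\<lambda>p. \<Prod>b\<in>{1..<n}. W (p (e (2*b))) (p (e (2*b+1)))"
  have "pfm (\<lambda>i j. \<Sum>s\<in>S. c s * \<beta> s i j) W = (\<Sum>p | p permutes UNIV. \<Sum>s\<in>S.
      c s * (of_int (sign p) * (\<beta> s (p (e 0)) (p (e 1)) * ?w p)))"
    unfolding pfm_expand by (simp add: sum_distrib_left sum_distrib_right mult_ac)
  then show ?thesis unfolding pfm_expand by (subst (asm) sum.swap) (simp add: sum_distrib_left)
qed

lemma permutes_transpose_UNIV: "Transposition.transpose i j permutes (UNIV::'m set)"
  by (simp add: permutes_swap_id)

lemma sum_permutations_antisym:
  fixes f :: "('m \<Rightarrow> 'm) \<Rightarrow> real"
  assumes "q permutes UNIV" "\<And>p. p permutes UNIV \<Longrightarrow> f (p \<circ> q) = - f p"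
  shows "(\<Sum>p | p permutes UNIV. f p) = 0"
proof -
  have "(\<Sum>p | p permutes UNIV. f p) = (\<Sum>p | p permutes UNIV. f (p \<circ> q))"
    by (rule sum_permutations_compose[OF assms(1), symmetric])
  also have "\<dots> = - (\<Sum>p | p permutes UNIV. f p)"
    using assms(2) by (simp add: sum_negf)
  finally show ?thesis by simp
qed

definition cofactor :: "('m \<Rightarrow> 'm \<Rightarrow> real) \<Rightarrow> 'm \<Rightarrow> 'm \<Rightarrow> real" where
  "cofactor W a b = pfm (\<lambda>i j. of_bool (i = a \<and> j = b)) W"

lemma pfm_cofactor: "pfm \<beta> W = (\<Sum>a\<in>UNIV. \<Sum>b\<in>UNIV. \<beta> a b * cofactor W a b)"
proof -
  have exp: "\<beta> i j = (\<Sum>s\<in>UNIV. \<beta> (fst s) (snd s) * of_bool (i = fst s \<and> j = snd s))" for i j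
  proof -
    have "(\<Sum>s\<in>UNIV. \<beta> (fst s) (snd s) * of_bool (i = fst s \<and> j = snd s))
      = (\<Sum>s\<in>UNIV. if s = (i, j) then \<beta> i j else 0)"
      by (rule sum.cong) (auto simp: prod_eq_iff)
    then show ?thesis by simp
  qed
  have "pfm \<beta> W = pfm (\<lambda>i j. \<Sum>s\<in>UNIV. \<beta> (fst s) (snd s) * of_bool (i = fst s \<and> j = snd s)) W"
    by (rule arg_cong[where f="\<lambda>\<beta>. pfm \<beta> W"], intro ext) (rule exp)
  also have "\<dots> = (\<Sum>s\<in>UNIV. \<beta> (fst s) (snd s) * cofactor W (fst s) (snd s))"
    unfolding cofactor_def by (rule pfm_linear)
  also have "\<dots> = (\<Sum>a\<in>UNIV. \<Sum>b\<in>UNIV. \<beta> a b * cofactor W a b)"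
    by (simp add: sum.cartesian_product case_prod_beta)
  finally show ?thesis .
qed

lemma cofactor_row: "(\<Sum>b\<in>UNIV. cofactor W a b * W c b) = pfm (\<lambda>i j. of_bool (i = a) * W c j) W"
proof -
  have exp: "of_bool (i = a) * W c j = (\<Sum>b\<in>UNIV. W c b * of_bool (i = a \<and> j = b))" for i j
    by (cases "i = a") (simp_all add: of_bool_def if_distrib[of "(*) _"] cong: if_cong)
  have "pfm (\<lambda>i j. of_bool (i = a) * W c j) W
      = pfm (\<lambda>i j. \<Sum>b\<in>UNIV. W c b * of_bool (i = a \<and> j = b)) W"
    by (rule arg_cong[where f="\<lambda>\<beta>. pfm \<beta> W"], intro ext) (rule exp)
  then show ?thesis unfolding cofactor_def by (simp only: pfm_linear mult.commute)
qed

text \<open>For \<open>c \<noteq> a\<close>, group the arrangements according to the position \<open>s\<close> of \<open>c\<close>. Its partner and the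
  index in the second position are both paired with \<open>c\<close>, so exchanging them changes only the sign of
  the arrangement.\<close>

lemma cofactor_row_off_diagonal:
  assumes anti: "\<And>i j. W i j = - W j i" and ne: "c \<noteq> a"
  shows "(\<Sum>b\<in>UNIV. cofactor W a b * W c b) = 0"
proof -
  let ?w = "\<lambda>p. \<Prod>b\<in>{1..<n}. W (p (e (2*b))) (p (e (2*b+1)))"
  let ?f = "\<lambda>s p. of_int (sign p) * (of_bool (p (e 0) = a) * W c (p (e 1)) * ?w p) * of_bool (p s = c)"
  have "(\<Sum>b\<in>UNIV. cofactor W a b * W c b) = (\<Sum>p | p permutes UNIV. \<Sum>s\<in>UNIV. ?f s p)"
    unfolding cofactor_row pfm_expand
  proof (rule sum.cong[OF refl])
    fix p :: "'m \<Rightarrow> 'm" assume "p \<in> {p. p permutes UNIV}"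
    then have "bij p" by (simp add: permutes_bij)
    then have "p s = c \<longleftrightarrow> s = inv p c" for s by (metis bij_inv_eq_iff)
    then have "(\<Sum>s\<in>UNIV. of_bool (p s = c) :: real) = 1" by (simp add: of_bool_def)
    then show "of_int (sign p) * (of_bool (p (e 0) = a) * W c (p (e 1)) * ?w p) = (\<Sum>s\<in>UNIV. ?f s p)"
      by (simp only: sum_distrib_left[symmetric] mult_1_right)
  qed
  also have "\<dots> = (\<Sum>s\<in>UNIV. \<Sum>p | p permutes UNIV. ?f s p)" by (rule sum.swap)
  also have "\<dots> = 0"
  proof (rule sum.neutral, rule ballI)
    fix s :: 'm
    obtain r where r: "r < 2*n" "s = e r" by (rule e_surj)
    have Wcc: "W c c = 0" using anti[of c c] by simp
    show "(\<Sum>p | p permutes UNIV. ?f s p) = 0"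
    proof (cases "r < 2")
      case True
      then have "r = 0 \<or> r = 1" by auto
      then have "?f s p = 0" for p using ne Wcc r by auto
      then show ?thesis by (intro sum.neutral) blast
    next
      case False
      define d where "d = r div 2"
      define r' where "r' = (if even r then r + 1 else r - 1)"
      have d: "d \<in> {1..<n}" using False r(1) by (auto simp: d_def)
      have rd: "(r = 2*d \<and> r' = 2*d+1) \<or> (r = 2*d+1 \<and> r' = 2*d)"
        unfolding d_def r'_def by (cases "even r") auto
      let ?t = "Transposition.transpose (e 1) (e r')"
      have t: "?t permutes UNIV" by (rule permutes_transpose_UNIV)
      have eqs: "?t (e i) = e i" if "i < 2*n" "i \<noteq> 1" "i \<noteq> r'" for i
        using that rd d n by (intro transpose_apply_other) (auto simp: e_eq_iff)
      have t1: "?t (e 1) = e r'" "?t (e r') = e 1" by auto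
      have sgn: "sign ?t = -1" using rd d n by (auto simp: sign_swap_id e_eq_iff)
      have r'2: "r' \<ge> 2" "r \<ge> 2" using rd d by auto
      show ?thesis
      proof (rule sum_permutations_antisym[OF t])
        fix p :: "'m \<Rightarrow> 'm" assume p: "p permutes UNIV"
        let ?D = "{1..<n} - {d}"
        let ?v = "\<lambda>p. \<Prod>b\<in>?D. W (p (e (2*b))) (p (e (2*b+1)))"
        have split: "?w q = W (q (e (2*d))) (q (e (2*d+1))) * ?v q" for q
          using d by (subst prod.remove[of _ d]) auto
        have v: "?v (p \<circ> ?t) = ?v p"
        proof (rule prod.cong[OF refl])
          fix b assume b: "b \<in> ?D"
          have "2*b \<noteq> 1" "2*b+1 \<noteq> 1" "2*b \<noteq> r'" "2*b+1 \<noteq> r'"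
            using b rd by (auto; presburger)+
          then show "W ((p \<circ> ?t) (e (2*b))) ((p \<circ> ?t) (e (2*b+1))) = W (p (e (2*b))) (p (e (2*b+1)))"
            using b eqs[of "2*b"] eqs[of "2*b+1"] by simp
        qed
        have s: "(p \<circ> ?t) s = p s" "(p \<circ> ?t) (e 0) = p (e 0)"
          using eqs[of r] eqs[of 0] r rd r'2 n by auto
        have sg: "sign (p \<circ> ?t) = - sign p" by (simp only: sign_mult_permutes[OF p t finite] sgn mult_minus1_right)
        show "?f s (p \<circ> ?t) = - ?f s p"
        proof (cases "p s = c")
          case True
          have "W c (p (e r')) * W ((p \<circ> ?t) (e (2*d))) ((p \<circ> ?t) (e (2*d+1)))
              = W c (p (e 1)) * W (p (e (2*d))) (p (e (2*d+1)))"
            using rd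
          proof
            assume *: "r = 2*d \<and> r' = 2*d+1"
            then have "?t (e (2*d)) = e r" "p (e r) = c" using eqs[of r] r True r'2 by auto
            then show ?thesis using * t1 by simp
          next
            assume *: "r = 2*d+1 \<and> r' = 2*d"
            then have "?t (e (2*d+1)) = e r" "p (e r) = c" using eqs[of r] r True r'2 by auto
            then show ?thesis using * t1 anti[of "p (e 1)" c] anti[of "p (e r')" c] by simp
          qed
          then show ?thesis
            unfolding split v s sg using t1(1) by (simp add: True)
        next
          case False
          then have "of_bool (p s = c) = (0::real)" by simp
          then show ?thesis unfolding s(1) by (simp only: mult_zero_right minus_zero)
        qed
      qed
    qed
  qed
  finally show ?thesis .
qed

text \<open>Exchanging the two entries of a pair changes the sign of the permutation and, by antisymmetry, the
  sign of one factor.\<close>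

lemma pf_summand_swap_in_pair:
  assumes anti: "\<And>i j. W i j = - W j i" and d: "d < n" and p: "p permutes UNIV"
  shows "of_int (sign (p \<circ> swap_in_pair d)) *
      (\<Prod>b<n. W ((p \<circ> swap_in_pair d) (e (2*b))) ((p \<circ> swap_in_pair d) (e (2*b+1))))
    = of_int (sign p) * (\<Prod>b<n. W (p (e (2*b))) (p (e (2*b+1))) :: real)"
proof -
  let ?t = "swap_in_pair d"
  let ?v = "\<lambda>p. \<Prod>b\<in>{..<n}-{d}. W (p (e (2*b))) (p (e (2*b+1)))"
  have split: "(\<Prod>b<n. W (q (e (2*b))) (q (e (2*b+1)))) = W (q (e (2*d))) (q (e (2*d+1))) * ?v q" for q
    using d by (subst prod.remove[of _ d]) auto
  have eqs: "?t (e i) = e i" if "i < 2*n" "i \<noteq> 2*d" "i \<noteq> 2*d+1" for i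
    using that d by (intro transpose_apply_other) (auto simp: e_eq_iff)
  have v: "?v (p \<circ> ?t) = ?v p"
  proof (rule prod.cong[OF refl])
    fix b assume b: "b \<in> {..<n} - {d}"
    have "2*b \<noteq> 2*d+1" "2*b+1 \<noteq> 2*d" by presburger+
    then show "W ((p \<circ> ?t) (e (2*b))) ((p \<circ> ?t) (e (2*b+1))) = W (p (e (2*b))) (p (e (2*b+1)))"
      using b eqs[of "2*b"] eqs[of "2*b+1"] by simp
  qed
  have "sign (p \<circ> ?t) = - sign p"
    using d by (simp add: sign_mult_permutes[OF p permutes_transpose_UNIV] sign_swap_id e_eq_iff)
  then show ?thesis
    unfolding split v using anti[of "p (e (2*d))" "p (e (2*d+1))"] by simp
qed

text \<open>Summing over the position of the index \<open>a\<close> gives \<open>2n\<close> equal contributions \<open>V s\<close>, because exchanges of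
  pairs and exchanges within a pair do not change the summands of \<open>pf W\<close>. The position \<open>e 0\<close>
  contributes the row of cofactors.\<close>

lemma cofactor_row_diagonal:
  assumes anti: "\<And>i j. W i j = - W j i"
  shows "2 * real n * (\<Sum>b\<in>UNIV. cofactor W a b * W a b) = pf W"
proof -
  let ?w = "\<lambda>p. of_int (sign p) * (\<Prod>b<n. W (p (e (2*b))) (p (e (2*b+1))))"
  define V where "V s = (\<Sum>p | p permutes UNIV. ?w p * of_bool (p s = a))" for s
  have row: "(\<Sum>b\<in>UNIV. cofactor W a b * W a b) = V (e 0)"
  proof -
    have "of_int (sign p) * (of_bool (p (e 0) = a) * W a (p (e 1)) *
        (\<Prod>b\<in>{1..<n}. W (p (e (2*b))) (p (e (2*b+1))))) = ?w p * of_bool (p (e 0) = a)" for p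
    proof -
      have "{..<n} = insert 0 {1..<n}" using n by auto
      then have "(\<Prod>b<n. W (p (e (2*b))) (p (e (2*b+1))))
        = W (p (e 0)) (p (e 1)) * (\<Prod>b\<in>{1..<n}. W (p (e (2*b))) (p (e (2*b+1))))" by simp
      then show ?thesis by (cases "p (e 0) = a") simp_all
    qed
    then show ?thesis unfolding cofactor_row pfm_expand V_def by presburger
  qed
  have Vodd: "V (e (2*d+1)) = V (e (2*d))" if d: "d < n" for d
  proof -
    have "V (e (2*d+1)) = (\<Sum>p | p permutes UNIV. ?w (p \<circ> swap_in_pair d) * of_bool ((p \<circ> swap_in_pair d) (e (2*d+1)) = a))"
      unfolding V_def by (rule sum_permutations_compose[OF permutes_transpose_UNIV, symmetric])
    also have "\<dots> = V (e (2*d))"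
      unfolding V_def
    proof (rule sum.cong[OF refl])
      fix p :: "'m \<Rightarrow> 'm" assume "p \<in> {p. p permutes UNIV}"
      then have "?w (p \<circ> swap_in_pair d) = ?w p"
        using pf_summand_swap_in_pair[of W, OF anti d] by blast
      then show "?w (p \<circ> swap_in_pair d) * of_bool ((p \<circ> swap_in_pair d) (e (2*d+1)) = a)
          = ?w p * of_bool (p (e (2*d)) = a)" by (simp only:) simp
    qed
    finally show ?thesis .
  qed
  have Veven: "V (e (2*d)) = V (e 0)" if d: "d < n" for d
  proof -
    have n0: "0 < n" using n by simp
    note s = swap_pairs[OF n0 d]
    have "V (e (2*d)) = (\<Sum>p | p permutes UNIV. ?w (p \<circ> swap_pairs 0 d) * of_bool ((p \<circ> swap_pairs 0 d) (e (2*d)) = a))"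
      unfolding V_def by (rule sum_permutations_compose[OF s(1), symmetric])
    also have "\<dots> = V (e 0)"
      unfolding V_def
    proof (rule sum.cong[OF refl])
      fix p :: "'m \<Rightarrow> 'm" assume "p \<in> {p. p permutes UNIV}"
      then have "?w (p \<circ> swap_pairs 0 d) = ?w p"
        using pfs_summand_swap_pairs[OF n0 d, of p "\<lambda>_. W"] by blast
      moreover have "(p \<circ> swap_pairs 0 d) (e (2*d)) = p (e 0)" using s(3)[OF d] by simp
      ultimately show "?w (p \<circ> swap_pairs 0 d) * of_bool ((p \<circ> swap_pairs 0 d) (e (2*d)) = a)
          = ?w p * of_bool (p (e 0) = a)" by (simp only:)
    qed
    finally show ?thesis .
  qed
  have V: "V s = V (e 0)" for s
  proof -
    obtain r where r: "r < 2*n" "s = e r" by (rule e_surj)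
    have "r = 2*(r div 2) \<or> r = 2*(r div 2)+1" "r div 2 < n" using r by auto
    then show ?thesis using Vodd[of "r div 2"] Veven[of "r div 2"] r(2) by metis
  qed
  have "pf W = (\<Sum>p | p permutes UNIV. \<Sum>s\<in>UNIV. ?w p * of_bool (p s = a))"
    unfolding pfs_def
  proof (rule sum.cong[OF refl])
    fix p :: "'m \<Rightarrow> 'm" assume "p \<in> {p. p permutes UNIV}"
    then have "bij p" by (simp add: permutes_bij)
    then have "p s = a \<longleftrightarrow> s = inv p a" for s by (metis bij_inv_eq_iff)
    then have "(\<Sum>s\<in>UNIV. of_bool (p s = a) :: real) = 1" by (simp add: of_bool_def)
    then show "?w p = (\<Sum>s\<in>UNIV. ?w p * of_bool (p s = a))"
      by (simp only: sum_distrib_left[symmetric] mult_1_right)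
  qed
  also have "\<dots> = (\<Sum>s\<in>UNIV. V s)" unfolding V_def by (rule sum.swap)
  also have "\<dots> = (\<Sum>s\<in>(UNIV::'m set). V (e 0))" by (rule sum.cong[OF refl V])
  also have "\<dots> = 2 * real n * V (e 0)"
    using bij_betw_same_card[OF e, symmetric] by simp
  finally show ?thesis using row by simp
qed

text \<open>By the expansions along rows, the cofactors form the matrix \<open>pf W / (2n)\<close> times the inverse of the
  transpose of \<open>W\<close>. As \<open>W\<close> is antisymmetric, this inverse is \<open>N\<close>.\<close>

theorem pfm_eq_trace:
  assumes anti: "\<And>i j. W i j = - W j i"
    and N: "\<And>i j. (\<Sum>k\<in>UNIV. W i k * N k j) = - of_bool (i = j)"
  shows "2 * real n * pfm \<beta> W = (\<Sum>a\<in>UNIV. \<Sum>b\<in>UNIV. N a b * \<beta> a b) * pf W"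
proof -
  have row: "2 * real n * (\<Sum>b\<in>UNIV. cofactor W a b * W c b) = of_bool (c = a) * pf W" for a c
    using cofactor_row_diagonal[of W a, OF anti] cofactor_row_off_diagonal[of W c a, OF anti]
    by (cases "c = a") auto
  have cof: "2 * real n * cofactor W a d = N a d * pf W" for a d
  proof -
    have WN: "(\<Sum>c\<in>UNIV. W c b * N c d) = of_bool (b = d)" for b
    proof -
      have "(\<Sum>c\<in>UNIV. W c b * N c d) = - (\<Sum>c\<in>UNIV. W b c * N c d)"
        unfolding sum_negf[symmetric] by (rule sum.cong[OF refl], subst anti) simp
      then show ?thesis using N by simp
    qed
    have "N a d * pf W = (\<Sum>c\<in>UNIV. (of_bool (c = a) * pf W) * N c d)"
      by (simp add: of_bool_def if_distrib[of "\<lambda>x. x * _"] cong: if_cong)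
    also have "\<dots> = (\<Sum>c\<in>UNIV. \<Sum>b\<in>UNIV. 2 * real n * cofactor W a b * (W c b * N c d))"
      unfolding row[symmetric] by (simp add: sum_distrib_left sum_distrib_right mult_ac)
    also have "\<dots> = (\<Sum>b\<in>UNIV. 2 * real n * cofactor W a b * (\<Sum>c\<in>UNIV. W c b * N c d))"
      by (subst sum.swap) (simp add: sum_distrib_left)
    also have "\<dots> = 2 * real n * cofactor W a d"
      by (simp add: WN of_bool_def if_distrib[of "(*) _"] cong: if_cong)
    finally show ?thesis by simp
  qed
  have "2 * real n * pfm \<beta> W = (\<Sum>a\<in>UNIV. \<Sum>b\<in>UNIV. \<beta> a b * (2 * real n * cofactor W a b))"
    unfolding pfm_cofactor by (simp add: sum_distrib_left mult_ac)
  also have "\<dots> = (\<Sum>a\<in>UNIV. \<Sum>b\<in>UNIV. N a b * \<beta> a b) * pf W"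
    unfolding cof by (simp add: sum_distrib_left mult_ac)
  finally show ?thesis .
qed

text \<open>Choosing an index for each element of the type is the same as choosing a pair of indices for each of
  the \<open>n\<close> pairs of positions; this is how the product of \<open>n\<close> double sums is multiplied out below.\<close>

lemma bij_betw_pair_functions:
  "bij_betw (\<lambda>F. \<lambda>b\<in>{..<n}. (F (e (2*b)), F (e (2*b+1))))
    (UNIV :: ('m \<Rightarrow> 'm) set) ({..<n} \<rightarrow>\<^sub>E UNIV)"
proof (rule bij_betw_byWitness)
  let ?i = "inv_into {..<2*n} e"
  let ?g = "\<lambda>G i. if even (?i i) then fst (G (?i i div 2)) else snd (G (?i i div 2)) :: 'm"
  have i: "?i (e r) = r" if "r < 2*n" for r
    using e that by (intro inv_into_f_f) (auto simp: bij_betw_def)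
  show "\<forall>F\<in>UNIV. ?g (\<lambda>b\<in>{..<n}. (F (e (2*b)), F (e (2*b+1)))) = F"
  proof (intro ballI ext)
    fix F :: "'m \<Rightarrow> 'm" and j
    obtain r where r: "r < 2*n" "j = e r" by (rule e_surj)
    show "?g (\<lambda>b\<in>{..<n}. (F (e (2*b)), F (e (2*b+1)))) j = F j"
      using r i[OF r(1)] by (cases "even r") (auto simp: elim!: evenE oddE)
  qed
  show "\<forall>G\<in>{..<n} \<rightarrow>\<^sub>E UNIV. (\<lambda>b\<in>{..<n}. (?g G (e (2*b)), ?g G (e (2*b+1)))) = G"
  proof (intro ballI ext)
    fix G :: "nat \<Rightarrow> 'm \<times> 'm" and b assume G: "G \<in> {..<n} \<rightarrow>\<^sub>E UNIV"
    show "(\<lambda>b\<in>{..<n}. (?g G (e (2*b)), ?g G (e (2*b+1)))) b = G b"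
    proof (cases "b < n")
      case True
      then have "?i (e (2*b)) = 2*b" "?i (e (2*b+1)) = 2*b+1" by (auto intro!: i)
      then show ?thesis using True by (simp only: restrict_apply) simp
    next
      case False
      then show ?thesis using PiE_arb[OF G] by simp
    qed
  qed
  show "(\<lambda>F. \<lambda>b\<in>{..<n}. (F (e (2*b)), F (e (2*b+1)))) ` UNIV \<subseteq> {..<n} \<rightarrow>\<^sub>E UNIV"
    by (auto simp: PiE_def extensional_def)
qed simp

text \<open>Multiplying out the product, every choice \<open>F\<close> of indices contributes a product of entries of \<open>W\<close>
  times the determinant of the matrix with the rows \<open>F i\<close> of \<open>B\<close>. It vanishes unless \<open>F\<close> is a
  permutation, and then it is the determinant of \<open>B\<close> up to the sign of \<open>F\<close>.\<close>

theorem pf_congruence: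
  fixes B :: "real^'m^'m"
  shows "pf (\<lambda>i j. \<Sum>k\<in>UNIV. \<Sum>l\<in>UNIV. B $ k $ i * B $ l $ j * W k l) = det B * pf W"
proof -
  let ?W' = "\<lambda>i j. \<Sum>k\<in>UNIV. \<Sum>l\<in>UNIV. B $ k $ i * B $ l $ j * W k l"
  let ?P = "{p. p permutes (UNIV::'m set)}"
  let ?w = "\<lambda>F. \<Prod>b<n. W (F (e (2*b))) (F (e (2*b+1)))"
  have expand: "(\<Prod>b<n. ?W' (p (e (2*b))) (p (e (2*b+1)))) = (\<Sum>F\<in>UNIV. ?w F * (\<Prod>i\<in>UNIV. B $ F i $ p i))"
    if p: "p \<in> ?P" for p
  proof -
    let ?h = "\<lambda>b y. B $ fst y $ p (e (2*b)) * B $ snd y $ p (e (2*b+1)) * W (fst y) (snd y)"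
    have "(\<Prod>b<n. ?W' (p (e (2*b))) (p (e (2*b+1)))) = (\<Prod>b<n. \<Sum>y\<in>UNIV. ?h b y)"
      by (simp add: sum.cartesian_product case_prod_beta)
    also have "\<dots> = (\<Sum>G\<in>{..<n} \<rightarrow>\<^sub>E UNIV. \<Prod>b<n. ?h b (G b))"
      by (rule prod_sum_PiE) auto
    also have "\<dots> = (\<Sum>F\<in>UNIV. \<Prod>b<n. ?h b ((\<lambda>b\<in>{..<n}. (F (e (2*b)), F (e (2*b+1)))) b))"
      by (rule sum.reindex_bij_betw[OF bij_betw_pair_functions, symmetric])
    also have "\<dots> = (\<Sum>F\<in>UNIV. ?w F * (\<Prod>i\<in>UNIV. B $ F i $ p i))"
    proof (rule sum.cong[OF refl])
      fix F :: "'m \<Rightarrow> 'm"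
      have "(\<Prod>b<n. ?h b ((\<lambda>b\<in>{..<n}. (F (e (2*b)), F (e (2*b+1)))) b))
        = (\<Prod>b<n. W (F (e (2*b))) (F (e (2*b+1))) *
            (B $ F (e (2*b)) $ p (e (2*b)) * B $ F (e (2*b+1)) $ p (e (2*b+1))))"
        by (rule prod.cong) (simp_all add: mult_ac)
      also have "\<dots> = ?w F * (\<Prod>i\<in>UNIV. B $ F i $ p i)"
        unfolding prod.distrib[of _ "\<lambda>b. B $ _ b $ _ b * _ b"] prod.distrib[of "\<lambda>b. W _ _"]
        using prod_pairs[of "\<lambda>i. B $ F i $ p i"] by (simp add: prod.distrib)
      finally show "(\<Prod>b<n. ?h b ((\<lambda>b\<in>{..<n}. (F (e (2*b)), F (e (2*b+1)))) b))
        = ?w F * (\<Prod>i\<in>UNIV. B $ F i $ p i)" .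
    qed
    finally show ?thesis .
  qed
  have "pf ?W' = (\<Sum>p\<in>?P. \<Sum>F\<in>UNIV. ?w F * (of_int (sign p) * (\<Prod>i\<in>UNIV. B $ F i $ p i)))"
    unfolding pfs_def by (rule sum.cong[OF refl], subst expand) (simp_all add: sum_distrib_left mult_ac)
  also have "\<dots> = (\<Sum>F\<in>UNIV. ?w F * det (\<chi> i. B $ F i))"
    by (subst sum.swap) (simp add: det_def sum_distrib_left)
  also have "\<dots> = (\<Sum>F\<in>?P. ?w F * det (\<chi> i. B $ F i))"
  proof (rule sum.mono_neutral_right)
    show "\<forall>F\<in>UNIV - ?P. ?w F * det (\<chi> i. B $ F i) = 0"
    proof
      fix F assume "F \<in> UNIV - ?P"
      then have "\<not> inj F" using finite_UNIV_inj_surj[of F] bij_imp_permutes[of F UNIV]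
        by (auto simp: bij_def)
      then obtain i j where "i \<noteq> j" "F i = F j" by (auto simp: inj_on_def)
      then have "det (\<chi> i. B $ F i) = 0"
        by (intro det_identical_rows[of i j]) (auto simp: row_def vec_eq_iff)
      then show "?w F * det (\<chi> i. B $ F i) = 0" by simp
    qed
  qed auto
  also have "\<dots> = det B * pf W"
    unfolding pfs_def sum_distrib_left
    by (rule sum.cong[OF refl]) (simp add: det_permute_rows mult_ac)
  finally show ?thesis .
qed

end

section \<open>Matrix-valued functions\<close>

lemma bounded_bilinear_matrix_mult:
  "bounded_bilinear ((**) :: real^'m::finite^'m \<Rightarrow> real^'m^'m \<Rightarrow> real^'m^'m)"
  unfolding bilinear_conv_bounded_bilinear[symmetric] bilinear_def
  by (auto intro!: linearI simp: matrix_matrix_mult_def vec_eq_iff sum.distrib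
      sum_distrib_left algebra_simps)

interpretation matrix_mult: bounded_bilinear "(**) :: real^'m::finite^'m \<Rightarrow> real^'m^'m \<Rightarrow> real^'m^'m"
  by (rule bounded_bilinear_matrix_mult)

lemmas matrix_distribs = matrix_mult.add_left matrix_mult.add_right matrix_mult.diff_left
  matrix_mult.diff_right matrix_mult.minus_left matrix_mult.minus_right

definition mdiff :: "(real^'m::finite \<Rightarrow> real^'m^'m) \<Rightarrow> real^'m \<Rightarrow> bool" where
  "mdiff F x \<longleftrightarrow> (\<forall>k j. (\<lambda>y. F y $ k $ j) differentiable (at x))"

definition pdm :: "'m::finite \<Rightarrow> (real^'m \<Rightarrow> real^'m^'m) \<Rightarrow> real^'m \<Rightarrow> real^'m^'m" where
  "pdm i F x = (\<chi> k j. pd i (\<lambda>y. F y $ k $ j) x)"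

lemma pdm_component: "pdm i F x $ k $ j = pd i (\<lambda>y. F y $ k $ j) x"
  by (simp add: pdm_def)

lemma pdm_cong:
  assumes "open S" "x \<in> S" "\<And>y. y \<in> S \<Longrightarrow> F y = G y" shows "pdm i F x = pdm i G x"
  unfolding pdm_def using assms by (simp add: vec_eq_iff) (intro allI pd_cong, auto)

lemma pdm_const [simp]: "pdm i (\<lambda>y. C) x = 0"
  by (simp add: pdm_def vec_eq_iff)

lemma mdiff_const [simp]: "mdiff (\<lambda>y. C) x"
  by (simp add: mdiff_def)

lemma mdiff_add: "mdiff F x \<Longrightarrow> mdiff G x \<Longrightarrow> mdiff (\<lambda>y. F y + G y) x"
  by (simp add: mdiff_def)

lemma mdiff_mult: "mdiff F x \<Longrightarrow> mdiff G x \<Longrightarrow> mdiff (\<lambda>y. F y ** G y) x"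
  unfolding mdiff_def matrix_matrix_mult_def by (auto intro!: differentiable_sum differentiable_mult)

lemma mdiff_scaleR: "f differentiable (at x) \<Longrightarrow> mdiff F x \<Longrightarrow> mdiff (\<lambda>y. f y *\<^sub>R F y) x"
  unfolding mdiff_def by (auto intro!: differentiable_mult)

lemma mdiff_sum: "(\<And>a. a \<in> I \<Longrightarrow> mdiff (F a) x) \<Longrightarrow> mdiff (\<lambda>y. \<Sum>a\<in>I. F a y) x"
  by (induction I rule: infinite_finite_induct) (auto intro: mdiff_add)

lemma pdm_add: "mdiff F x \<Longrightarrow> mdiff G x \<Longrightarrow> pdm i (\<lambda>y. F y + G y) x = pdm i F x + pdm i G x"
  by (simp add: pdm_def mdiff_def vec_eq_iff pd_add)

lemma pdm_mult:
  assumes "mdiff F x" "mdiff G x"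
  shows "pdm i (\<lambda>y. F y ** G y) x = pdm i F x ** G x + F x ** pdm i G x"
proof -
  have "pd i (\<lambda>y. \<Sum>l\<in>UNIV. F y $ k $ l * G y $ l $ j) x
    = (\<Sum>l\<in>UNIV. pd i (\<lambda>y. F y $ k $ l) x * G x $ l $ j) + (\<Sum>l\<in>UNIV. F x $ k $ l * pd i (\<lambda>y. G y $ l $ j) x)"
    for k j
    using assms unfolding mdiff_def
    by (subst pd_sum) (auto intro!: differentiable_mult simp: pd_mult sum.distrib)
  then show ?thesis by (simp add: pdm_def matrix_matrix_mult_def vec_eq_iff)
qed

lemma pdm_scaleR:
  assumes "f differentiable (at x)" "mdiff F x"
  shows "pdm i (\<lambda>y. f y *\<^sub>R F y) x = pd i f x *\<^sub>R F x + f x *\<^sub>R pdm i F x"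
  using assms by (simp add: pdm_def mdiff_def vec_eq_iff pd_mult)

lemma pdm_sum:
  assumes "\<And>a. a \<in> I \<Longrightarrow> mdiff (F a) x"
  shows "pdm i (\<lambda>y. \<Sum>a\<in>I. F a y) x = (\<Sum>a\<in>I. pdm i (F a) x)"
  using assms
  by (induction I rule: infinite_finite_induct) (auto simp: pdm_add mdiff_sum)

lemma pdm_inverse:
  assumes U: "open U" "x \<in> U" and KJ: "\<And>y. y \<in> U \<Longrightarrow> K y ** J y = mat 1"
    and JK: "J x ** K x = mat 1" and d: "mdiff K x" "mdiff J x"
  shows "pdm i K x = - (K x ** pdm i J x ** K x)"
proof -
  have "pdm i (\<lambda>y. K y ** J y) x = pdm i (\<lambda>y. mat 1) x"
    by (rule pdm_cong[OF U]) (rule KJ)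
  then have "pdm i K x ** J x + K x ** pdm i J x = 0"
    by (simp add: pdm_mult d)
  then have "(pdm i K x ** J x + K x ** pdm i J x) ** K x = 0" by (simp only: matrix_mult.zero_left)
  then have "pdm i K x ** (J x ** K x) + K x ** pdm i J x ** K x = 0"
    by (simp only: matrix_distribs matrix_mul_assoc)
  then show ?thesis by (simp add: JK eq_neg_iff_add_eq_0)
qed

lemma matrix_inv_mult:
  fixes M :: "real^'m::finite^'m"
  assumes "invertible M"
  shows "M ** matrix_inv M = mat 1" and "matrix_inv M ** M = mat 1"
  using someI_ex[OF assms[unfolded invertible_def]] unfolding matrix_inv_def by blast+

lemma matrix_inv_unique:
  fixes M :: "real^'m::finite^'m"
  assumes "N ** M = mat 1" shows "matrix_inv M = N"
proof -
  have "invertible M" using assms invertible_left_inverse by blast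
  then have "N ** (M ** matrix_inv M) = N" by (simp add: matrix_inv_mult)
  then show ?thesis by (simp add: matrix_mul_assoc assms)
qed

text \<open>Cramer's rule, from which inverse matrices inherit smoothness and continuity.\<close>

lemma matrix_inv_entry:
  fixes M :: "real^'m::finite^'m"
  assumes "det M \<noteq> 0"
  shows "matrix_inv M $ k $ l = det (\<chi> i j. if j = k then (if i = l then 1 else 0) else M $ i $ j) / det M"
proof -
  have "M ** matrix_inv M = mat 1"
    using assms by (simp add: invertible_det_nz matrix_inv_mult)
  then have "M *v (matrix_inv M *v axis l 1) = axis l 1"
    by (simp add: matrix_vector_mul_assoc)
  then have "matrix_inv M *v axis l 1 =
      (\<chi> k. det (\<chi> i j. if j = k then (axis l 1 :: real^'m) $ i else M $ i $ j) / det M)"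
    using cramer[OF assms] by blast
  then have "(matrix_inv M *v axis l 1) $ k =
      det (\<chi> i j. if j = k then (axis l 1 :: real^'m) $ i else M $ i $ j) / det M" by simp
  moreover have "(matrix_inv M *v axis l 1) $ k = matrix_inv M $ k $ l"
    by (simp add: matrix_vector_mult_basis column_def)
  moreover have "(\<chi> i j. if j = k then (axis l 1 :: real^'m) $ i else M $ i $ j)
      = (\<chi> i j. if j = k then (if i = l then 1 else 0) else M $ i $ j)"
    by (auto simp: vec_eq_iff axis_def)
  ultimately show ?thesis by simp
qed

lemma smooth_on_det:
  assumes "open S" "\<And>i j. smooth_on S (\<lambda>x. M x $ i $ j)"
  shows "smooth_on S (\<lambda>x. det (M x :: real^'m::finite^'m))"
  unfolding det_def by (intro smooth_intros assms)

lemma smooth_on_matrix_inv: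
  fixes M :: "real^'n::finite \<Rightarrow> real^'m::finite^'m"
  assumes S: "open S" and M: "\<And>i j. smooth_on S (\<lambda>x. M x $ i $ j)" and nz: "\<And>x. x \<in> S \<Longrightarrow> det (M x) \<noteq> 0"
  shows "smooth_on S (\<lambda>x. matrix_inv (M x) $ k $ l)"
proof -
  have "smooth_on S (\<lambda>x. det (\<chi> i j. if j = k then (if i = l then 1 else 0) else M x $ i $ j) / det (M x))"
  proof (intro smooth_on_divide[OF S] smooth_on_det[OF S] M nz)
    show "smooth_on S (\<lambda>x. (\<chi> i j. if j = k then (if i = l then 1 else 0) else M x $ i $ j) $ i $ j)" for i j
      using M[of i j] by (cases "j = k") simp_all
  qed
  then show ?thesis by (subst smooth_on_cong[OF S matrix_inv_entry[OF nz]])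
qed


section \<open>Curvature of connection matrices\<close>

definition curv :: "(real^'m::finite \<Rightarrow> 'm \<Rightarrow> real^'m^'m) \<Rightarrow> real^'m \<Rightarrow> 'm \<Rightarrow> 'm \<Rightarrow> real^'m^'m" where
  "curv B x i j = pdm i (\<lambda>y. B y j) x - pdm j (\<lambda>y. B y i) x + B x i ** B x j - B x j ** B x i"

lemma curv_cong:
  assumes "open S" "x \<in> S" "\<And>y i. y \<in> S \<Longrightarrow> B y i = C y i" shows "curv B x i j = curv C x i j"
  unfolding curv_def using assms by (simp cong: pdm_cong)

text \<open>The terms with derivatives of \<open>J\<close> cancel because \<open>\<partial>K = - K (\<partial>J) K\<close> and second derivatives commute.
  This is used both for the gauge group and for the change of frame between two charts.\<close>

lemma curv_gauge:
  assumes U: "open U" "x \<in> U" and KJ: "\<And>y. y \<in> U \<Longrightarrow> K y ** J y = mat 1" and JK: "J x ** K x = mat 1"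
    and d: "mdiff K x" "mdiff J x" "\<And>i. mdiff (pdm i J) x" "\<And>i. mdiff (\<lambda>y. B y i) x"
    and comm: "\<And>i j. pdm i (pdm j J) x = pdm j (pdm i J) x"
  shows "curv (\<lambda>y i. K y ** B y i ** J y + K y ** pdm i J y) x i j = K x ** curv B x i j ** J x"
proof -
  have JK': "J x ** (K x ** M) = M" for M by (simp add: matrix_mul_assoc JK)
  have dK: "pdm i K x = - (K x ** (pdm i J x ** K x))" for i
    using pdm_inverse[OF U KJ JK d(1,2)] by (simp add: matrix_mul_assoc)
  have D: "pdm i (\<lambda>y. K y ** B y j ** J y + K y ** pdm j J y) x
      = (pdm i K x ** B x j + K x ** pdm i (\<lambda>y. B y j) x) ** J x + K x ** B x j ** pdm i J x
        + (pdm i K x ** pdm j J x + K x ** pdm i (pdm j J) x)" for i j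
    using d by (simp add: pdm_add pdm_mult mdiff_mult)
  show ?thesis
    unfolding curv_def D dK
    by (simp add: matrix_distribs matrix_mul_assoc[symmetric] JK' JK comm[of i j])
qed

text \<open>Here \<open>J\<close> is the Jacobian matrix of \<open>T\<close>; the terms with its derivatives cancel by the symmetry of the
  second derivatives of \<open>T\<close>.\<close>

lemma curv_pullback:
  fixes C :: "real^'m::finite \<Rightarrow> 'm \<Rightarrow> real^'m^'m" and J :: "real^'m \<Rightarrow> 'm \<Rightarrow> 'm \<Rightarrow> real"
  assumes J: "\<And>a i. (\<lambda>y. J y a i) differentiable (at x)"
    and comm: "\<And>a i j. pd i (\<lambda>y. J y a j) x = pd j (\<lambda>y. J y a i) x"
    and C: "\<And>a. mdiff (\<lambda>y. C (T y) a) x"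
    and chain: "\<And>a i. pdm i (\<lambda>y. C (T y) a) x = (\<Sum>b\<in>UNIV. J x b i *\<^sub>R pdm b (\<lambda>y. C y a) (T x))"
  shows "curv (\<lambda>y i. \<Sum>a\<in>UNIV. J y a i *\<^sub>R C (T y) a) x i j
    = (\<Sum>a\<in>UNIV. \<Sum>b\<in>UNIV. (J x a i * J x b j) *\<^sub>R curv C (T x) a b)"
proof -
  have D: "pdm i (\<lambda>y. \<Sum>b\<in>UNIV. J y b j *\<^sub>R C (T y) b) x
    = (\<Sum>b\<in>UNIV. pd i (\<lambda>y. J y b j) x *\<^sub>R C (T x) b)
      + (\<Sum>a\<in>UNIV. \<Sum>b\<in>UNIV. (J x a i * J x b j) *\<^sub>R pdm a (\<lambda>y. C y b) (T x))" for i j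
  proof -
    have "pdm i (\<lambda>y. \<Sum>b\<in>UNIV. J y b j *\<^sub>R C (T y) b) x
      = (\<Sum>b\<in>UNIV. pd i (\<lambda>y. J y b j) x *\<^sub>R C (T x) b)
       + (\<Sum>b\<in>UNIV. \<Sum>a\<in>UNIV. (J x a i * J x b j) *\<^sub>R pdm a (\<lambda>y. C y b) (T x))"
      using J C by (simp add: pdm_sum mdiff_scaleR pdm_scaleR chain sum.distrib scaleR_sum_right mult.commute)
    then show ?thesis by (subst (asm) sum.swap)
  qed
  have M: "(\<Sum>a\<in>UNIV. J x a i *\<^sub>R C (T x) a) ** (\<Sum>b\<in>UNIV. J x b j *\<^sub>R C (T x) b)
    = (\<Sum>a\<in>UNIV. \<Sum>b\<in>UNIV. (J x a i * J x b j) *\<^sub>R (C (T x) a ** C (T x) b))" for i j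
    by (subst sum.swap)
      (simp add: matrix_mult.sum_left matrix_mult.sum_right matrix_mult.scaleR_left
        matrix_mult.scaleR_right scaleR_sum_right mult.commute)
  have swap: "(\<Sum>a\<in>UNIV. \<Sum>b\<in>UNIV. (J x a j * J x b i) *\<^sub>R G a b)
    = (\<Sum>a\<in>UNIV. \<Sum>b\<in>UNIV. (J x a i * J x b j) *\<^sub>R G b a)" for G :: "'m \<Rightarrow> 'm \<Rightarrow> real^'m^'m"
    by (subst sum.swap) (simp add: mult.commute)
  show ?thesis
    unfolding curv_def D M
    unfolding swap[of "\<lambda>a b. pdm a (\<lambda>y. C y b) (T x)"] swap[of "\<lambda>a b. C (T x) a ** C (T x) b"]
    by (simp add: comm[of i _ j] sum.distrib sum_subtractf scaleR_diff_right scaleR_add_right)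
qed


section \<open>Tensor fields in matrix notation\<close>

lemma sum_lists_Suc:
  "(\<Sum>us | length us = Suc r. f us) = (\<Sum>k\<in>(UNIV::'m::finite set). \<Sum>us | length us = r. f (k # us))"
proof -
  have "{us::'m list. length us = Suc r} = (\<lambda>(k, us). k # us) ` (UNIV \<times> {us. length us = r})"
    by (auto simp: length_Suc_conv)
  moreover have "inj_on (\<lambda>(k, us). k # us) (UNIV \<times> {us::'m list. length us = r})"
    by (auto simp: inj_on_def)
  ultimately have "(\<Sum>us | length us = Suc r. f us)
      = (\<Sum>x\<in>UNIV \<times> {us. length us = r}. f (case x of (k, us) \<Rightarrow> k # us))"
    by (simp only: sum.reindex o_def)
  then show ?thesis by (simp add: sum.cartesian_product case_prod_unfold)
qed

lemma sum_lists_0: "(\<Sum>us | length us = 0. f us) = f ([] :: 'm::finite list)"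
  by simp

lemma all_lists_Suc: "(\<forall>us. length us = Suc r \<longrightarrow> P us) \<longleftrightarrow> (\<forall>k us. length us = r \<longrightarrow> P (k # us))"
  by (metis length_Suc_conv)

text \<open>The index of differentiation stays outside of the matrix, in which the upper index is the row, so that
  composition of endomorphisms is the matrix product. The notation also serves for differences of
  connections and for covariant derivatives of endomorphism fields.\<close>

definition conn_matrix :: "('a,'m::finite) tfield \<Rightarrow> ('a,'m) chart \<Rightarrow> real^'m \<Rightarrow> 'm \<Rightarrow> real^'m^'m" where
  "conn_matrix D c x i = (\<chi> k j. D c x [k] [i,j])"

definition curv_matrix :: "('a,'m::finite) tfield \<Rightarrow> ('a,'m) chart \<Rightarrow> real^'m \<Rightarrow> 'm \<Rightarrow> 'm \<Rightarrow> real^'m^'m" where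
  "curv_matrix R c x i j = (\<chi> k p. R c x [k] [i,j,p])"

definition form_matrix :: "('a,'m::finite) tfield \<Rightarrow> ('a,'m) chart \<Rightarrow> real^'m \<Rightarrow> real^'m^'m" where
  "form_matrix W c x = (\<chi> i j. W c x [] [i,j])"

lemma all_lists_single_upper:
  "(\<forall>us ls. length us = 1 \<longrightarrow> length ls = s \<longrightarrow> P us ls) \<longleftrightarrow> (\<forall>ls. length ls = s \<longrightarrow> (\<forall>k. P [k] ls))"
  unfolding One_nat_def using all_lists_Suc[of 0 "\<lambda>us. \<forall>ls. length ls = s \<longrightarrow> P us ls"] by auto

lemma tensor_field_1:
  fixes T :: "('a,'m::finite) tfield"
  shows "tensor_field A 1 s T \<longleftrightarrow>
    (\<forall>ls. length ls = s \<longrightarrow> (\<forall>c\<in>A. \<forall>k. smooth_on (coords c) (\<lambda>x. T c x [k] ls))) \<and>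
    (\<forall>ls. length ls = s \<longrightarrow> (\<forall>c\<in>A. \<forall>d\<in>A. \<forall>p\<in>fst c \<inter> fst d. \<forall>k. T d (snd d p) [k] ls =
      (\<Sum>k'\<in>UNIV. jac c d (snd c p) k k' * (\<Sum>ls' | length ls' = s.
        (\<Prod>b<s. jac d c (snd d p) (ls' ! b) (ls ! b)) * T c (snd c p) [k'] ls'))))"
proof -
  have s1: "(\<Sum>us | length us = 1. f us) = (\<Sum>k\<in>UNIV. f [k])" for f :: "'m list \<Rightarrow> real"
    unfolding One_nat_def sum_lists_Suc by simp
  show ?thesis
    unfolding tensor_field_def all_lists_single_upper s1 by (simp add: sum_distrib_left mult.assoc) blast
qed

lemma matrix_triple_component:
  fixes K T J :: "real^'m::finite^'m"
  shows "(K ** T ** J) $ k $ j = (\<Sum>k'\<in>UNIV. K $ k $ k' * (\<Sum>j'\<in>UNIV. J $ j' $ j * T $ k' $ j'))"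
proof -
  have "(K ** T ** J) $ k $ j = (K ** (T ** J)) $ k $ j" by (simp only: matrix_mul_assoc)
  also have "\<dots> = (\<Sum>k'\<in>UNIV. K $ k $ k' * (\<Sum>j'\<in>UNIV. J $ j' $ j * T $ k' $ j'))"
    by (simp add: matrix_matrix_mult_def mult.commute)
  finally show ?thesis .
qed

lemma tensor_field_11:
  fixes T :: "('a,'m::finite) tfield"
  shows "tensor_field A 1 1 T \<longleftrightarrow> (\<forall>c\<in>A. \<forall>k j. smooth_on (coords c) (\<lambda>x. T c x [k] [j])) \<and>
    (\<forall>c\<in>A. \<forall>d\<in>A. \<forall>p\<in>fst c \<inter> fst d. endo_matrix T d (snd d p)
      = jacm c d (snd c p) ** endo_matrix T c (snd c p) ** jacm d c (snd d p))"
  unfolding tensor_field_1 vec_eq_iff matrix_triple_component endo_matrix_def jacm_def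
  unfolding One_nat_def all_lists_Suc sum_lists_Suc by simp blast

lemma tensor_field_12:
  fixes T :: "('a,'m::finite) tfield"
  shows "tensor_field A 1 2 T \<longleftrightarrow> (\<forall>c\<in>A. \<forall>k i j. smooth_on (coords c) (\<lambda>x. T c x [k] [i,j])) \<and>
    (\<forall>c\<in>A. \<forall>d\<in>A. \<forall>p\<in>fst c \<inter> fst d. \<forall>i. conn_matrix T d (snd d p) i
      = (\<Sum>a\<in>UNIV. jac d c (snd d p) a i *\<^sub>R
          (jacm c d (snd c p) ** conn_matrix T c (snd c p) a ** jacm d c (snd d p))))"
proof -
  have e: "(\<Sum>a\<in>UNIV. J a *\<^sub>R (K ** M a ** L)) $ k $ j
    = (\<Sum>k'\<in>UNIV. K $ k $ k' * (\<Sum>a\<in>UNIV. \<Sum>j'\<in>UNIV. J a * L $ j' $ j * M a $ k' $ j'))"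
    for J :: "'m \<Rightarrow> real" and K L :: "real^'m^'m" and M :: "'m \<Rightarrow> real^'m^'m" and j k
    by (simp add: matrix_triple_component sum_distrib_left mult_ac) (subst sum.swap, simp)
  show ?thesis
    unfolding tensor_field_1 vec_eq_iff e conn_matrix_def jacm_def
    unfolding numeral_2_eq_2 all_lists_Suc sum_lists_Suc by simp blast
qed

lemma tensor_field_13:
  fixes T :: "('a,'m::finite) tfield"
  shows "tensor_field A 1 3 T \<longleftrightarrow> (\<forall>c\<in>A. \<forall>k i j q. smooth_on (coords c) (\<lambda>x. T c x [k] [i,j,q])) \<and>
    (\<forall>c\<in>A. \<forall>d\<in>A. \<forall>p\<in>fst c \<inter> fst d. \<forall>i j. curv_matrix T d (snd d p) i j
      = (\<Sum>a\<in>UNIV. \<Sum>b\<in>UNIV. (jac d c (snd d p) a i * jac d c (snd d p) b j) *\<^sub>R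
          (jacm c d (snd c p) ** curv_matrix T c (snd c p) a b ** jacm d c (snd d p))))"
proof -
  have e: "(\<Sum>a\<in>UNIV. \<Sum>b\<in>UNIV. (J a * J2 b) *\<^sub>R (K ** M a b ** L)) $ k $ q
    = (\<Sum>k'\<in>UNIV. K $ k $ k' * (\<Sum>a\<in>UNIV. \<Sum>b\<in>UNIV. \<Sum>q'\<in>UNIV. J a * (J2 b * L $ q' $ q) * M a b $ k' $ q'))"
    for J J2 :: "'m \<Rightarrow> real" and K L :: "real^'m^'m" and M :: "'m \<Rightarrow> 'm \<Rightarrow> real^'m^'m" and k q
  proof -
    have "(\<Sum>k'\<in>UNIV. K $ k $ k' * (\<Sum>a\<in>UNIV. \<Sum>b\<in>UNIV. \<Sum>q'\<in>UNIV. J a * (J2 b * L $ q' $ q) * M a b $ k' $ q'))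
      = (\<Sum>k'\<in>UNIV. \<Sum>a\<in>UNIV. \<Sum>b\<in>UNIV. J a * J2 b * (K $ k $ k' * (\<Sum>q'\<in>UNIV. L $ q' $ q * M a b $ k' $ q')))"
      by (simp add: sum_distrib_left mult_ac)
    also have "\<dots> = (\<Sum>a\<in>UNIV. \<Sum>k'\<in>UNIV. \<Sum>b\<in>UNIV. J a * J2 b * (K $ k $ k' * (\<Sum>q'\<in>UNIV. L $ q' $ q * M a b $ k' $ q')))"
      by (rule sum.swap)
    also have "\<dots> = (\<Sum>a\<in>UNIV. \<Sum>b\<in>UNIV. \<Sum>k'\<in>UNIV. J a * J2 b * (K $ k $ k' * (\<Sum>q'\<in>UNIV. L $ q' $ q * M a b $ k' $ q')))"
      by (intro sum.cong[OF refl] sum.swap)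
    finally show ?thesis by (simp add: matrix_triple_component sum_distrib_left)
  qed
  show ?thesis
    unfolding tensor_field_1 vec_eq_iff e curv_matrix_def jacm_def
    unfolding numeral_3_eq_3 all_lists_Suc sum_lists_Suc
    by (simp add: lessThan_Suc mult_ac) blast
qed

lemma tensor_field_02:
  "tensor_field A 0 2 W \<Longrightarrow> c \<in> A \<Longrightarrow> smooth_on (coords c) (\<lambda>x. W c x [] [i,j])"
  "tensor_field A 0 2 W \<Longrightarrow> c \<in> A \<Longrightarrow> d \<in> A \<Longrightarrow> p \<in> fst c \<inter> fst d \<Longrightarrow> W d (snd d p) [] [i,j]
    = (\<Sum>k\<in>UNIV. \<Sum>l\<in>UNIV. jacm d c (snd d p) $ k $ i * jacm d c (snd d p) $ l $ j * W c (snd c p) [] [k,l])"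
  unfolding tensor_field_def numeral_2_eq_2 sum_lists_Suc sum_lists_0
  by (auto simp: jacm_def lessThan_Suc mult_ac)

text \<open>In matrix notation the inhomogeneous transformation law is a pullback of the index of differentiation
  followed by a gauge transformation with the Jacobian matrix. Both operations have a simple effect on
  the curvature, by \<open>curv_pullback\<close> and \<open>curv_gauge\<close>.\<close>

lemma affine_connection_matrix:
  fixes D :: "('a,'m::finite) tfield"
  shows "affine_connection A D \<longleftrightarrow> (\<forall>c\<in>A. \<forall>k i j. smooth_on (coords c) (\<lambda>x. D c x [k] [i,j])) \<and>
    (\<forall>c\<in>A. \<forall>d\<in>A. \<forall>p\<in>fst c \<inter> fst d. \<forall>i. conn_matrix D d (snd d p) i
      = jacm c d (snd c p) ** (\<Sum>a\<in>UNIV. jac d c (snd d p) a i *\<^sub>R conn_matrix D c (snd c p) a) ** jacm d c (snd d p)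
        + jacm c d (snd c p) ** pdm i (jacm d c) (snd d p))"
proof -
  have e: "(K ** (\<Sum>a\<in>UNIV. J a i *\<^sub>R M a) ** L + K ** N) $ k $ j
    = (\<Sum>k'\<in>UNIV. K $ k $ k' * ((\<Sum>a\<in>UNIV. \<Sum>j'\<in>UNIV. J a i * L $ j' $ j * M a $ k' $ j') + N $ k' $ j))"
    for J :: "'m \<Rightarrow> 'm \<Rightarrow> real" and K L N :: "real^'m^'m" and M :: "'m \<Rightarrow> real^'m^'m" and i j k
  proof -
    have "(\<Sum>j'\<in>UNIV. L $ j' $ j * (\<Sum>a\<in>UNIV. J a i *\<^sub>R M a) $ k' $ j')
      = (\<Sum>a\<in>UNIV. \<Sum>j'\<in>UNIV. J a i * L $ j' $ j * M a $ k' $ j')" for k'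
      by (subst sum.swap) (simp add: sum_distrib_left mult_ac)
    then show ?thesis
      by (simp only: vector_add_component matrix_triple_component)
        (simp add: matrix_matrix_mult_def distrib_left sum.distrib)
  qed
  show ?thesis
    unfolding affine_connection_def vec_eq_iff e
    by (simp add: conn_matrix_def jacm_def pdm_def) blast
qed

section \<open>Curvature and covariant derivatives of tensor fields\<close>

lemma cov_vector:
  "cov D V c y [k] [j] = pd j (\<lambda>z. V c z [k] []) y + (\<Sum>p\<in>UNIV. D c y [k] [j,p] * V c y [p] [])"
  by (simp add: cov_def)

lemma cov_cov_vector:
  "cov D (cov D V) c x [k] [i,j] = pd i (\<lambda>y. cov D V c y [k] [j]) x
    + (\<Sum>p\<in>UNIV. D c x [k] [i,p] * cov D V c x [p] [j]) - (\<Sum>p\<in>UNIV. D c x [p] [i,j] * cov D V c x [k] [p])"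
  by (subst cov_def) (simp add: Let_def)

lemma cov_endo:
  fixes D T :: "('a,'m::finite) tfield"
  shows "conn_matrix (cov D T) c x i
    = pdm i (endo_matrix T c) x + conn_matrix D c x i ** endo_matrix T c x - endo_matrix T c x ** conn_matrix D c x i"
proof -
  have "(\<Sum>p\<in>UNIV. D c x [p] [i, j] * T c x [k] [p]) = (\<Sum>p\<in>UNIV. T c x [k] [p] * D c x [p] [i, j])" for k j
    by (rule sum.cong[OF refl mult.commute])
  then show ?thesis
    unfolding vec_eq_iff conn_matrix_def pdm_def endo_matrix_def matrix_matrix_mult_def
    by (simp add: cov_def[of D T] Let_def)
qed

text \<open>The second derivatives of \<open>V\<close> cancel by symmetry. The terms of first order combine to covariant
  derivatives contracted with the torsion, and those of order zero to the curvature.\<close>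

lemma ricci_identity:
  fixes D V :: "('a,'m::finite) tfield"
  assumes S: "open S" "x \<in> S" and D: "\<And>k i j. smooth_on S (\<lambda>x. D c x [k] [i,j])"
    and V: "\<And>k. smooth_on S (\<lambda>x. V c x [k] [])"
  shows "cov D (cov D V) c x [k] [i,j] - cov D (cov D V) c x [k] [j,i]
    = (\<Sum>p\<in>UNIV. curv (conn_matrix D c) x i j $ k $ p * V c x [p] [])
      - (\<Sum>p\<in>UNIV. (D c x [p] [i,j] - D c x [p] [j,i]) * cov D V c x [k] [p])"
proof -
  let ?v = "\<lambda>p y. V c y [p] []"
  let ?D = "\<lambda>k i j y. D c y [k] [i,j]"
  have dV: "?v p differentiable (at x)" "pd i (?v p) differentiable (at x)" for p i
    using smooth_on_differentiable[OF V S(2)] smooth_on_differentiable[OF smooth_on_pd[OF V] S(2)] by auto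
  have dD: "?D k i j differentiable (at x)" for k i j
    by (rule smooth_on_differentiable[OF D S(2)])
  have pd1: "pd i (\<lambda>y. cov D V c y [k] [j]) x = pd i (pd j (?v k)) x
      + (\<Sum>p\<in>UNIV. pd i (?D k j p) x * ?v p x) + (\<Sum>p\<in>UNIV. ?D k j p x * pd i (?v p) x)" for i j
    unfolding cov_vector using dV dD
    by (subst pd_add) (auto intro!: differentiable_sum differentiable_mult simp: pd_sum pd_mult sum.distrib)
  have comm: "pd i (pd j (?v k)) x = pd j (pd i (?v k)) x"
    by (rule pd_commute[OF S smooth_on_imp_Ck[OF V]])
  have DD: "(\<Sum>p\<in>UNIV. ?D k i p x * cov D V c x [p] [j]) = (\<Sum>p\<in>UNIV. ?D k i p x * pd j (?v p) x)
      + (\<Sum>q\<in>UNIV. (\<Sum>p\<in>UNIV. ?D k i p x * ?D p j q x) * ?v q x)" for i j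
  proof -
    have "(\<Sum>p\<in>UNIV. \<Sum>q\<in>UNIV. ?D k i p x * (?D p j q x * ?v q x))
      = (\<Sum>q\<in>UNIV. (\<Sum>p\<in>UNIV. ?D k i p x * ?D p j q x) * ?v q x)"
      by (subst sum.swap) (simp add: sum_distrib_right mult.assoc)
    then show ?thesis unfolding cov_vector by (simp add: distrib_left sum.distrib sum_distrib_left)
  qed
  have R: "curv (conn_matrix D c) x i j $ k $ p = pd i (?D k j p) x - pd j (?D k i p) x
      + (\<Sum>q\<in>UNIV. ?D k i q x * ?D q j p x) - (\<Sum>q\<in>UNIV. ?D k j q x * ?D q i p x)" for p
    by (simp add: curv_def pdm_def conn_matrix_def matrix_matrix_mult_def)
  show ?thesis
    unfolding cov_cov_vector pd1 DD R comm
    by (simp add: left_diff_distrib distrib_right sum_subtractf sum.distrib)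
qed

context manifold
begin

lemma affine_smooth: "affine_connection A D \<Longrightarrow> c \<in> A \<Longrightarrow> smooth_on (coords c) (\<lambda>x. D c x [k] [i,j])"
  by (simp add: affine_connection_matrix)

lemma affine_mdiff:
  assumes "affine_connection A D" "c \<in> A" "x \<in> coords c" shows "mdiff (\<lambda>y. conn_matrix D c y i) x"
  using smooth_on_differentiable[OF affine_smooth[OF assms(1,2)] assms(3)]
  by (simp add: mdiff_def conn_matrix_def)

lemma frame_change:
  assumes "c \<in> A" "d \<in> A" "y \<in> overlap d c"
  shows "jacm c d (transition d c y) ** jacm d c y = mat 1"
    and "jacm d c y ** jacm c d (transition d c y) = mat 1"
    and "mdiff (jacm d c) y" and "mdiff (\<lambda>y. jacm c d (transition d c y)) y"
    and "mdiff (pdm i (jacm d c)) y" and "pdm i (pdm j (jacm d c)) y = pdm j (pdm i (jacm d c)) y"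
    and "pd i (\<lambda>y. jac d c y a j) y = pd j (\<lambda>y. jac d c y a i) y"
proof -
  let ?y = "transition d c y"
  have y: "?y \<in> overlap c d" by (rule transition_in_overlap[OF assms(2,3)])
  show "jacm c d ?y ** jacm d c y = mat 1" by (rule jacm_inverse[OF assms(2,1,3)])
  then show "jacm d c y ** jacm c d ?y = mat 1" by (simp add: matrix_left_right_inverse)
  show "mdiff (jacm d c) y"
    unfolding mdiff_def jacm_def using smooth_on_differentiable[OF smooth_jac[OF assms(2,1)] assms(3)] by simp
  show "mdiff (\<lambda>y. jacm c d (transition d c y)) y"
    unfolding mdiff_def jacm_def
    using pd_pullback(2)[OF assms(2,1,3) smooth_on_differentiable[OF smooth_jac[OF assms(1,2)] y]] by simp
  show "mdiff (pdm i (jacm d c)) y"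
    unfolding mdiff_def pdm_def jacm_def
    using smooth_on_differentiable[OF smooth_on_pd[OF smooth_jac[OF assms(2,1)]] assms(3)] by simp
  have o: "open (overlap d c)" by (rule open_overlap[OF assms(2,1)])
  have "pd i (pd j (\<lambda>y. jac d c y k l)) y = pd j (pd i (\<lambda>y. jac d c y k l)) y" for k l
    by (rule pd_commute[OF o assms(3) smooth_on_imp_Ck[OF smooth_jac[OF assms(2,1)]]])
  then show "pdm i (pdm j (jacm d c)) y = pdm j (pdm i (jacm d c)) y"
    by (simp add: pdm_def jacm_def vec_eq_iff)
  show "pd i (\<lambda>y. jac d c y a j) y = pd j (\<lambda>y. jac d c y a i) y"
    unfolding jac_def
    by (rule pd_commute[OF o assms(3) smooth_on_imp_Ck[OF smooth_transition[OF assms(2,1)]]])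
qed

lemma pdm_pullback:
  assumes "c \<in> A" "d \<in> A" "y \<in> overlap d c" "mdiff F (transition d c y)"
  shows "pdm i (\<lambda>y. F (transition d c y)) y = (\<Sum>b\<in>UNIV. jac d c y b i *\<^sub>R pdm b F (transition d c y))"
    and "mdiff (\<lambda>y. F (transition d c y)) y"
proof -
  have d: "(\<lambda>x. F x $ k $ j) differentiable (at (transition d c y))" for k j
    using assms(4) by (simp add: mdiff_def)
  show "pdm i (\<lambda>y. F (transition d c y)) y = (\<Sum>b\<in>UNIV. jac d c y b i *\<^sub>R pdm b F (transition d c y))"
    by (simp add: vec_eq_iff pdm_component pd_pullback(1)[OF assms(2,1,3) d])
  show "mdiff (\<lambda>y. F (transition d c y)) y"
    unfolding mdiff_def using pd_pullback(2)[OF assms(2,1,3) d] by simp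
qed

lemma overlap_coords: "y \<in> overlap d c \<Longrightarrow> d \<in> A \<Longrightarrow> transition d c y \<in> coords c"
  by (rule subsetD[OF overlap_subset transition_in_overlap])

definition pulled_conn :: "('a,'m) tfield \<Rightarrow> ('a,'m) chart \<Rightarrow> ('a,'m) chart \<Rightarrow> real^'m \<Rightarrow> 'm \<Rightarrow> real^'m^'m" where
  "pulled_conn D c d y i = (\<Sum>a\<in>UNIV. jac d c y a i *\<^sub>R conn_matrix D c (transition d c y) a)"

lemma conn_matrix_change:
  assumes "affine_connection A D" "c \<in> A" "d \<in> A" "y \<in> overlap d c"
  shows "conn_matrix D d y i = jacm c d (transition d c y) ** pulled_conn D c d y i ** jacm d c y
    + jacm c d (transition d c y) ** pdm i (jacm d c) y"
  using assms(4,3)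
proof (rule overlapE)
  fix p assume "p \<in> fst d" "p \<in> fst c" "y = snd d p" "transition d c y = snd c p"
  then show ?thesis
    using assms(1-3) unfolding affine_connection_matrix pulled_conn_def by auto
qed

lemma curv_change:
  assumes D: "affine_connection A D" and cd: "c \<in> A" "d \<in> A" "y \<in> overlap d c"
  shows "curv (conn_matrix D d) y i j = (\<Sum>a\<in>UNIV. \<Sum>b\<in>UNIV. (jac d c y a i * jac d c y b j) *\<^sub>R
    (jacm c d (transition d c y) ** curv (conn_matrix D c) (transition d c y) a b ** jacm d c y))"
proof -
  let ?T = "transition d c" and ?K = "\<lambda>y. jacm c d (transition d c y)" and ?J = "jacm d c"
  note o = open_overlap[OF cd(2,1)]
  have C: "mdiff (\<lambda>y. conn_matrix D c (?T y) a) y" for a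
    by (rule pdm_pullback(2)[OF cd affine_mdiff[OF D cd(1) overlap_coords[OF cd(3,2)]]])
  have J: "(\<lambda>y. jac d c y a i) differentiable (at y)" for a i
    by (rule smooth_on_differentiable[OF smooth_jac[OF cd(2,1)] cd(3)])
  have "curv (conn_matrix D d) y i j
      = curv (\<lambda>y i. ?K y ** pulled_conn D c d y i ** ?J y + ?K y ** pdm i ?J y) y i j"
    by (rule curv_cong[OF o cd(3)]) (rule conn_matrix_change[OF D cd(1,2)])
  also have "\<dots> = ?K y ** curv (pulled_conn D c d) y i j ** ?J y"
  proof (rule curv_gauge[OF o cd(3)])
    show "mdiff (\<lambda>y. pulled_conn D c d y i) y" for i
      unfolding pulled_conn_def by (intro mdiff_sum mdiff_scaleR J C)
  qed (use frame_change[OF cd(1,2)] cd(3) in auto)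
  also have "curv (pulled_conn D c d) y i j = (\<Sum>a\<in>UNIV. \<Sum>b\<in>UNIV. (jac d c y a i * jac d c y b j) *\<^sub>R
      curv (conn_matrix D c) (?T y) a b)"
    unfolding pulled_conn_def
    by (rule curv_pullback[where J="jac d c" and C="conn_matrix D c" and T="?T", OF J frame_change(7)[OF cd] C])
      (rule pdm_pullback(1)[OF cd affine_mdiff[OF D cd(1) overlap_coords[OF cd(3,2)]]])
  finally show ?thesis
    by (simp add: matrix_mult.sum_left matrix_mult.sum_right matrix_mult.scaleR_left matrix_mult.scaleR_right)
qed

lemma smooth_curv:
  assumes "affine_connection A D" "c \<in> A"
  shows "smooth_on (coords c) (\<lambda>x. curv (conn_matrix D c) x i j $ k $ p)"
proof -
  have "curv (conn_matrix D c) x i j $ k $ p = pd i (\<lambda>y. D c y [k] [j,p]) x - pd j (\<lambda>y. D c y [k] [i,p]) x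
      + (\<Sum>q\<in>UNIV. D c x [k] [i,q] * D c x [q] [j,p]) - (\<Sum>q\<in>UNIV. D c x [k] [j,q] * D c x [q] [i,p])" for x
    by (simp add: curv_def pdm_def conn_matrix_def matrix_matrix_mult_def)
  then show ?thesis
    using assms open_coords by (simp) (intro smooth_intros affine_smooth, auto)
qed

text \<open>The coordinate formula for the torsion defines a tensor because the inhomogeneous term in the
  transformation law of a connection is symmetric, and the one for the curvature by \<open>curv_change\<close>.\<close>

lemma has_curvature_torsion_exists:
  assumes D: "affine_connection A D"
  shows "\<exists>R \<tau>. has_curvature_torsion A D R \<tau>"
proof -
  define R :: "('a,'m) tfield" where
    "R c x us ls = curv (conn_matrix D c) x (ls ! 0) (ls ! 1) $ (us ! 0) $ (ls ! 2)" for c x us ls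
  define \<tau> :: "('a,'m) tfield" where
    "\<tau> c x us ls = D c x us [ls ! 0, ls ! 1] - D c x us [ls ! 1, ls ! 0]" for c x us ls
  have "tensor_field A 1 3 R"
    unfolding tensor_field_13
  proof (intro conjI ballI allI)
    show "smooth_on (coords c) (\<lambda>x. R c x [k] [i,j,q])" if "c \<in> A" for c k i j q
      using smooth_curv[OF D that] by (simp add: R_def)
    have R: "curv_matrix R c x i j = curv (conn_matrix D c) x i j" for c x i j
      by (simp add: curv_matrix_def R_def vec_eq_iff)
    fix c d p i j assume c: "c \<in> A" and d: "d \<in> A" and p: "p \<in> fst c \<inter> fst d"
    have "transition d c (snd d p) = snd c p" using p d by (simp add: transition_def chart_inv_eq)
    then show "curv_matrix R d (snd d p) i j = (\<Sum>a\<in>UNIV. \<Sum>b\<in>UNIV. (jac d c (snd d p) a i * jac d c (snd d p) b j) *\<^sub>R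
        (jacm c d (snd c p) ** curv_matrix R c (snd c p) a b ** jacm d c (snd d p)))"
      using curv_change[OF D c d overlapI, of p i j] p by (simp add: R)
  qed
  moreover have "tensor_field A 1 2 \<tau>"
    unfolding tensor_field_12
  proof (intro conjI ballI allI)
    show "smooth_on (coords c) (\<lambda>x. \<tau> c x [k] [i,j])" if "c \<in> A" for c k i j
      using smooth_on_diff[OF open_coords[OF that] affine_smooth[OF D that] affine_smooth[OF D that]]
      by (simp add: \<tau>_def)
    fix c d p i assume c: "c \<in> A" and d: "d \<in> A" and p: "p \<in> fst c \<inter> fst d"
    let ?y = "snd d p" and ?x = "snd c p"
    have y: "?y \<in> overlap d c" using p by (auto intro: overlapI)
    have T: "transition d c ?y = ?x" using p d by (simp add: transition_def chart_inv_eq)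
    have sym: "pdm i (jacm d c) ?y $ k' $ j = pdm j (jacm d c) ?y $ k' $ i" for k' i j
      using frame_change(7)[OF c d y, of i k' j] by (simp add: pdm_def jacm_def)
    have Dd: "D d ?y [k] [i,j] = (\<Sum>a\<in>UNIV. \<Sum>k'\<in>UNIV. \<Sum>j'\<in>UNIV.
        jac d c ?y a i * (jacm c d ?x $ k $ k' * (jac d c ?y j' j * D c ?x [k'] [a,j'])))
        + (\<Sum>k'\<in>UNIV. jacm c d ?x $ k $ k' * pdm i (jacm d c) ?y $ k' $ j)" for k i j
    proof -
      have "D d ?y [k] [i,j] = conn_matrix D d ?y i $ k $ j" by (simp add: conn_matrix_def)
      also have "\<dots> = (\<Sum>a\<in>UNIV. jac d c ?y a i * (jacm c d ?x ** conn_matrix D c ?x a ** jacm d c ?y) $ k $ j)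
          + (jacm c d ?x ** pdm i (jacm d c) ?y) $ k $ j"
        unfolding conn_matrix_change[OF D c d y] T pulled_conn_def
        by (simp add: matrix_mult.sum_left matrix_mult.sum_right matrix_mult.scaleR_left matrix_mult.scaleR_right)
      also have "(jacm c d ?x ** pdm i (jacm d c) ?y) $ k $ j = (\<Sum>k'\<in>UNIV. jacm c d ?x $ k $ k' * pdm i (jacm d c) ?y $ k' $ j)"
        by (simp add: matrix_matrix_mult_def)
      finally show ?thesis
        unfolding matrix_triple_component by (simp add: conn_matrix_def jacm_def[of d c] sum_distrib_left)
    qed
    have swap: "(\<Sum>a\<in>UNIV. \<Sum>k'\<in>UNIV. \<Sum>j'\<in>UNIV. jac d c ?y a j * (jacm c d ?x $ k $ k' * (jac d c ?y j' i * D c ?x [k'] [a,j'])))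
      = (\<Sum>a\<in>UNIV. \<Sum>k'\<in>UNIV. \<Sum>j'\<in>UNIV. jac d c ?y a i * (jacm c d ?x $ k $ k' * (jac d c ?y j' j * D c ?x [k'] [j',a])))"
      for k i j
    proof -
      let ?f = "\<lambda>a k' j'. jac d c ?y a j * (jacm c d ?x $ k $ k' * (jac d c ?y j' i * D c ?x [k'] [a,j']))"
      have "(\<Sum>a\<in>UNIV. \<Sum>k'\<in>UNIV. \<Sum>j'\<in>UNIV. ?f a k' j') = (\<Sum>k'\<in>UNIV. \<Sum>a\<in>UNIV. \<Sum>j'\<in>UNIV. ?f a k' j')"
        by (rule sum.swap)
      also have "\<dots> = (\<Sum>k'\<in>UNIV. \<Sum>j'\<in>UNIV. \<Sum>a\<in>UNIV. ?f a k' j')"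
        by (intro sum.cong[OF refl] sum.swap)
      also have "\<dots> = (\<Sum>j'\<in>UNIV. \<Sum>k'\<in>UNIV. \<Sum>a\<in>UNIV. ?f a k' j')"
        by (rule sum.swap)
      finally show ?thesis by (simp add: mult_ac)
    qed
    show "conn_matrix \<tau> d ?y i = (\<Sum>a\<in>UNIV. jac d c ?y a i *\<^sub>R (jacm c d ?x ** conn_matrix \<tau> c ?x a ** jacm d c ?y))"
      unfolding vec_eq_iff
    proof (intro allI)
      fix k j
      show "conn_matrix \<tau> d ?y i $ k $ j = (\<Sum>a\<in>UNIV. jac d c ?y a i *\<^sub>R (jacm c d ?x ** conn_matrix \<tau> c ?x a ** jacm d c ?y)) $ k $ j"
        by (simp add: matrix_triple_component)
          (simp add: conn_matrix_def \<tau>_def Dd sym[of i _ j] swap[of j k i] jacm_def[of d c] sum_distrib_left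
            right_diff_distrib sum_subtractf)
    qed
  qed
  moreover have "cov D (cov D V) c x [k] [i,j] - cov D (cov D V) c x [k] [j,i] =
      (\<Sum>p\<in>UNIV. R c x [k] [i,j,p] * V c x [p] []) - (\<Sum>p\<in>UNIV. \<tau> c x [p] [i,j] * cov D V c x [k] [p])"
    if "c \<in> A" "\<forall>k. smooth_on (coords c) (\<lambda>x. V c x [k] [])" "x \<in> coords c" for c V x i j k
    using ricci_identity[where V=V and D=D and c=c, OF open_coords[OF that(1)] that(3) affine_smooth[OF D that(1)]] that
    by (simp add: R_def \<tau>_def)
  ultimately have "has_curvature_torsion A D R \<tau>" by (simp add: has_curvature_torsion_def)
  then show ?thesis by blast
qed

text \<open>Uniqueness: a vector field that vanishes at the point and has a prescribed first derivative there
  determines the torsion, and vector fields with constant components then determine the curvature.\<close>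

theorem curvature_eq:
  assumes D: "affine_connection A D" and c: "c \<in> A" and x: "x \<in> coords c"
  shows "curvature A D c x [k] [i,j,q] = curv (conn_matrix D c) x i j $ k $ q"
proof -
  define R where "R = curvature A D"
  obtain \<tau> where h: "has_curvature_torsion A D R \<tau>"
    using someI_ex[OF has_curvature_torsion_exists[OF D]] unfolding R_def curvature_def by blast
  note o = open_coords[OF c]
  have eq: "(\<Sum>p\<in>UNIV. R c x [k] [i,j,p] * V c x [p] []) - (\<Sum>p\<in>UNIV. \<tau> c x [p] [i,j] * cov D V c x [k] [p])
    = (\<Sum>p\<in>UNIV. curv (conn_matrix D c) x i j $ k $ p * V c x [p] [])
      - (\<Sum>p\<in>UNIV. (D c x [p] [i,j] - D c x [p] [j,i]) * cov D V c x [k] [p])"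
    if V: "\<And>k. smooth_on (coords c) (\<lambda>x. V c x [k] [])" for V :: "('a,'m) tfield" and k
    using ricci_identity[where V=V and D=D and c=c, OF o x affine_smooth[OF D c] V] h c x V
    unfolding has_curvature_torsion_def by simp
  have tau: "\<tau> c x [r] [i,j] = D c x [r] [i,j] - D c x [r] [j,i]" for r
  proof -
    let ?V = "\<lambda>c y us ls. if hd us = r then y $ r - x $ r else 0 :: real"
    have "smooth_on (coords c) (\<lambda>y. ?V c y [k] [])" for k
      using o by (cases "k = r") (auto intro!: smooth_intros)
    from eq[of ?V, OF this, of r]
    have "(\<Sum>p\<in>UNIV. \<tau> c x [p] [i,j] * cov D ?V c x [r] [p])
      = (\<Sum>p\<in>UNIV. (D c x [p] [i,j] - D c x [p] [j,i]) * cov D ?V c x [r] [p])"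
      by (simp cong: if_cong)
    moreover have "cov D ?V c x [r] [p] = (if p = r then 1 else 0)" for p
    proof -
      have "pd p (\<lambda>y. y $ r - x $ r) x = (if p = r then 1 else 0)"
        by (subst pd_diff) (auto simp: pd_component bounded_linear_imp_differentiable bounded_linear_vec_nth)
      then show ?thesis by (simp add: cov_vector cong: if_cong)
    qed
    ultimately show ?thesis by (simp add: if_distrib[of "(*) _"] cong: if_cong)
  qed
  let ?V = "\<lambda>c y us ls. if hd us = q then 1 else 0 :: real"
  have "smooth_on (coords c) (\<lambda>y. ?V c y [k] [])" for k by simp
  from eq[of ?V, OF this, of k] show ?thesis
    unfolding R_def[symmetric] tau by (simp add: if_distrib[of "(*) _"] cong: if_cong)
qed

lemma smooth_11: "tensor_field A 1 1 T \<Longrightarrow> c \<in> A \<Longrightarrow> smooth_on (coords c) (\<lambda>x. T c x [k] [j])"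
  unfolding tensor_field_11 by blast

lemma smooth_12: "tensor_field A 1 2 T \<Longrightarrow> c \<in> A \<Longrightarrow> smooth_on (coords c) (\<lambda>x. T c x [k] [i,j])"
  unfolding tensor_field_12 by blast

text \<open>The derivatives of the Jacobian matrices in \<open>\<partial>T\<close> cancel against the inhomogeneous terms of the
  connection matrices.\<close>

lemma cov_change:
  assumes D: "affine_connection A D" and T: "tensor_field A 1 1 T" and cd: "c \<in> A" "d \<in> A" "y \<in> overlap d c"
  shows "conn_matrix (cov D T) d y i = (\<Sum>a\<in>UNIV. jac d c y a i *\<^sub>R
    (jacm c d (transition d c y) ** conn_matrix (cov D T) c (transition d c y) a ** jacm d c y))"
proof -
  let ?T = "transition d c" and ?K = "\<lambda>y. jacm c d (transition d c y)" and ?J = "jacm d c"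
  let ?E = "endo_matrix T c" and ?B = "pulled_conn D c d y"
  note o = open_overlap[OF cd(2,1)]
  note f = frame_change[OF cd]
  have TE: "mdiff ?E (?T y)"
    using smooth_on_differentiable[OF smooth_11[OF T cd(1)] overlap_coords[OF cd(3,2)]]
    by (simp add: mdiff_def endo_matrix_def)
  have Td: "endo_matrix T d z = ?K z ** ?E (?T z) ** ?J z" if "z \<in> overlap d c" for z
    using that cd(2)
  proof (rule overlapE)
    fix p assume p: "p \<in> fst d" "p \<in> fst c" "z = snd d p" "?T z = snd c p"
    have "endo_matrix T d (snd d p)
        = jacm c d (snd c p) ** endo_matrix T c (snd c p) ** jacm d c (snd d p)"
      using T cd(1,2) p(1,2) unfolding tensor_field_11 by blast
    then show ?thesis using p(3,4) by simp
  qed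
  note E = pdm_pullback[OF cd TE]
  have dK: "pdm i ?K y = - (?K y ** pdm i ?J y ** ?K y)" for i
    by (rule pdm_inverse[OF o cd(3) _ f(2) f(4) f(3)]) (rule frame_change(1)[OF cd(1,2)])
  have "pdm i (endo_matrix T d) y = pdm i (\<lambda>z. ?K z ** ?E (?T z) ** ?J z) y"
    by (rule pdm_cong[OF o cd(3) Td])
  also have "\<dots> = - (?K y ** pdm i ?J y ** ?K y) ** ?E (?T y) ** ?J y
      + ?K y ** (\<Sum>a\<in>UNIV. jac d c y a i *\<^sub>R pdm a ?E (?T y)) ** ?J y + ?K y ** ?E (?T y) ** pdm i ?J y"
    using f(3,4) E by (simp add: pdm_mult mdiff_mult dK matrix_distribs)
  finally have pT: "pdm i (endo_matrix T d) y = \<dots>" .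
  have JK: "?J y ** (?K y ** M) = M" for M by (simp add: matrix_mul_assoc f(2))
  have "conn_matrix (cov D T) d y i
      = ?K y ** ((\<Sum>a\<in>UNIV. jac d c y a i *\<^sub>R pdm a ?E (?T y)) + ?B i ** ?E (?T y) - ?E (?T y) ** ?B i) ** ?J y"
    unfolding cov_endo pT conn_matrix_change[OF D cd] Td[OF cd(3)]
    by (simp add: matrix_distribs matrix_mul_assoc[symmetric] JK)
  also have "(\<Sum>a\<in>UNIV. jac d c y a i *\<^sub>R pdm a ?E (?T y)) + ?B i ** ?E (?T y) - ?E (?T y) ** ?B i
      = (\<Sum>a\<in>UNIV. jac d c y a i *\<^sub>R conn_matrix (cov D T) c (?T y) a)"
    unfolding cov_endo pulled_conn_def
    by (simp add: matrix_mult.sum_left matrix_mult.sum_right matrix_mult.scaleR_left matrix_mult.scaleR_right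
        sum.distrib sum_subtractf scaleR_add_right scaleR_diff_right)
  finally show ?thesis
    by (simp add: matrix_mult.sum_left matrix_mult.sum_right matrix_mult.scaleR_left matrix_mult.scaleR_right)
qed

lemma cov_endo_component:
  "cov D T c x [k] [i,j] = pd i (\<lambda>y. T c y [k] [j]) x + (\<Sum>p\<in>UNIV. D c x [k] [i,p] * T c x [p] [j])
    - (\<Sum>p\<in>UNIV. D c x [p] [i,j] * T c x [k] [p])"
  by (simp add: cov_def[of D T] Let_def)

lemma smooth_cov:
  assumes "affine_connection A D" "tensor_field A 1 1 T" "c \<in> A"
  shows "smooth_on (coords c) (\<lambda>x. cov D T c x [k] [i,j])"
  unfolding cov_endo_component
  by (intro smooth_intros open_coords affine_smooth[OF assms(1)] smooth_11[OF assms(2)] assms(3))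

lemma transition_at: "d \<in> A \<Longrightarrow> p \<in> fst c \<inter> fst d \<Longrightarrow> transition d c (snd d p) = snd c p"
  by (simp add: transition_def chart_inv_eq)

lemma tensor_cov:
  assumes D: "affine_connection A D" and T: "tensor_field A 1 1 T"
  shows "tensor_field A 1 2 (cov D T)"
  unfolding tensor_field_12
proof (intro conjI ballI allI)
  fix c d p i assume c: "c \<in> A" and d: "d \<in> A" and p: "p \<in> fst c \<inter> fst d"
  show "conn_matrix (cov D T) d (snd d p) i = (\<Sum>a\<in>UNIV. jac d c (snd d p) a i *\<^sub>R
      (jacm c d (snd c p) ** conn_matrix (cov D T) c (snd c p) a ** jacm d c (snd d p)))"
    using cov_change[OF D T c d overlapI, of p i] p transition_at[OF d p] by simp
qed (rule smooth_cov[OF D T])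

lemma affine_plus_tensor:
  assumes D: "affine_connection A D" and P: "tensor_field A 1 2 P"
    and E: "\<And>c x k i j. c \<in> A \<Longrightarrow> x \<in> coords c \<Longrightarrow> E c x [k] [i,j] = D c x [k] [i,j] + P c x [k] [i,j]"
  shows "affine_connection A E"
  unfolding affine_connection_matrix
proof (intro conjI ballI allI)
  show "smooth_on (coords c) (\<lambda>x. E c x [k] [i,j])" if c: "c \<in> A" for c k i j
    using smooth_on_add[OF open_coords[OF c] affine_smooth[OF D c] smooth_12[OF P c]]
    by (subst smooth_on_cong[OF open_coords[OF c] E[OF c]])
  fix c d p i assume c: "c \<in> A" and d: "d \<in> A" and p: "p \<in> fst c \<inter> fst d"
  have x: "snd c p \<in> coords c" "snd d p \<in> coords d" using p by (auto simp: coords_def)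
  have Em: "conn_matrix E c z i = conn_matrix D c z i + conn_matrix P c z i" if "c \<in> A" "z \<in> coords c" for c z i
    using E[OF that] by (simp add: conn_matrix_def vec_eq_iff)
  have DD: "conn_matrix D d (snd d p) i
      = jacm c d (snd c p) ** (\<Sum>a\<in>UNIV. jac d c (snd d p) a i *\<^sub>R conn_matrix D c (snd c p) a) ** jacm d c (snd d p)
        + jacm c d (snd c p) ** pdm i (jacm d c) (snd d p)"
    using D c d p unfolding affine_connection_matrix by blast
  have PP: "conn_matrix P d (snd d p) i = (\<Sum>a\<in>UNIV. jac d c (snd d p) a i *\<^sub>R
          (jacm c d (snd c p) ** conn_matrix P c (snd c p) a ** jacm d c (snd d p)))"
    using P c d p unfolding tensor_field_12 by blast
  show "conn_matrix E d (snd d p) i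
      = jacm c d (snd c p) ** (\<Sum>a\<in>UNIV. jac d c (snd d p) a i *\<^sub>R conn_matrix E c (snd c p) a) ** jacm d c (snd d p)
        + jacm c d (snd c p) ** pdm i (jacm d c) (snd d p)"
    unfolding Em[OF d x(2)] Em[OF c x(1)] DD PP
    by (simp add: matrix_distribs scaleR_add_right sum.distrib
        matrix_mult.sum_left matrix_mult.sum_right matrix_mult.scaleR_left matrix_mult.scaleR_right)
qed

lemma tensor_scale_12:
  assumes P: "tensor_field A 1 2 P"
  shows "tensor_field A 1 2 (\<lambda>c x us ls. t * P c x us ls)"
proof -
  let ?Q = "\<lambda>c x us ls. t * P c x us ls"
  have Q: "conn_matrix ?Q c x i = t *\<^sub>R conn_matrix P c x i" for c x i
    by (simp add: conn_matrix_def vec_eq_iff)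
  show ?thesis
    unfolding tensor_field_12
  proof (intro conjI ballI allI)
    show "smooth_on (coords c) (\<lambda>x. ?Q c x [k] [i,j])" if c: "c \<in> A" for c k i j
      by (intro smooth_on_mult open_coords[OF c] smooth_on_const smooth_12[OF P c])
    fix c d p i assume c: "c \<in> A" and d: "d \<in> A" and p: "p \<in> fst c \<inter> fst d"
    have PP: "conn_matrix P d (snd d p) i = (\<Sum>a\<in>UNIV. jac d c (snd d p) a i *\<^sub>R
          (jacm c d (snd c p) ** conn_matrix P c (snd c p) a ** jacm d c (snd d p)))"
      using P c d p unfolding tensor_field_12 by blast
    show "conn_matrix ?Q d (snd d p) i = (\<Sum>a\<in>UNIV. jac d c (snd d p) a i *\<^sub>R
          (jacm c d (snd c p) ** conn_matrix ?Q c (snd c p) a ** jacm d c (snd d p)))"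
      unfolding Q PP
      by (simp add: scaleR_sum_right matrix_mult.scaleR_left matrix_mult.scaleR_right mult.commute)
  qed
qed

lemma affine_translate:
  assumes "affine_connection A D" "tensor_field A 1 2 P"
  shows "affine_connection A (translate D t P)"
  by (rule affine_plus_tensor[OF assms(1) tensor_scale_12[OF assms(2), of t]]) (simp add: translate_def)


section \<open>The action of the gauge group\<close>

lemma endo_matrix_of_matrix: "endo_matrix (endo_of_matrix G) c x = G c x"
  by (simp add: endo_matrix_def endo_of_matrix_def vec_eq_iff)

lemma endo_matrix_inv: "endo_matrix (endo_inv g) c x = matrix_inv (endo_matrix g c x)"
  unfolding endo_inv_def by (rule endo_matrix_of_matrix)

lemma endo_matrix_comp: "endo_matrix (endo_comp g h) c x = endo_matrix g c x ** endo_matrix h c x"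
  unfolding endo_comp_def by (rule endo_matrix_of_matrix)

lemma gauge_act_matrix:
  "conn_matrix (gauge_act g D) c x i
    = conn_matrix D c x i + matrix_inv (endo_matrix g c x) ** conn_matrix (cov D g) c x i"
  by (simp add: conn_matrix_def gauge_act_def vec_eq_iff matrix_matrix_mult_def endo_inv_def endo_of_matrix_def)

lemma gauge_act_matrix':
  assumes "invertible (endo_matrix g c x)"
  shows "conn_matrix (gauge_act g D) c x i
    = matrix_inv (endo_matrix g c x) ** conn_matrix D c x i ** endo_matrix g c x
      + matrix_inv (endo_matrix g c x) ** pdm i (endo_matrix g c) x"
  unfolding gauge_act_matrix cov_endo
  by (simp add: matrix_distribs matrix_mul_assoc matrix_inv_mult[OF assms])

text \<open>In matrix notation the action is \<open>D\<^sub>i \<mapsto> g\<^sup>-\<^sup>1 D\<^sub>i g + g\<^sup>-\<^sup>1 \<partial>\<^sub>i g\<close>, so that \<open>curv_gauge\<close> applies with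
  \<open>J = g\<close>.\<close>

lemma gauge_act_curv:
  assumes D: "affine_connection A D" and g: "tensor_field A 1 1 g"
    and inv: "\<And>c x. c \<in> A \<Longrightarrow> x \<in> coords c \<Longrightarrow> invertible (endo_matrix g c x)"
  shows gauge_act_affine: "affine_connection A (gauge_act g D)"
    and "c \<in> A \<Longrightarrow> x \<in> coords c \<Longrightarrow> curv (conn_matrix (gauge_act g D) c) x i j
      = matrix_inv (endo_matrix g c x) ** curv (conn_matrix D c) x i j ** endo_matrix g c x"
proof -
  have smooth_inv: "smooth_on (coords c) (\<lambda>x. matrix_inv (endo_matrix g c x) $ k $ j)" if c: "c \<in> A" for c k j
  proof (rule smooth_on_matrix_inv[OF open_coords[OF c]])
    show "smooth_on (coords c) (\<lambda>x. endo_matrix g c x $ i $ j)" for i j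
      using smooth_11[OF g c] by (simp add: endo_matrix_def)
    show "det (endo_matrix g c x) \<noteq> 0" if "x \<in> coords c" for x
      using inv[OF c that] invertible_det_nz by blast
  qed
  let ?E = "\<lambda>c x us ls. \<Sum>p\<in>UNIV. endo_inv g c x us [p] * cov D g c x [p] ls"
  have Em: "conn_matrix ?E c x i = matrix_inv (endo_matrix g c x) ** conn_matrix (cov D g) c x i" for c x i
    by (simp add: conn_matrix_def vec_eq_iff matrix_matrix_mult_def endo_inv_def endo_of_matrix_def)
  have "tensor_field A 1 2 ?E"
    unfolding tensor_field_12
  proof (intro conjI ballI allI)
    show "smooth_on (coords c) (\<lambda>x. ?E c x [k] [i,j])" if c: "c \<in> A" for c k i j
      unfolding endo_inv_def endo_of_matrix_def list.sel
      by (intro smooth_intros open_coords c smooth_inv smooth_cov[OF D g])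
    fix c d p i assume c: "c \<in> A" and d: "d \<in> A" and p: "p \<in> fst c \<inter> fst d"
    let ?K = "jacm c d (snd c p)" and ?J = "jacm d c (snd d p)" and ?G = "endo_matrix g c (snd c p)"
    have y: "snd d p \<in> overlap d c" and x: "snd c p \<in> coords c"
      using p by (auto simp: overlap_def coords_def)
    note f = frame_change[OF c d y, unfolded transition_at[OF d p]]
    have JK: "?J ** (?K ** M) = M" for M by (simp add: matrix_mul_assoc f(2))
    have GG: "matrix_inv ?G ** (?G ** M) = M" for M by (simp add: matrix_mul_assoc matrix_inv_mult[OF inv[OF c x]])
    have "endo_matrix g d (snd d p) = ?K ** ?G ** ?J"
      using g c d p unfolding tensor_field_11 by blast
    moreover have "(?K ** matrix_inv ?G ** ?J) ** (?K ** ?G ** ?J) = mat 1"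
      by (simp only: matrix_mul_assoc[symmetric] JK GG f(1))
    ultimately have "matrix_inv (endo_matrix g d (snd d p)) = ?K ** matrix_inv ?G ** ?J"
      by (simp add: matrix_inv_unique)
    moreover have "conn_matrix (cov D g) d (snd d p) i = (\<Sum>a\<in>UNIV. jac d c (snd d p) a i *\<^sub>R
        (?K ** conn_matrix (cov D g) c (snd c p) a ** ?J))"
      using tensor_cov[OF D g] c d p unfolding tensor_field_12 by blast
    ultimately show "conn_matrix ?E d (snd d p) i = (\<Sum>a\<in>UNIV. jac d c (snd d p) a i *\<^sub>R
        (?K ** conn_matrix ?E c (snd c p) a ** ?J))"
      unfolding Em
      by (simp add: matrix_mult.sum_right matrix_mult.scaleR_right matrix_mul_assoc[symmetric] JK)
  qed
  then show "affine_connection A (gauge_act g D)"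
    by (rule affine_plus_tensor[OF D]) (simp add: gauge_act_def)
  assume c: "c \<in> A" and x: "x \<in> coords c"
  note o = open_coords[OF c]
  have "curv (conn_matrix (gauge_act g D) c) x i j
    = curv (\<lambda>y i. matrix_inv (endo_matrix g c y) ** conn_matrix D c y i ** endo_matrix g c y
        + matrix_inv (endo_matrix g c y) ** pdm i (endo_matrix g c) y) x i j"
    by (rule curv_cong[OF o x]) (rule gauge_act_matrix'[OF inv[OF c]])
  also have "\<dots> = matrix_inv (endo_matrix g c x) ** curv (conn_matrix D c) x i j ** endo_matrix g c x"
  proof (rule curv_gauge[OF o x])
    show "matrix_inv (endo_matrix g c y) ** endo_matrix g c y = mat 1" if "y \<in> coords c" for y
      by (rule matrix_inv_mult(2)[OF inv[OF c that]])
    show "endo_matrix g c x ** matrix_inv (endo_matrix g c x) = mat 1"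
      by (rule matrix_inv_mult(1)[OF inv[OF c x]])
    show "mdiff (\<lambda>y. matrix_inv (endo_matrix g c y)) x"
      unfolding mdiff_def using smooth_on_differentiable[OF smooth_inv[OF c] x] by blast
    show "mdiff (endo_matrix g c) x"
      using smooth_on_differentiable[OF smooth_11[OF g c] x] by (simp add: mdiff_def endo_matrix_def)
    show "mdiff (pdm i (endo_matrix g c)) x" for i
      using smooth_on_differentiable[OF smooth_on_pd[OF smooth_11[OF g c]] x]
      by (simp add: mdiff_def pdm_def endo_matrix_def)
    show "mdiff (\<lambda>y. conn_matrix D c y i) x" for i by (rule affine_mdiff[OF D c x])
    show "pdm i (pdm j (endo_matrix g c)) x = pdm j (pdm i (endo_matrix g c)) x" for i j
      using pd_commute[OF o x smooth_on_imp_Ck[OF smooth_11[OF g c]]]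
      by (simp add: pdm_def endo_matrix_def vec_eq_iff)
  qed
  finally show "curv (conn_matrix (gauge_act g D) c) x i j
    = matrix_inv (endo_matrix g c x) ** curv (conn_matrix D c) x i j ** endo_matrix g c x" .
qed

end


section \<open>The matrix exponential near zero\<close>

definition mpow :: "nat \<Rightarrow> real^'m::finite^'m \<Rightarrow> real^'m^'m" where
  "mpow k B = (((**) B) ^^ k) (mat 1)"

lemma mpow_simps [simp]: "mpow 0 B = mat 1" "mpow (Suc k) B = B ** mpow k B"
  by (simp_all add: mpow_def)

fun dmpow :: "nat \<Rightarrow> real^'m::finite^'m \<Rightarrow> real^'m^'m \<Rightarrow> real^'m^'m" where
  "dmpow 0 B h = 0"
| "dmpow (Suc k) B h = h ** mpow k B + B ** dmpow k B h"

lemma has_derivative_mpow: "(mpow k has_derivative dmpow k B) (at B within S)"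
proof (induction k)
  case 0
  have "mpow 0 = (\<lambda>B. mat 1 :: real^'a^'a)" "dmpow 0 B = (\<lambda>h. 0)" by (auto simp: fun_eq_iff)
  then show ?case by simp
next
  case (Suc k)
  have "((\<lambda>B. B ** mpow k B) has_derivative (\<lambda>h. B ** dmpow k B h + h ** mpow k B)) (at B within S)"
    by (rule matrix_mult.FDERIV[OF has_derivative_ident Suc])
  moreover have "mpow (Suc k) = (\<lambda>B. B ** mpow k B)" by (simp add: fun_eq_iff)
  moreover have "dmpow (Suc k) B = (\<lambda>h. B ** dmpow k B h + h ** mpow k B)" by (simp add: fun_eq_iff)
  ultimately show ?case by simp
qed

lemma mpow_series_0: "(\<lambda>k. (1 / fact k) *\<^sub>R mpow k 0) sums (mat 1 :: real^'m::finite^'m)"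
proof -
  have "(\<lambda>k. (1 / fact k) *\<^sub>R mpow k 0) sums (\<Sum>k\<in>{0}. (1 / fact k) *\<^sub>R mpow k (0 :: real^'m^'m))"
  proof (rule sums_finite)
    show "(1 / fact k) *\<^sub>R mpow k (0 :: real^'m^'m) = 0" if "k \<notin> {0}" for k
      using that by (cases k) (simp_all add: matrix_mult.zero_left)
  qed simp
  then show ?thesis by simp
qed

lemma matrix_exp_0: "matrix_exp 0 = (mat 1 :: real^'m::finite^'m)"
  using sums_unique[OF mpow_series_0, symmetric] by (simp add: matrix_exp_def mpow_def)

text \<open>The exponential series is differentiated term by term; on the unit ball the derivatives of the terms
  are dominated by the series \<open>a\<close>, whose sum is the constant \<open>C\<close>. The estimate says that the derivative
  at \<open>B\<close> is the identity up to an error of order \<open>norm B\<close>, which determines the gauge action to first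
  order.\<close>

lemma matrix_exp_derivative:
  obtains E' :: "real^'m::finite^'m \<Rightarrow> real^'m^'m \<Rightarrow> real^'m^'m" and C where "0 \<le> C"
    "\<And>B. norm B < 1 \<Longrightarrow> (matrix_exp has_derivative E' B) (at B)"
    "\<And>B h. norm B < 1 \<Longrightarrow> norm (E' B h - h) \<le> C * norm B * norm h"
proof -
  obtain M where M: "M > 0" "\<And>(P :: real^'m^'m) (Q :: real^'m^'m). norm (P ** Q) \<le> norm P * norm Q * M"
    using matrix_mult.pos_bounded by auto
  define m where "m = norm (mat 1 :: real^'m^'m)"
  have m: "m \<ge> 0" by (simp add: m_def)
  have pow: "norm (mpow k B) \<le> (M * norm B) ^ k * m" for k and B :: "real^'m^'m"
  proof (induction k)
    case (Suc k)
    have "norm (B ** mpow k B) \<le> norm B * norm (mpow k B) * M" by (rule M(2))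
    also have "\<dots> \<le> norm B * ((M * norm B) ^ k * m) * M"
      using Suc M(1) by (intro mult_right_mono mult_left_mono) auto
    finally show ?case by (simp add: mult_ac)
  qed (simp add: m_def)
  define a where "a k = (case k of 0 \<Rightarrow> 0 | Suc j \<Rightarrow> M * m * (M ^ j / fact j))" for k
  have a0: "a k \<ge> 0" for k using M(1) m by (auto simp: a_def split: nat.splits)
  have suma: "summable a"
  proof -
    have "summable (\<lambda>j. M * m * (M ^ j / fact j))"
      using summable_exp[of M] by (intro summable_mult) (simp add: field_simps)
    then have "summable (\<lambda>j. a (Suc j))" by (simp add: a_def)
    then show ?thesis by (simp only: summable_Suc_iff)
  qed
  have dpow: "norm (dmpow (Suc k) B h) \<le> real (Suc k) * (M * m * (M * norm B) ^ k * norm h)"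
    for k and B h :: "real^'m^'m"
  proof (induction k)
    case 0
    have "norm (h ** mat 1) \<le> norm h * norm (mat 1 :: real^'m^'m) * M" by (rule M(2))
    then show ?case by (simp add: m_def mult_ac)
  next
    case (Suc k)
    have "norm (dmpow (Suc (Suc k)) B h) \<le> norm (h ** mpow (Suc k) B) + norm (B ** dmpow (Suc k) B h)"
      by (simp only: dmpow.simps(2)[of "Suc k"] norm_triangle_ineq)
    also have "\<dots> \<le> norm h * norm (mpow (Suc k) B) * M + norm B * norm (dmpow (Suc k) B h) * M"
      by (intro add_mono M(2))
    also have "\<dots> \<le> norm h * ((M * norm B) ^ Suc k * m) * M
        + norm B * (real (Suc k) * (M * m * (M * norm B) ^ k * norm h)) * M"
      using Suc pow[of "Suc k" B] M(1) by (intro add_mono mult_right_mono mult_left_mono) auto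
    finally show ?case by (simp add: algebra_simps)
  qed
  let ?f = "\<lambda>k B. (1 / fact k) *\<^sub>R mpow k B"
  let ?d = "\<lambda>k B h. (1 / fact k) *\<^sub>R dmpow k B h"
  have db: "norm (?d (Suc k) B h) \<le> a (Suc k) * norm B ^ k * norm h" for k and B h :: "real^'m^'m"
  proof -
    have "norm (?d (Suc k) B h) \<le> (1 / fact (Suc k)) * (real (Suc k) * (M * m * (M * norm B) ^ k * norm h))"
      unfolding norm_scaleR using dpow[of k B h] by (intro mult_mono) auto
    also have "\<dots> = a (Suc k) * norm B ^ k * norm h"
      by (simp add: a_def power_mult_distrib field_simps del: of_nat_Suc)
    finally show ?thesis .
  qed
  have db1: "norm (?d k B h) \<le> a k * norm h" if "norm B < 1" for k and B h :: "real^'m^'m"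
  proof (cases k)
    case (Suc j)
    have "a (Suc j) * norm B ^ j * norm h \<le> a (Suc j) * 1 * norm h"
      using a0 that by (intro mult_right_mono mult_left_mono power_le_one) auto
    then show ?thesis using db[of j B h] Suc by simp
  qed (simp add: a_def)
  define E' where "E' B h = (\<Sum>k. ?d k B h)" for B h :: "real^'m^'m"
  have sumd: "summable (\<lambda>k. ?d k B h)" if "norm B < 1" for B h :: "real^'m^'m"
    by (rule summable_comparison_test'[OF summable_mult2[OF suma, of "norm h"]]) (rule db1[OF that])
  have unif: "\<forall>\<^sub>F n in sequentially. \<forall>B\<in>ball 0 1. \<forall>h. norm ((\<Sum>k<n. ?d k B h) - E' B h) \<le> e * norm h"
    if "e > 0" for e
  proof -
    have "(\<lambda>n. suminf a - (\<Sum>k<n. a k)) \<longlonglongrightarrow> suminf a - suminf a"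
      by (intro tendsto_diff tendsto_const summable_LIMSEQ suma)
    then have "\<forall>\<^sub>F n in sequentially. suminf a - (\<Sum>k<n. a k) < e"
      using that by (intro order_tendstoD(2)[where y=0]) auto
    then show ?thesis
    proof (rule eventually_mono, intro ballI allI)
      fix n and B h :: "real^'m^'m" assume n: "suminf a - (\<Sum>k<n. a k) < e" and "B \<in> ball 0 1"
      then have B: "norm B < 1" by simp
      have sn: "summable (\<lambda>k. norm (?d (k + n) B h))"
        by (rule summable_comparison_test'[OF summable_mult2[OF summable_ignore_initial_segment[OF suma, of n], of "norm h"]])
          (simp only: real_norm_def abs_norm_cancel, rule db1[OF B])
      have "norm ((\<Sum>k<n. ?d k B h) - E' B h) = norm (\<Sum>k. ?d (k + n) B h)"
        unfolding E'_def suminf_minus_initial_segment[OF sumd[OF B]] by (rule norm_minus_commute)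
      also have "\<dots> \<le> (\<Sum>k. norm (?d (k + n) B h))" by (rule summable_norm[OF sn])
      also have "\<dots> \<le> (\<Sum>k. a (k + n) * norm h)"
        by (intro suminf_le sn summable_mult2 summable_ignore_initial_segment suma db1[OF B])
      also have "\<dots> = (suminf a - (\<Sum>k<n. a k)) * norm h"
        by (subst suminf_mult2[symmetric]) (simp_all add: suminf_minus_initial_segment summable_ignore_initial_segment suma)
      also have "\<dots> \<le> e * norm h" using n by (intro mult_right_mono) auto
      finally show "norm ((\<Sum>k<n. ?d k B h) - E' B h) \<le> e * norm h" .
    qed
  qed
  have "\<exists>g. \<forall>B\<in>ball 0 1. (\<lambda>k. ?f k B) sums g B \<and> (g has_derivative E' B) (at B within ball 0 1)"
  proof (rule has_derivative_series[where f="?f" and f'="?d", OF convex_ball _ unif _ mpow_series_0])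
    show "(?f n has_derivative ?d n B) (at B within ball 0 1)" for n and B :: "real^'m^'m"
      by (rule has_derivative_scaleR_right[OF has_derivative_mpow])
  qed simp_all
  then obtain g where g: "\<And>B. B \<in> ball 0 1 \<Longrightarrow> (\<lambda>k. ?f k B) sums g B"
    "\<And>B. B \<in> ball 0 1 \<Longrightarrow> (g has_derivative E' B) (at B within ball 0 1)" by blast
  have ge: "g B = matrix_exp B" if "B \<in> ball 0 1" for B
    using sums_unique[OF g(1)[OF that]] by (simp add: matrix_exp_def mpow_def)
  show ?thesis
  proof (rule that[of "suminf a" E'])
    show "0 \<le> suminf a" by (rule suminf_nonneg[OF suma a0])
    fix B :: "real^'m^'m" assume B: "norm B < 1"
    then have Bb: "B \<in> ball 0 1" by simp
    have "(g has_derivative E' B) (at B)" using g(2)[OF Bb] unfolding at_within_open[OF Bb open_ball] .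
    then show "(matrix_exp has_derivative E' B) (at B)"
      using has_derivative_cong_open[of "ball 0 1" B g matrix_exp "E' B"] Bb ge by blast
    fix h :: "real^'m^'m"
    let ?r = "\<lambda>k. ?d k B h - (if k = 1 then h else 0)"
    have r: "norm (?r k) \<le> a k * (norm B * norm h)" for k
    proof -
      consider "k = 0" | "k = 1" | j where "k = Suc (Suc j)" by (metis One_nat_def not0_implies_Suc)
      then show ?thesis
      proof cases
        case 2
        then show ?thesis using a0[of 1] by (simp add: matrix_mult.zero_right)
      next
        case 3
        have "norm B ^ Suc j \<le> norm B" using B power_decreasing[of 1 "Suc j" "norm B"] by simp
        then have "a (Suc (Suc j)) * norm B ^ Suc j * norm h \<le> a (Suc (Suc j)) * norm B * norm h"
          using a0 by (intro mult_right_mono mult_left_mono) auto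
        then show ?thesis using db[of "Suc j" B h] 3 by (simp add: mult.assoc)
      qed (simp add: a_def)
    qed
    have s1: "(\<lambda>k. if k = 1 then h else 0) sums h" by (rule sums_single)
    have sr: "?r sums (E' B h - h)"
      unfolding E'_def by (intro sums_diff summable_sums sumd[OF B] s1)
    have sn: "summable (\<lambda>k. norm (?r k))"
      by (rule summable_comparison_test'[OF summable_mult2[OF suma, of "norm B * norm h"]])
        (simp only: real_norm_def abs_norm_cancel, rule r)
    have "norm (E' B h - h) = norm (\<Sum>k. ?r k)" using sums_unique[OF sr] by simp
    also have "\<dots> \<le> (\<Sum>k. norm (?r k))" by (rule summable_norm[OF sn])
    also have "\<dots> \<le> (\<Sum>k. a k * (norm B * norm h))" by (intro suminf_le sn summable_mult2 suma r)
    also have "\<dots> = suminf a * norm B * norm h" using suma by (simp add: suminf_mult2[symmetric] mult.assoc)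
    finally show "norm (E' B h - h) \<le> suminf a * norm B * norm h" .
  qed
qed

lemma DERIV_quadratic_remainder:
  assumes "\<And>t. \<bar>t\<bar> < \<delta> \<Longrightarrow> \<bar>f t - t * d\<bar> \<le> K * t\<^sup>2" "\<delta> > 0"
  shows "(f has_real_derivative d) (at 0)"
proof -
  have f0: "f 0 = 0" using assms(1)[of 0] assms(2) by simp
  have "\<forall>\<^sub>F h in at 0. norm ((f (0 + h) - f 0) / h - d) \<le> \<bar>h\<bar> * K"
    unfolding eventually_at
  proof (intro exI[of _ \<delta>] conjI ballI impI)
    fix h :: real assume "h \<noteq> 0 \<and> dist h 0 < \<delta>"
    then have h: "h \<noteq> 0" "\<bar>h\<bar> < \<delta>" by auto
    have "(f (0 + h) - f 0) / h - d = (f h - h * d) / h" using h f0 by (simp add: field_simps)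
    then have "norm ((f (0 + h) - f 0) / h - d) = \<bar>f h - h * d\<bar> / \<bar>h\<bar>" by (simp add: abs_divide)
    also have "\<dots> \<le> K * h\<^sup>2 / \<bar>h\<bar>" using assms(1)[OF h(2)] by (intro divide_right_mono) auto
    also have "\<dots> = \<bar>h\<bar> * K" using h by (simp add: power2_eq_square field_simps abs_if)
    finally show "norm ((f (0 + h) - f 0) / h - d) \<le> \<bar>h\<bar> * K" .
  qed (use assms in auto)
  moreover have "((\<lambda>h. \<bar>h\<bar> * K) \<longlongrightarrow> 0) (at (0::real))"
    by (auto intro!: tendsto_eq_intros)
  ultimately have "((\<lambda>h. (f (0 + h) - f 0) / h - d) \<longlongrightarrow> 0) (at 0)"
    by (rule Lim_null_comparison)
  then show ?thesis unfolding DERIV_def by (simp add: LIM_zero_iff)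
qed

lemma isCont_det:
  fixes M :: "real \<Rightarrow> real^'m::finite^'m"
  assumes "\<And>a b. isCont (\<lambda>t. M t $ a $ b) u"
  shows "isCont (\<lambda>t. det (M t)) u"
  unfolding det_def by (intro continuous_sum continuous_mult continuous_prod continuous_const assms)

text \<open>Since \<open>v\<close> vanishes at zero, continuity of the factor \<open>u\<close> suffices. This is applied with \<open>u = g\<^sup>-\<^sup>1\<close> and
  \<open>v = \<nabla>g\<close> for the curve \<open>g = exp(-t\<alpha>)\<close>.\<close>

lemma DERIV_mult_zero:
  fixes u v :: "real \<Rightarrow> real"
  assumes "isCont u 0" "(v has_real_derivative d) (at 0)" "v 0 = 0"
  shows "((\<lambda>t. u t * v t) has_real_derivative u 0 * d) (at 0)"
proof -
  have "((\<lambda>h. u h * ((v (0 + h) - v 0) / h)) \<longlongrightarrow> u 0 * d) (at 0)"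
    using assms(1,2) unfolding isCont_def DERIV_def by (rule tendsto_mult)
  then show ?thesis using assms(3) unfolding DERIV_def by simp
qed

context manifold
begin

text \<open>For \<open>g = exp(-t\<alpha>)\<close> the field \<open>\<nabla>g\<close> vanishes at \<open>t = 0\<close>, because the identity is parallel. Hence only
  the derivative of \<open>\<nabla>g\<close> contributes to that of \<open>g\<^sup>-\<^sup>1 \<nabla>g\<close>. It is \<open>- \<nabla>\<alpha>\<close>, because
  \<open>exp(-t\<alpha>)\<close> and its first derivatives in \<open>M\<close> agree with those of \<open>1 - t\<alpha>\<close> up to \<open>O(t\<^sup>2)\<close>.\<close>

lemma gauge_vector_field_eq:
  assumes D: "affine_connection A D" and T: "tensor_field A 1 1 \<alpha>" and c: "c \<in> A" and x: "x \<in> coords c"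
  shows "gauge_vector_field \<alpha> D c x [k] [i,j] = - cov D \<alpha> c x [k] [i,j]"
proof -
  let ?a = "endo_matrix \<alpha> c"
  define G where "G t = endo_exp (\<lambda>c x us ls. - t * \<alpha> c x us ls)" for t
  obtain E' C where E': "0 \<le> C"
    "\<And>B :: real^'m^'m. norm B < 1 \<Longrightarrow> (matrix_exp has_derivative E' B) (at B)"
    "\<And>(B :: real^'m^'m) h. norm B < 1 \<Longrightarrow> norm (E' B h - h) \<le> C * norm B * norm h"
    using matrix_exp_derivative by metis
  have Gm: "endo_matrix (G t) c y = matrix_exp (- t *\<^sub>R ?a y)" for t y
  proof -
    have "endo_matrix (\<lambda>c x us ls. - t * \<alpha> c x us ls) c y = - t *\<^sub>R ?a y"
      by (simp add: endo_matrix_def vec_eq_iff)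
    then show ?thesis unfolding G_def endo_exp_def endo_matrix_of_matrix by simp
  qed
  define \<delta> where "\<delta> = 1 / (norm (?a x) + 1)"
  have \<delta>: "\<delta> > 0" by (simp add: \<delta>_def add_nonneg_pos)
  have small: "norm (- t *\<^sub>R ?a x) < 1" if "\<bar>t\<bar> < \<delta>" for t
  proof -
    have "\<bar>t\<bar> * norm (?a x) \<le> \<bar>t\<bar> * (norm (?a x) + 1)" by (intro mult_left_mono) auto
    also have "\<dots> < \<delta> * (norm (?a x) + 1)" using that by (intro mult_strict_right_mono) (auto intro: add_nonneg_pos)
    also have "\<dots> = 1" using add_nonneg_pos[OF norm_ge_zero[of "?a x"], of 1] by (simp add: \<delta>_def)
    finally show ?thesis by simp
  qed
  have da: "(\<lambda>y. ?a y $ k $ j) differentiable (at x)" for k j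
    using smooth_on_differentiable[OF smooth_11[OF T c] x] by (simp add: endo_matrix_def)
  have a': "(?a has_derivative (\<lambda>h. \<chi> k j. \<Sum>i\<in>UNIV. h $ i * pd i (\<lambda>y. ?a y $ k $ j) x)) (at x)"
  proof (rule has_derivative_componentwise_within[THEN iffD2], rule ballI)
    fix b :: "real^'m^'m" assume "b \<in> Basis"
    then obtain k j where b: "b = axis k (axis j 1)" by (auto simp: Basis_vec_def)
    show "((\<lambda>y. ?a y \<bullet> b) has_derivative
      (\<lambda>h. (\<chi> k j. \<Sum>i\<in>UNIV. h $ i * pd i (\<lambda>y. ?a y $ k $ j) x) \<bullet> b)) (at x)"
      using has_derivative_pd[OF da, of k j] unfolding b by (simp add: inner_axis)
  qed
  have pG: "pdm i (endo_matrix (G t) c) x = E' (- t *\<^sub>R ?a x) (- t *\<^sub>R pdm i ?a x)" if t: "\<bar>t\<bar> < \<delta>" for t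
  proof -
    have "((\<lambda>y. matrix_exp (- t *\<^sub>R ?a y)) has_derivative
        (\<lambda>h. E' (- t *\<^sub>R ?a x) (- t *\<^sub>R (\<chi> k j. \<Sum>i\<in>UNIV. h $ i * pd i (\<lambda>y. ?a y $ k $ j) x)))) (at x)"
      by (rule has_derivative_compose[OF has_derivative_scaleR_right[OF a'] E'(2)[OF small[OF t]]])
    then have "((\<lambda>y. matrix_exp (- t *\<^sub>R ?a y) $ k $ j) has_derivative
        (\<lambda>h. E' (- t *\<^sub>R ?a x) (- t *\<^sub>R (\<chi> k j. \<Sum>i\<in>UNIV. h $ i * pd i (\<lambda>y. ?a y $ k $ j) x)) $ k $ j)) (at x)"
      for k j
      by (intro bounded_linear.has_derivative[OF bounded_linear_vec_nth])
    from pd_eqI[OF this, of i] show ?thesis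
      by (simp add: pdm_def Gm[abs_def] vec_eq_iff axis_def if_distrib[of "\<lambda>z. z * _"] cong: if_cong)
  qed
  \<comment> \<open>the derivative at zero of the factor \<open>\<nabla>\<^sub>i g\<close>, which vanishes at zero\<close>
  have d1: "((\<lambda>t. pdm i (endo_matrix (G t) c) x $ p $ j) has_real_derivative - pdm i ?a x $ p $ j) (at 0)" for p j
  proof (rule DERIV_quadratic_remainder[OF _ \<delta>, where K="C * norm (?a x) * norm (pdm i ?a x)"])
    fix t :: real assume t: "\<bar>t\<bar> < \<delta>"
    let ?Z = "E' (- t *\<^sub>R ?a x) (- t *\<^sub>R pdm i ?a x)"
    have "\<bar>(?Z - (- t *\<^sub>R pdm i ?a x)) $ p $ j\<bar> \<le> norm ((?Z - (- t *\<^sub>R pdm i ?a x)) $ p)"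
      by (rule component_le_norm_cart)
    also have "\<dots> \<le> norm (?Z - (- t *\<^sub>R pdm i ?a x))"
      by (rule Finite_Cartesian_Product.norm_nth_le)
    also have "\<dots> \<le> C * norm (- t *\<^sub>R ?a x) * norm (- t *\<^sub>R pdm i ?a x)" by (rule E'(3)[OF small[OF t]])
    finally show "\<bar>pdm i (endo_matrix (G t) c) x $ p $ j - t * - pdm i ?a x $ p $ j\<bar>
        \<le> C * norm (?a x) * norm (pdm i ?a x) * t\<^sup>2"
      unfolding pG[OF t] by (simp add: power2_eq_square mult_ac)
  qed
  have d2: "((\<lambda>t. endo_matrix (G t) c x $ p $ j) has_real_derivative - ?a x $ p $ j) (at 0)" for p j
  proof -
    have "E' 0 = (\<lambda>h. h)" using E'(3)[of 0] by (intro ext) simp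
    then have e: "(matrix_exp has_derivative (\<lambda>h. h)) (at (0 *\<^sub>R (- ?a x)))"
      using E'(2)[of 0] by simp
    have "((\<lambda>t. t *\<^sub>R (- ?a x)) has_derivative (\<lambda>h. h *\<^sub>R (- ?a x))) (at 0)"
      by (rule bounded_linear.has_derivative[OF bounded_linear_scaleR_left has_derivative_ident])
    from has_derivative_compose[OF this e]
    have "((\<lambda>t. matrix_exp (t *\<^sub>R (- ?a x))) has_derivative (\<lambda>h. h *\<^sub>R (- ?a x))) (at 0)" .
    then have "((\<lambda>t. matrix_exp (t *\<^sub>R (- ?a x)) $ p $ j) has_derivative (\<lambda>h. (h *\<^sub>R (- ?a x)) $ p $ j)) (at 0)"
      by (intro bounded_linear.has_derivative[OF bounded_linear_vec_nth])
    moreover have "(*) (- ?a x $ p $ j) = (\<lambda>h. - (h * ?a x $ p $ j))"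
      by (simp add: fun_eq_iff mult.commute)
    ultimately show ?thesis by (simp add: has_field_derivative_def Gm)
  qed
  have G0: "endo_matrix (G 0) c y = mat 1" for y by (simp add: Gm matrix_exp_0)
  define V where "V t p = cov D (G t) c x [p] [i,j]" for t p
  have Vm: "V t p = pdm i (endo_matrix (G t) c) x $ p $ j + (\<Sum>q\<in>UNIV. D c x [p] [i,q] * endo_matrix (G t) c x $ q $ j)
      - (\<Sum>q\<in>UNIV. D c x [q] [i,j] * endo_matrix (G t) c x $ p $ q)" for t p
    unfolding V_def cov_endo_component by (simp add: pdm_def endo_matrix_def)
  have V0: "V 0 p = 0" for p
    unfolding Vm G0[abs_def] by (simp add: mat_def if_distrib[of "(*) _"] cong: if_cong)
  have dV: "((\<lambda>t. V t p) has_real_derivative - cov D \<alpha> c x [p] [i,j]) (at 0)" for p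
    unfolding Vm cov_endo_component
    by (rule derivative_eq_intros d1 d2 refl)+ (simp add: pdm_def endo_matrix_def sum_negf mult.commute)
  have detc: "isCont (\<lambda>t. det (\<chi> a b. if b = q then z a else endo_matrix (G t) c x $ a $ b)) 0" for q z
  proof (rule isCont_det)
    show "isCont (\<lambda>t. (\<chi> a b. if b = q then z a else endo_matrix (G t) c x $ a $ b) $ a $ b) 0" for a b
      using DERIV_isCont[OF d2, of a b] by (cases "b = q") simp_all
  qed
  have detc': "isCont (\<lambda>t. det (endo_matrix (G t) c x)) 0"
    by (rule isCont_det) (rule DERIV_isCont[OF d2])
  have nz: "\<forall>\<^sub>F t in nhds 0. det (endo_matrix (G t) c x) \<noteq> 0"
  proof -
    have "((\<lambda>t. det (endo_matrix (G t) c x)) \<longlongrightarrow> 1) (at 0)"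
      using detc' by (simp add: isCont_def G0)
    then have "\<forall>\<^sub>F t in at 0. det (endo_matrix (G t) c x) \<noteq> 0"
      by (rule tendsto_imp_eventually_ne) simp
    then show ?thesis unfolding eventually_nhds_conv_at by (simp add: G0)
  qed
  have N: "isCont (\<lambda>t. matrix_inv (endo_matrix (G t) c x) $ k $ p) 0" for p
  proof -
    have "isCont (\<lambda>t. det (\<chi> a b. if b = k then (if a = p then 1 else 0) else endo_matrix (G t) c x $ a $ b)
        / det (endo_matrix (G t) c x)) 0"
      using detc detc' by (intro continuous_intros) (simp_all add: G0)
    moreover have "\<forall>\<^sub>F t in nhds 0. matrix_inv (endo_matrix (G t) c x) $ k $ p
      = det (\<chi> a b. if b = k then (if a = p then 1 else 0) else endo_matrix (G t) c x $ a $ b)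
        / det (endo_matrix (G t) c x)"
      using nz by eventually_elim (rule matrix_inv_entry)
    ultimately show ?thesis by (subst isCont_cong)
  qed
  have inv0: "matrix_inv (endo_matrix (G 0) c x) $ k $ p = (if k = p then 1 else 0)" for p
  proof -
    have "matrix_inv (mat 1 :: real^'m^'m) = mat 1" by (rule matrix_inv_unique) simp
    then show ?thesis unfolding G0 by (simp add: mat_def)
  qed
  have "((\<lambda>t. gauge_act (G t) D c x [k] [i,j]) has_real_derivative
      0 + (\<Sum>p\<in>UNIV. matrix_inv (endo_matrix (G 0) c x) $ k $ p * - cov D \<alpha> c x [p] [i,j])) (at 0)"
    unfolding gauge_act_def V_def[symmetric] endo_inv_def endo_of_matrix_def list.sel
    by (intro DERIV_add DERIV_const DERIV_sum DERIV_mult_zero N dV V0)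
  then have "((\<lambda>t. gauge_act (G t) D c x [k] [i,j]) has_real_derivative - cov D \<alpha> c x [k] [i,j]) (at 0)"
    by (simp add: inv0 if_distrib[of "\<lambda>z. z * _"] sum_negf cong: if_cong)
  from DERIV_imp_deriv[OF this] show ?thesis
    by (simp add: gauge_vector_field_def G_def)
qed

end

section \<open>The Liouville density\<close>

lemma has_real_derivative_abs:
  assumes "u \<noteq> (0::real)" shows "(abs has_real_derivative sgn u) (at u)"
proof (cases "u > 0")
  case True
  have "((\<lambda>x. x) has_real_derivative sgn u) (at u)" using True by simp
  then show ?thesis
    by (rule has_field_derivative_transform_within_open[of _ _ _ "{0<..}"]) (use True in auto)
next
  case False
  then have "u < 0" using assms by simp
  have "((\<lambda>x. - x) has_real_derivative sgn u) (at u)" using \<open>u < 0\<close> by (auto intro!: derivative_eq_intros)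
  then show ?thesis
    by (rule has_field_derivative_transform_within_open[of _ _ _ "{..<0}"]) (use \<open>u < 0\<close> in auto)
qed

text \<open>At a zero of \<open>f\<close> the differential of \<open>f\<close> vanishes as well, and then so does that of \<open>\<bar>f\<bar>\<close>. This is how
  the Liouville density, the absolute value of a Pfaffian, is differentiated.\<close>

lemma pd_abs:
  fixes f :: "real^'m::finite \<Rightarrow> real"
  assumes f: "f differentiable (at x)" and q: "\<And>i. pd i f x = q i * f x"
  shows "pd i (\<lambda>y. \<bar>f y\<bar>) x = q i * \<bar>f x\<bar>" and "(\<lambda>y. \<bar>f y\<bar>) differentiable (at x)"
proof -
  have "pd i (\<lambda>y. \<bar>f y\<bar>) x = q i * \<bar>f x\<bar> \<and> (\<lambda>y. \<bar>f y\<bar>) differentiable (at x)"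
  proof (cases "f x = 0")
    case True
    have "(f has_derivative (\<lambda>h. 0)) (at x)" using has_derivative_pd[OF f] by (simp add: q True)
    then have "((\<lambda>y. \<bar>f y\<bar>) has_derivative (\<lambda>h. 0)) (at x)"
      by (simp add: has_derivative_iff_norm True)
    from pd_eqI[OF this, of i] this show ?thesis by (auto simp: True differentiable_def)
  next
    case False
    from pd_compose_real[OF has_real_derivative_abs[OF this] f] show ?thesis
      by (simp add: q abs_if sgn_if)
  qed
  then show "pd i (\<lambda>y. \<bar>f y\<bar>) x = q i * \<bar>f x\<bar>" and "(\<lambda>y. \<bar>f y\<bar>) differentiable (at x)" by auto
qed

text \<open>By the product rule, and each of the \<open>n\<close> factors contributes the same amount by \<open>pfs_one_factor\<close>.\<close>

lemma (in pairing) pd_pf: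
  fixes W :: "real^'k::finite \<Rightarrow> 'm \<Rightarrow> 'm \<Rightarrow> real"
  assumes W: "\<And>i j. (\<lambda>y. W y i j) differentiable (at x)"
  shows "pd l (\<lambda>y. pf (W y)) x = real n * pfm (\<lambda>i j. pd l (\<lambda>y. W y i j) x) (W x)"
    and "(\<lambda>y. pf (W y)) differentiable (at x)"
proof -
  let ?dW = "\<lambda>i j. pd l (\<lambda>y. W y i j) x"
  have "pd l (\<lambda>y. pf (W y)) x = (\<Sum>p | p permutes UNIV. of_int (sign p) *
      (\<Sum>a<n. ?dW (p (e (2*a))) (p (e (2*a+1))) * (\<Prod>b\<in>{..<n}-{a}. W x (p (e (2*b))) (p (e (2*b+1))))))"
    unfolding pfs_def using W
    by (subst pd_sum) (auto intro!: sum.cong differentiable_mult differentiable_prod simp: pd_cmult pd_prod differentiable_prod)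
  also have "\<dots> = (\<Sum>p | p permutes UNIV. \<Sum>a<n. of_int (sign p) *
      (\<Prod>b<n. (if b = a then ?dW else W x) (p (e (2*b))) (p (e (2*b+1)))))"
  proof (intro sum.cong[OF refl], unfold sum_distrib_left, intro sum.cong[OF refl])
    fix p :: "'m \<Rightarrow> 'm" and a assume a: "a \<in> {..<n}"
    have "(\<Prod>b<n. (if b = a then ?dW else W x) (p (e (2*b))) (p (e (2*b+1))))
      = ?dW (p (e (2*a))) (p (e (2*a+1))) * (\<Prod>b\<in>{..<n}-{a}. W x (p (e (2*b))) (p (e (2*b+1))))"
      using a by (subst prod.remove[of _ a]) (auto intro!: prod.cong)
    then show "of_int (sign p) * (?dW (p (e (2*a))) (p (e (2*a+1))) * (\<Prod>b\<in>{..<n}-{a}. W x (p (e (2*b))) (p (e (2*b+1)))))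
      = of_int (sign p) * (\<Prod>b<n. (if b = a then ?dW else W x) (p (e (2*b))) (p (e (2*b+1))))" by simp
  qed
  also have "\<dots> = (\<Sum>a<n. pfs (\<lambda>b. if b = a then ?dW else W x))"
    unfolding pfs_def by (rule sum.swap)
  also have "\<dots> = real n * pfm ?dW (W x)" by (simp add: pfs_one_factor)
  finally show "pd l (\<lambda>y. pf (W y)) x = real n * pfm ?dW (W x)" .
  show "(\<lambda>y. pf (W y)) differentiable (at x)"
    unfolding pfs_def using W by (auto intro!: differentiable_sum differentiable_mult differentiable_prod)
qed

locale compact_symplectic = manifold X A
  for X :: "'a topology" and A :: "('a,'m::finite) chart set" +
  fixes n :: nat and \<Omega> :: "('a,'m) tfield"
  assumes csm: "compact_symplectic_manifold X A n \<Omega>"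
begin

text \<open>The same choice as in the definition of \<open>form_integral\<close>.\<close>

definition en :: "'m list" where
  "en = (SOME e. distinct e \<and> set e = (UNIV :: 'm set))"

lemma en: "distinct en" "set en = UNIV" "length en = 2 * n"
proof -
  have "\<exists>e. set e = (UNIV :: 'm set) \<and> distinct e"
    by (rule finite_distinct_list) simp
  then have "\<exists>e. distinct e \<and> set e = (UNIV :: 'm set)" by (simp only: conj_commute)
  from someI_ex[OF this] show 1: "distinct en" "set en = UNIV" by (auto simp: en_def)
  show "length en = 2 * n"
    using distinct_card[OF 1(1)] 1(2) csm by (simp add: compact_symplectic_manifold_def)
qed

sublocale pairing n "(!) en"
proof
  have "CARD('m) > 0" by simp
  then show "n \<ge> 1" using csm by (simp add: compact_symplectic_manifold_def del: zero_less_card_finite)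
  have "inj_on ((!) en) {..<2*n}" using en by (auto simp: inj_on_def nth_eq_iff_index_eq)
  moreover have "(!) en ` {..<2*n} = UNIV" using en by (metis lessThan_atLeast0 list.set_map map_nth set_upt)
  ultimately show "bij_betw ((!) en) {..<2*n} UNIV" by (simp add: bij_betw_def)
qed

abbreviation W :: "('a,'m) chart \<Rightarrow> real^'m \<Rightarrow> 'm \<Rightarrow> 'm \<Rightarrow> real" where
  "W c x i j \<equiv> \<Omega> c x [] [i,j]"

abbreviation N :: "('a,'m) chart \<Rightarrow> real^'m \<Rightarrow> 'm \<Rightarrow> 'm \<Rightarrow> real" where
  "N \<equiv> inv_symp \<Omega>"

lemma symplectic: "symplectic_form A \<Omega>" and compact: "compact_space X"
  using csm by (auto simp: compact_symplectic_manifold_def)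

lemma tensor_\<Omega>: "tensor_field A 0 2 \<Omega>"
  using symplectic by (simp add: symplectic_form_def)

lemma W_anti: "c \<in> A \<Longrightarrow> x \<in> coords c \<Longrightarrow> W c x i j = - W c x j i"
  using symplectic unfolding symplectic_form_def by blast

lemma form_invertible: "c \<in> A \<Longrightarrow> x \<in> coords c \<Longrightarrow> invertible (form_matrix \<Omega> c x)"
  using symplectic unfolding symplectic_form_def form_matrix_def by blast

lemma smooth_W: "c \<in> A \<Longrightarrow> smooth_on (coords c) (\<lambda>x. W c x i j)"
  by (rule tensor_field_02(1)[OF tensor_\<Omega>])

lemma N_eq: "N c x i j = - matrix_inv (form_matrix \<Omega> c x) $ i $ j"
  by (simp add: inv_symp_def form_matrix_def)

lemma smooth_N:
  assumes c: "c \<in> A" shows "smooth_on (coords c) (\<lambda>x. N c x i j)"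
  unfolding N_eq
proof (intro smooth_on_uminus smooth_on_matrix_inv open_coords[OF c])
  show "smooth_on (coords c) (\<lambda>x. form_matrix \<Omega> c x $ i $ j)" for i j
    using smooth_W[OF c] by (simp add: form_matrix_def)
  show "det (form_matrix \<Omega> c x) \<noteq> 0" if "x \<in> coords c" for x
    using form_invertible[OF c that] invertible_det_nz by blast
qed

lemma W_N:
  assumes c: "c \<in> A" "x \<in> coords c"
  shows "(\<Sum>k\<in>UNIV. W c x i k * N c x k j) = - of_bool (i = j)"
    and "(\<Sum>k\<in>UNIV. N c x i k * W c x k j) = - of_bool (i = j)"
proof -
  have "(form_matrix \<Omega> c x ** matrix_inv (form_matrix \<Omega> c x)) $ i $ j = mat 1 $ i $ j"
    "(matrix_inv (form_matrix \<Omega> c x) ** form_matrix \<Omega> c x) $ i $ j = mat 1 $ i $ j"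
    using matrix_inv_mult[OF form_invertible[OF c]] by simp_all
  then show "(\<Sum>k\<in>UNIV. W c x i k * N c x k j) = - of_bool (i = j)"
    and "(\<Sum>k\<in>UNIV. N c x i k * W c x k j) = - of_bool (i = j)"
    by (simp_all add: N_eq form_matrix_def matrix_matrix_mult_def mat_def sum_negf)
qed

lemma N_anti:
  assumes c: "c \<in> A" "x \<in> coords c" shows "N c x i j = - N c x j i"
proof -
  let ?W = "form_matrix \<Omega> c x"
  have "transpose ?W = - ?W"
    by (simp add: transpose_def form_matrix_def vec_eq_iff) (intro allI W_anti[OF c])
  moreover have "transpose (matrix_inv ?W) ** transpose ?W = mat 1"
    using matrix_inv_mult(1)[OF form_invertible[OF c]]
    by (simp add: matrix_transpose_mul[symmetric] transpose_mat)
  ultimately have "(- transpose (matrix_inv ?W)) ** ?W = mat 1"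
    by (simp add: matrix_distribs)
  then have "matrix_inv ?W = - transpose (matrix_inv ?W)" by (rule matrix_inv_unique)
  then have "matrix_inv ?W $ i $ j = (- transpose (matrix_inv ?W)) $ i $ j" by simp
  then show ?thesis by (simp add: N_eq transpose_def)
qed

definition vol :: "('a,'m) chart \<Rightarrow> real^'m \<Rightarrow> real" where
  "vol c x = divided_power \<Omega> n c x [] en"

text \<open>The density of the Liouville measure in a chart. The absolute value accounts for the orientation sign
  in the definition of \<open>form_integral\<close>.\<close>

definition dens :: "('a,'m) chart \<Rightarrow> real^'m \<Rightarrow> real" where
  "dens c x = \<bar>vol c x\<bar>"

lemma vol_eq: "vol c x = pf (W c x) / (2 ^ n * fact n)"
  using wedge_power_eq_sum[OF en(3), of \<Omega> c x "[]"]
  by (simp add: vol_def divided_power_def pfs_positions)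

text \<open>Written out as alternating sums, the left-hand side is the polarized Pfaffian \<open>pfm\<close> and \<open>vol\<close> is the
  Pfaffian, so that \<open>pfm_eq_trace\<close> applies.\<close>

lemma wedge_divided_power:
  assumes c: "c \<in> A" "x \<in> coords c"
  shows "wedge 2 (2 * (n - 1)) \<beta> (divided_power \<Omega> (n - 1)) c x [] en
    = (\<Sum>i\<in>UNIV. \<Sum>j\<in>UNIV. N c x i j * \<beta> c x [] [i,j]) / 2 * vol c x"
proof -
  obtain k where k: "n = Suc k" using n by (cases n) auto
  have len: "length en = 2 * k + 2" using en(3) k by simp
  let ?b = "\<lambda>i j. \<beta> c x [] [i,j]"
  have prod0: "(\<Prod>b<n. h b) = h 0 * (\<Prod>a<k. h (Suc a))" for h :: "nat \<Rightarrow> real"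
    by (simp add: k prod.lessThan_Suc_shift del: prod.lessThan_Suc)
  have "pfm ?b (W c x) = (\<Sum>\<sigma> | \<sigma> permutes {..<2*k+2}. of_int (sign \<sigma>) * (\<beta> c x [] [en ! \<sigma> 0, en ! \<sigma> 1] *
        (\<Prod>a<k. \<Omega> c x [] [en ! \<sigma> (2*a+2), en ! \<sigma> (2*a+3)])))"
    unfolding pfm_def pfs_positions prod0 using k by (simp add: numeral_3_eq_3)
  then have w: "wedge 2 (2*k) \<beta> (wedge_power \<Omega> k) c x [] en = pfm ?b (W c x) / 2 ^ n"
    using wedge_with_power[where \<Omega>=\<Omega> and \<beta>=\<beta> and c=c and x=x and us="[]", OF wedge_power_eq_sum len] k
    by simp
  have "wedge 2 (2*k) \<beta> (divided_power \<Omega> k) c x [] en = wedge 2 (2*k) \<beta> (wedge_power \<Omega> k) c x [] en / fact k"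
    by (simp add: wedge_def divided_power_def sum_divide_distrib mult_ac)
  also have "\<dots> = 2 * real n * pfm ?b (W c x) / (2 * real n * 2 ^ n * fact k)"
    unfolding w using k by simp
  also have "\<dots> = (\<Sum>i\<in>UNIV. \<Sum>j\<in>UNIV. N c x i j * ?b i j) / 2 * vol c x"
    unfolding pfm_eq_trace[of "W c x" "N c x", OF W_anti[OF c] W_N(1)[OF c]] vol_eq
    using k by (simp add: field_simps)
  finally show ?thesis using k by simp
qed

lemma vol_change:
  assumes c: "c \<in> A" "d \<in> A" "y \<in> overlap d c"
  shows "vol d y = det (jacm d c y) * vol c (transition d c y)"
  using c(3,2)
proof (rule overlapE)
  fix p assume p: "p \<in> fst d" "p \<in> fst c" "y = snd d p" "transition d c y = snd c p"
  have "W d y = (\<lambda>i j. \<Sum>k\<in>UNIV. \<Sum>l\<in>UNIV. jacm d c y $ k $ i * jacm d c y $ l $ j * W c (transition d c y) k l)"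
    using tensor_field_02(2)[OF tensor_\<Omega> c(1,2), of p] p by (intro ext) simp
  then show ?thesis unfolding vol_eq by (simp add: pf_congruence)
qed

lemma dens_change:
  assumes c: "c \<in> A" "d \<in> A" "y \<in> overlap d c"
  shows "dens d y = \<bar>det (jacm d c y)\<bar> * dens c (transition d c y)"
  using vol_change[OF c] by (simp add: dens_def abs_mult)

text \<open>The analogue for Pfaffians of Jacobi's formula for the derivative of a determinant.\<close>

lemma dens_derivative:
  assumes c: "c \<in> A" "x \<in> coords c"
  shows "pd l (dens c) x = (\<Sum>i\<in>UNIV. \<Sum>j\<in>UNIV. N c x i j * pd l (\<lambda>y. W c y i j) x) / 2 * dens c x"
    and "dens c differentiable (at x)"
proof -
  have dW: "(\<lambda>y. W c y i j) differentiable (at x)" for i j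
    by (rule smooth_on_differentiable[OF smooth_W[OF c(1)] c(2)])
  note pf = pd_pf[of "W c" x, OF dW]
  have v: "vol c = (\<lambda>y. (1 / (2 ^ n * fact n)) * pf (W c y))" by (simp add: vol_eq fun_eq_iff)
  have dv: "vol c differentiable (at x)" unfolding v by (intro differentiable_mult pf(2)) simp
  have pv: "pd l (vol c) x = (\<Sum>i\<in>UNIV. \<Sum>j\<in>UNIV. N c x i j * pd l (\<lambda>y. W c y i j) x) / 2 * vol c x" for l
  proof -
    have "pd l (vol c) x = 2 * real n * pfm (\<lambda>i j. pd l (\<lambda>y. W c y i j) x) (W c x) / (2 * 2 ^ n * fact n)"
      unfolding v by (subst pd_cmult) (simp_all add: pf)
    then show ?thesis
      unfolding pfm_eq_trace[of "W c x" "N c x", OF W_anti[OF c] W_N(1)[OF c]] vol_eq by simp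
  qed
  have d: "dens c = (\<lambda>y. \<bar>vol c y\<bar>)" by (simp add: dens_def fun_eq_iff)
  show "pd l (dens c) x = (\<Sum>i\<in>UNIV. \<Sum>j\<in>UNIV. N c x i j * pd l (\<lambda>y. W c y i j) x) / 2 * dens c x"
    and "dens c differentiable (at x)"
    unfolding d using pd_abs[OF dv pv] by auto
qed

lemma continuous_dens: "c \<in> A \<Longrightarrow> continuous_on (coords c) (dens c)"
  by (intro continuous_at_imp_continuous_on ballI differentiable_imp_continuous_within dens_derivative(2))

lemma continuous_pd_dens:
  assumes c: "c \<in> A" shows "continuous_on (coords c) (pd l (dens c))"
proof -
  have "continuous_on (coords c) (\<lambda>x. (\<Sum>i\<in>UNIV. \<Sum>j\<in>UNIV. N c x i j * pd l (\<lambda>y. W c y i j) x) / 2 * dens c x)"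
    by (intro continuous_intros continuous_dens[OF c] smooth_on_continuous smooth_N[OF c] smooth_on_pd smooth_W[OF c]) auto
  then show ?thesis by (rule continuous_on_eq) (simp add: dens_derivative(1)[OF c])
qed


section \<open>Integration and the divergence theorem\<close>

text \<open>The same choice as in the definition of \<open>form_integral\<close>.\<close>

definition pou :: "('a,'m) chart set \<times> (('a,'m) chart \<Rightarrow> 'a \<Rightarrow> real)" where
  "pou = (SOME (C, \<rho>). partition_of_unity X A C \<rho>)"

definition C where "C = fst pou"
definition \<rho> where "\<rho> = snd pou"

lemma partition: "partition_of_unity X A C \<rho>"
proof -
  have "\<exists>z. case z of (C', \<rho>') \<Rightarrow> partition_of_unity X A C' \<rho>'"
    using partition_of_unity_exists[OF compact] by auto
  then have "case pou of (C', \<rho>') \<Rightarrow> partition_of_unity X A C' \<rho>'"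
    unfolding pou_def by (rule someI_ex)
  then show ?thesis by (simp add: C_def \<rho>_def case_prod_unfold)
qed

lemma C: "finite C" "c \<in> C \<Longrightarrow> c \<in> A"
  using partition unfolding partition_of_unity_def by (simp, blast)

abbreviation r :: "('a,'m) chart \<Rightarrow> ('a,'m) chart \<Rightarrow> real^'m \<Rightarrow> real" where
  "r c d x \<equiv> \<rho> c (chart_inv d x)"

lemma smooth_r: "c \<in> C \<Longrightarrow> d \<in> A \<Longrightarrow> smooth_on (coords d) (r c d)"
  using partition unfolding partition_of_unity_def by blast

lemma point_in: "d \<in> A \<Longrightarrow> x \<in> coords d \<Longrightarrow> chart_inv d x \<in> topspace X"
  by (rule subsetD[OF domain_subset chart_inv_in])

lemma r_sum:
  assumes "d \<in> A" "x \<in> coords d" shows "(\<Sum>c\<in>C. r c d x) = 1"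
  using partition point_in[OF assms] unfolding partition_of_unity_def by blast

definition supp :: "('a,'m) chart \<Rightarrow> 'a set" where
  "supp c = X closure_of {p \<in> topspace X. \<rho> c p \<noteq> 0}"

lemma supp: "closedin X (supp c)" "c \<in> C \<Longrightarrow> supp c \<subseteq> fst c" "compactin X (supp c)"
proof -
  show cl: "closedin X (supp c)" unfolding supp_def by (rule closedin_closure_of)
  then show "compactin X (supp c)" by (rule closedin_compact_space[OF compact])
  show "c \<in> C \<Longrightarrow> supp c \<subseteq> fst c"
    using partition unfolding partition_of_unity_def supp_def by blast
qed

lemma r_0:
  assumes "d \<in> A" "x \<in> coords d" "chart_inv d x \<notin> supp c" shows "r c d x = 0"
proof (rule ccontr)
  assume "r c d x \<noteq> 0"
  then have "chart_inv d x \<in> {p \<in> topspace X. \<rho> c p \<noteq> 0}" using point_in[OF assms(1,2)] by simp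
  moreover have "{p \<in> topspace X. \<rho> c p \<noteq> 0} \<subseteq> supp c"
    unfolding supp_def by (rule closure_of_subset) simp
  ultimately show False using assms(3) by blast
qed

lemma pd_r_0:
  assumes d: "d \<in> A" "x \<in> coords d" "chart_inv d x \<notin> supp c"
  shows "pd i (r c d) x = 0"
proof -
  let ?V = "snd d ` (fst d - supp c)"
  have "openin X (fst d - supp c)" using supp(1) open_domain[OF d(1)] by blast
  then have o: "open ?V" by (rule open_chart_image[OF d(1)]) auto
  have x: "x \<in> ?V" using d chart_inv_in[OF d(2)] chart_of_chart_inv[OF d(2)] by (intro image_eqI[of _ _ "chart_inv d x"]) auto
  have "r c d y = 0" if "y \<in> ?V" for y
    using that by (intro r_0[OF d(1)]) (auto simp: coords_def chart_inv_eq[OF d(1)])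
  then have "pd i (r c d) x = pd i (\<lambda>y. 0) x" by (rule pd_cong[OF o x])
  then show ?thesis by simp
qed

lemma chart_supp:
  assumes c: "c \<in> C"
  shows "compact (snd c ` supp c)" "snd c ` supp c \<subseteq> coords c"
    and "x \<in> coords c - snd c ` supp c \<Longrightarrow> chart_inv c x \<notin> supp c"
proof -
  show "compact (snd c ` supp c)" by (rule compact_chart_image[OF C(2)[OF c] supp(3) supp(2)[OF c]])
  show "snd c ` supp c \<subseteq> coords c" unfolding coords_def by (rule image_mono[OF supp(2)[OF c]])
  assume x: "x \<in> coords c - snd c ` supp c"
  show "chart_inv c x \<notin> supp c"
  proof
    assume "chart_inv c x \<in> supp c"
    then have "snd c (chart_inv c x) \<in> snd c ` supp c" by (rule imageI)
    then show False using x chart_of_chart_inv[of x c] by simp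
  qed
qed

lemma localized_integrable:
  assumes c: "c \<in> C" and f: "continuous_on (coords c) f"
  shows "(\<lambda>x. r c c x * f x) integrable_on coords c"
proof (rule integral_compact_support(1)[OF chart_supp(1,2)[OF c]])
  have "continuous_on (coords c) (\<lambda>x. r c c x * f x)"
    by (intro continuous_on_mult f smooth_on_continuous smooth_r c C(2))
  then show "continuous_on (snd c ` supp c) (\<lambda>x. r c c x * f x)"
    using chart_supp(2)[OF c] continuous_on_subset by blast
  show "r c c x * f x = 0" if "x \<in> coords c - snd c ` supp c" for x
    using r_0[OF C(2)[OF c], of x c] chart_supp(3)[OF c that] that by simp
qed

text \<open>The integral over the manifold, with respect to the Liouville measure, of a function that is given by
  its expressions \<open>f c\<close> in the charts.\<close>

definition Liouville_integral :: "(('a,'m) chart \<Rightarrow> real^'m \<Rightarrow> real) \<Rightarrow> real" where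
  "Liouville_integral f = (\<Sum>c\<in>C. integral (coords c) (\<lambda>x. r c c x * (f c x * dens c x)))"

lemma form_integral_eq_Liouville_integral:
  assumes "\<And>c x. c \<in> A \<Longrightarrow> x \<in> coords c \<Longrightarrow> \<omega> c x [] en = f c x * vol c x"
  shows "form_integral X A (divided_power \<Omega> n) \<omega> = Liouville_integral f"
proof -
  have "form_integral X A (divided_power \<Omega> n) \<omega> = (case pou of (C', \<rho>') \<Rightarrow>
      \<Sum>c\<in>C'. integral (coords c) (\<lambda>x. \<rho>' c (chart_inv c x) * sgn (divided_power \<Omega> n c x [] en) * \<omega> c x [] en))"
    unfolding form_integral_def Let_def en_def pou_def by (rule refl)
  also have "\<dots> = (\<Sum>c\<in>C. integral (coords c) (\<lambda>x. r c c x * sgn (vol c x) * \<omega> c x [] en))"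
    by (simp only: C_def \<rho>_def vol_def case_prod_unfold)
  also have "\<dots> = Liouville_integral f"
    unfolding Liouville_integral_def
  proof (intro sum.cong[OF refl] integral_cong)
    fix c x assume "c \<in> C" "x \<in> coords c"
    then show "r c c x * sgn (vol c x) * \<omega> c x [] en = r c c x * (f c x * dens c x)"
      using assms[of c x] C(2) by (simp add: dens_def abs_sgn mult_ac)
  qed
  finally show ?thesis .
qed

lemma Liouville_integral_cong: "(\<And>c x. c \<in> A \<Longrightarrow> x \<in> coords c \<Longrightarrow> f c x = g c x) \<Longrightarrow> Liouville_integral f = Liouville_integral g"
  unfolding Liouville_integral_def by (intro sum.cong[OF refl] integral_cong) (simp add: C(2))

lemma Liouville_integral_linear:
  assumes f: "\<And>c. c \<in> A \<Longrightarrow> continuous_on (coords c) (f c)" and g: "\<And>c. c \<in> A \<Longrightarrow> continuous_on (coords c) (g c)"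
  shows "Liouville_integral (\<lambda>c x. a * f c x + b * g c x) = a * Liouville_integral f + b * Liouville_integral g"
proof -
  have "integral (coords c) (\<lambda>x. r c c x * ((a * f c x + b * g c x) * dens c x))
    = a * integral (coords c) (\<lambda>x. r c c x * (f c x * dens c x)) + b * integral (coords c) (\<lambda>x. r c c x * (g c x * dens c x))"
    if c: "c \<in> C" for c
  proof -
    have i: "(\<lambda>x. r c c x * (f c x * dens c x)) integrable_on coords c" "(\<lambda>x. r c c x * (g c x * dens c x)) integrable_on coords c"
      by (intro localized_integrable[OF c] continuous_on_mult f g continuous_dens C(2) c)+
    have "integral (coords c) (\<lambda>x. r c c x * ((a * f c x + b * g c x) * dens c x))
      = integral (coords c) (\<lambda>x. a * (r c c x * (f c x * dens c x)) + b * (r c c x * (g c x * dens c x)))"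
      by (simp add: algebra_simps)
    also have "\<dots> = integral (coords c) (\<lambda>x. a * (r c c x * (f c x * dens c x))) + integral (coords c) (\<lambda>x. b * (r c c x * (g c x * dens c x)))"
      using i by (intro integral_add integrable_on_mult_right)
    finally show ?thesis by simp
  qed
  then show ?thesis unfolding Liouville_integral_def by (simp add: sum.distrib sum_distrib_left)
qed

definition partition_derivative :: "(('a,'m) chart \<Rightarrow> real^'m \<Rightarrow> 'm \<Rightarrow> real) \<Rightarrow> ('a,'m) chart \<Rightarrow> ('a,'m) chart \<Rightarrow> real^'m \<Rightarrow> real" where
  "partition_derivative Z c d x = (\<Sum>i\<in>UNIV. Z d x i * pd i (r c d) x)"

text \<open>The components of a smooth vector field on the manifold in all charts.\<close>

context
  fixes Z :: "('a,'m) chart \<Rightarrow> real^'m \<Rightarrow> 'm \<Rightarrow> real"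
  assumes smooth_Z: "\<And>c i. c \<in> A \<Longrightarrow> smooth_on (coords c) (\<lambda>x. Z c x i)"
    and Z_change: "\<And>c d x k. c \<in> A \<Longrightarrow> d \<in> A \<Longrightarrow> x \<in> overlap c d \<Longrightarrow>
      Z d (transition c d x) k = (\<Sum>i\<in>UNIV. jac c d x k i * Z c x i)"
begin

lemma partition_derivative_change:
  assumes c: "c \<in> C" and cd: "b \<in> A" "d \<in> A" "x \<in> overlap b d"
  shows "partition_derivative Z c d (transition b d x) = partition_derivative Z c b x"
proof -
  let ?y = "transition b d x"
  have y: "?y \<in> coords d" by (rule subsetD[OF overlap_subset transition_in_overlap[OF cd(1,3)]])
  have "pd i (r c b) x = (\<Sum>k\<in>UNIV. jac b d x k i * pd k (r c d) ?y)" for i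
  proof -
    have "pd i (r c b) x = pd i (\<lambda>x. r c d (transition b d x)) x"
      by (rule pd_cong[OF open_overlap[OF cd(1,2)] cd(3)]) (simp add: chart_inv_transition[OF cd(1,2)])
    also have "\<dots> = (\<Sum>k\<in>UNIV. jac b d x k i * pd k (r c d) ?y)"
      by (rule pd_pullback(1)[OF cd smooth_on_differentiable[OF smooth_r[OF c cd(2)] y]])
    finally show ?thesis .
  qed
  then have "partition_derivative Z c b x = (\<Sum>i\<in>UNIV. \<Sum>k\<in>UNIV. jac b d x k i * Z b x i * pd k (r c d) ?y)"
    by (simp add: partition_derivative_def sum_distrib_left mult_ac)
  also have "\<dots> = (\<Sum>k\<in>UNIV. (\<Sum>i\<in>UNIV. jac b d x k i * Z b x i) * pd k (r c d) ?y)"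
    by (subst sum.swap) (simp add: sum_distrib_right)
  finally show ?thesis by (simp add: partition_derivative_def Z_change[OF cd])
qed

lemma continuous_partition_derivative: "c \<in> C \<Longrightarrow> d \<in> A \<Longrightarrow> continuous_on (coords d) (partition_derivative Z c d)"
  unfolding partition_derivative_def
  by (intro continuous_on_sum continuous_on_mult smooth_on_continuous smooth_Z smooth_on_pd smooth_r)

text \<open>Change of variables by the transition map: the Liouville density absorbs the Jacobian determinant, and
  the other factors are functions on the manifold. Both integrands vanish outside of the image of
  \<open>supp c \<inter> supp d\<close>, a compact set in the domains of both charts.\<close>

lemma integral_chart_change:
  assumes c: "c \<in> C" and d: "d \<in> C"
  shows "integral (coords c) (\<lambda>x. r d c x * (partition_derivative Z c c x * dens c x))
    = integral (coords d) (\<lambda>y. r d d y * (partition_derivative Z c d y * dens d y))"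
proof -
  let ?K = "supp c \<inter> supp d" and ?T = "transition c d"
  note cA = C(2)[OF c] and dA = C(2)[OF d]
  have K: "compactin X ?K" "?K \<subseteq> fst c \<inter> fst d"
    using closedin_compact_space[OF compact closedin_Int[OF supp(1) supp(1)]] supp(2)[OF c] supp(2)[OF d]
    by blast+
  have Kc: "compact (snd c ` ?K)" by (rule compact_chart_image[OF cA K(1)]) (use K in auto)
  have Kd: "compact (snd d ` ?K)" by (rule compact_chart_image[OF dA K(1)]) (use K in auto)
  have sub: "snd c ` ?K \<subseteq> coords c" "snd d ` ?K \<subseteq> coords d" "snd c ` ?K \<subseteq> overlap c d"
    using K by (auto simp: coords_def overlap_def)
  have img: "?T ` snd c ` ?K = snd d ` ?K"
    unfolding image_image by (rule image_cong) (use K in \<open>auto simp: transition_def chart_inv_eq[OF cA]\<close>)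
  have partition_derivative_0: "partition_derivative Z c b x = 0" if "b \<in> A" "x \<in> coords b" "chart_inv b x \<notin> supp c" for b x
    using pd_r_0[OF that] by (simp add: partition_derivative_def)
  have van: "r d b x * (partition_derivative Z c b x * dens b x) = 0" if b: "b \<in> A" and x: "x \<in> coords b - snd b ` ?K" for b x
  proof -
    have "chart_inv b x \<notin> ?K"
    proof
      assume "chart_inv b x \<in> ?K"
      then have "snd b (chart_inv b x) \<in> snd b ` ?K" by (rule imageI)
      then show False using x chart_of_chart_inv[of x b] by simp
    qed
    then show ?thesis using r_0[OF b, of x d] partition_derivative_0[OF b, of x] x by auto
  qed
  have cont: "continuous_on (coords b) (\<lambda>x. r d b x * (partition_derivative Z c b x * dens b x))" if "b \<in> A" for b
    by (intro continuous_on_mult smooth_on_continuous smooth_r[OF d] that continuous_partition_derivative[OF c] continuous_dens)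
  have der: "(?T has_derivative (\<lambda>h. jacm c d x *v h)) (at x within snd c ` ?K)" if "x \<in> snd c ` ?K" for x
    by (rule has_derivative_at_withinI[OF has_derivative_transition[OF cA dA subsetD[OF sub(3) that]]])
  have inj: "inj_on ?T (snd c ` ?K)"
    by (rule inj_on_inverseI[where g="transition d c"]) (rule transition_transition[OF cA dA subsetD[OF sub(3)]])
  have det: "continuous_on (snd c ` ?K) (\<lambda>x. det (matrix ((*v) (jacm c d x))))"
  proof (rule continuous_on_subset[OF _ sub(3)])
    have "smooth_on (overlap c d) (\<lambda>x. det (jacm c d x))"
      by (rule smooth_on_det[OF open_overlap[OF cA dA]]) (simp add: jacm_def smooth_jac[OF cA dA])
    then show "continuous_on (overlap c d) (\<lambda>x. det (matrix ((*v) (jacm c d x))))"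
      by (simp add: smooth_on_continuous)
  qed
  have "integral (coords c) (\<lambda>x. r d c x * (partition_derivative Z c c x * dens c x))
      = integral (snd c ` ?K) (\<lambda>x. r d c x * (partition_derivative Z c c x * dens c x))"
    by (rule integral_compact_support(3)[OF Kc sub(1) continuous_on_subset[OF cont[OF cA] sub(1)] van[OF cA]])
  also have "\<dots> = integral (snd c ` ?K) (\<lambda>x. \<bar>det (matrix ((*v) (jacm c d x)))\<bar> *
      (\<lambda>y. r d d y * (partition_derivative Z c d y * dens d y)) (?T x))"
  proof (rule integral_cong)
    fix x assume "x \<in> snd c ` ?K"
    then have x: "x \<in> overlap c d" using sub(3) by blast
    show "r d c x * (partition_derivative Z c c x * dens c x) = \<bar>det (matrix ((*v) (jacm c d x)))\<bar> *
      (\<lambda>y. r d d y * (partition_derivative Z c d y * dens d y)) (?T x)"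
      using partition_derivative_change[OF c cA dA x] chart_inv_transition[OF cA dA x] dens_change[OF dA cA x] by simp
  qed
  also have "\<dots> = integral (?T ` snd c ` ?K) (\<lambda>y. r d d y * (partition_derivative Z c d y * dens d y))"
    by (rule integral_change_of_variables_compact[OF Kc der inj _ det])
      (use img continuous_on_subset[OF cont[OF dA] sub(2)] in simp_all)
  also have "\<dots> = integral (coords d) (\<lambda>y. r d d y * (partition_derivative Z c d y * dens d y))"
    unfolding img
    by (rule integral_compact_support(3)[symmetric, OF Kd sub(2) continuous_on_subset[OF cont[OF dA] sub(2)] van[OF dA]])
  finally show ?thesis .
qed

text \<open>Integration by parts in each chart moves the derivative to the functions of the partition of unity.
  The resulting integrals are decomposed by the partition of unity once more and each piece is moved
  to the chart of the second function, where the derivatives of the functions \<open>\<rho> c\<close> add up to zero.\<close>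

theorem divergence_theorem:
  "(\<Sum>c\<in>C. integral (coords c) (\<lambda>x. r c c x * (\<Sum>i\<in>UNIV. pd i (\<lambda>y. Z c y i * dens c y) x))) = 0"
proof -
  have dZ: "(\<lambda>y. Z c y i * dens c y) differentiable (at x)" if "c \<in> A" "x \<in> coords c" for c x i
    by (intro differentiable_mult smooth_on_differentiable[OF smooth_Z] dens_derivative(2) that)
  have pZ: "continuous_on (coords c) (pd i (\<lambda>y. Z c y i * dens c y))" if c: "c \<in> A" for c i
  proof -
    have "continuous_on (coords c) (\<lambda>x. pd i (\<lambda>y. Z c y i) x * dens c x + Z c x i * pd i (dens c) x)"
      by (intro continuous_on_add continuous_on_mult smooth_on_continuous[OF smooth_on_pd] smooth_Z
          smooth_on_continuous[OF smooth_Z] continuous_dens continuous_pd_dens c)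
    then show ?thesis
      by (rule continuous_on_eq)
        (rule pd_mult[symmetric, OF smooth_on_differentiable[OF smooth_Z[OF c]] dens_derivative(2)[OF c]])
  qed
  have parts: "integral (coords c) (\<lambda>x. r c c x * (\<Sum>i\<in>UNIV. pd i (\<lambda>y. Z c y i * dens c y) x))
      = - integral (coords c) (\<lambda>x. partition_derivative Z c c x * dens c x)" if c: "c \<in> C" for c
  proof -
    note cA = C(2)[OF c]
    note o = open_coords[OF cA]
    let ?g = "\<lambda>i y. r c c y * (Z c y i * dens c y)"
    have dr: "r c c differentiable (at x)" if "x \<in> coords c" for x
      by (rule smooth_on_differentiable[OF smooth_r[OF c cA] that])
    have pg: "pd i (?g i) x = pd i (r c c) x * (Z c x i * dens c x) + r c c x * pd i (\<lambda>y. Z c y i * dens c y) x"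
      if "x \<in> coords c" for i x
      by (rule pd_mult[OF dr dZ]) (use that cA in auto)
    have cr: "continuous_on (coords c) (r c c)" "continuous_on (coords c) (pd i (r c c))" for i
      by (intro smooth_on_continuous smooth_on_pd smooth_r c cA)+
    have cpg: "continuous_on (coords c) (pd i (?g i))" for i
    proof -
      have "continuous_on (coords c) (\<lambda>x. pd i (r c c) x * (Z c x i * dens c x) + r c c x * pd i (\<lambda>y. Z c y i * dens c y) x)"
        by (intro continuous_on_add continuous_on_mult cr pZ cA smooth_on_continuous[OF smooth_Z] continuous_dens)
      then show ?thesis by (rule continuous_on_eq) (rule pg[symmetric])
    qed
    note S = chart_supp[OF c]
    have r0: "r c c x = 0" "pd i (r c c) x = 0" if "x \<in> coords c - snd c ` supp c" for x i
      using r_0[OF cA, of x c] pd_r_0[OF cA, of x c] S(3)[OF that] that by auto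
    have g0: "integral (coords c) (pd i (?g i)) = 0" for i
      by (rule integral_pd_eq_0[OF o _ cpg S(1,2)]) (auto intro!: differentiable_mult dr dZ[OF cA] simp: r0(1)
          smooth_on_differentiable[OF smooth_Z[OF cA]] dens_derivative(2)[OF cA])
    have ig: "pd i (?g i) integrable_on coords c" for i
      by (rule integral_compact_support(1)[OF S(1,2) continuous_on_subset[OF cpg S(2)]]) (simp add: pg r0)
    have iZ: "(\<lambda>x. partition_derivative Z c c x * dens c x) integrable_on coords c"
    proof (rule integral_compact_support(1)[OF S(1,2)])
      show "continuous_on (snd c ` supp c) (\<lambda>x. partition_derivative Z c c x * dens c x)"
        by (rule continuous_on_subset[OF _ S(2)])
          (intro continuous_on_mult continuous_partition_derivative[OF c cA] continuous_dens[OF cA])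
      show "partition_derivative Z c c x * dens c x = 0" if "x \<in> coords c - snd c ` supp c" for x
        by (simp add: partition_derivative_def r0[OF that])
    qed
    have "integral (coords c) (\<lambda>x. r c c x * (\<Sum>i\<in>UNIV. pd i (\<lambda>y. Z c y i * dens c y) x))
      = integral (coords c) (\<lambda>x. (\<Sum>i\<in>UNIV. pd i (?g i) x) - partition_derivative Z c c x * dens c x)"
      by (rule integral_cong)
        (simp only: pg sum.distrib partition_derivative_def sum_distrib_left sum_distrib_right, simp add: mult_ac)
    also have "\<dots> = (\<Sum>i\<in>UNIV. integral (coords c) (pd i (?g i))) - integral (coords c) (\<lambda>x. partition_derivative Z c c x * dens c x)"
      using ig iZ by (simp add: integral_diff integral_sum integrable_sum)
    finally show ?thesis by (simp add: g0)
  qed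
  have iZr: "(\<lambda>y. r d d y * (partition_derivative Z c d y * dens d y)) integrable_on coords d" if "c \<in> C" "d \<in> C" for c d
    by (intro localized_integrable continuous_on_mult continuous_partition_derivative continuous_dens C(2) that)
  have split: "integral (coords c) (\<lambda>x. partition_derivative Z c c x * dens c x)
      = (\<Sum>d\<in>C. integral (coords c) (\<lambda>x. r d c x * (partition_derivative Z c c x * dens c x)))" if c: "c \<in> C" for c
  proof -
    note cA = C(2)[OF c]
    note S = chart_supp[OF c]
    have i: "(\<lambda>x. r d c x * (partition_derivative Z c c x * dens c x)) integrable_on coords c" if d: "d \<in> C" for d
    proof (rule integral_compact_support(1)[OF S(1,2)])
      show "continuous_on (snd c ` supp c) (\<lambda>x. r d c x * (partition_derivative Z c c x * dens c x))"
        by (rule continuous_on_subset[OF _ S(2)])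
          (intro continuous_on_mult smooth_on_continuous smooth_r[OF d] cA continuous_partition_derivative[OF c] continuous_dens)
      show "r d c x * (partition_derivative Z c c x * dens c x) = 0" if "x \<in> coords c - snd c ` supp c" for x
        using pd_r_0[OF cA, of x c] S(3)[OF that] that by (simp add: partition_derivative_def)
    qed
    have "integral (coords c) (\<lambda>x. partition_derivative Z c c x * dens c x)
      = integral (coords c) (\<lambda>x. \<Sum>d\<in>C. r d c x * (partition_derivative Z c c x * dens c x))"
      by (rule integral_cong) (simp add: sum_distrib_right[symmetric] r_sum[OF cA])
    also have "\<dots> = (\<Sum>d\<in>C. integral (coords c) (\<lambda>x. r d c x * (partition_derivative Z c c x * dens c x)))"
      using i by (intro integral_sum C(1))
    finally show ?thesis .
  qed
  have zero: "(\<Sum>c\<in>C. partition_derivative Z c d y) = 0" if d: "d \<in> A" and y: "y \<in> coords d" for d y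
  proof -
    have "(\<Sum>c\<in>C. pd i (r c d) y) = 0" for i
    proof -
      have "(\<Sum>c\<in>C. pd i (r c d) y) = pd i (\<lambda>y. \<Sum>c\<in>C. r c d y) y"
        by (rule pd_sum[symmetric]) (rule smooth_on_differentiable[OF smooth_r[OF _ d] y])
      also have "\<dots> = pd i (\<lambda>y. 1) y"
        by (rule pd_cong[OF open_coords[OF d] y]) (rule r_sum[OF d])
      finally show ?thesis by simp
    qed
    then show ?thesis
      unfolding partition_derivative_def by (subst sum.swap) (simp add: sum_distrib_left[symmetric])
  qed
  have "(\<Sum>c\<in>C. integral (coords c) (\<lambda>x. r c c x * (\<Sum>i\<in>UNIV. pd i (\<lambda>y. Z c y i * dens c y) x)))
      = - (\<Sum>c\<in>C. \<Sum>d\<in>C. integral (coords d) (\<lambda>y. r d d y * (partition_derivative Z c d y * dens d y)))"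
  proof -
    have "(\<Sum>d\<in>C. integral (coords c) (\<lambda>x. r d c x * (partition_derivative Z c c x * dens c x)))
        = (\<Sum>d\<in>C. integral (coords d) (\<lambda>y. r d d y * (partition_derivative Z c d y * dens d y)))" if "c \<in> C" for c
      by (rule sum.cong[OF refl integral_chart_change[OF that]])
    then show ?thesis by (simp add: parts split sum_negf)
  qed
  also have "\<dots> = - (\<Sum>d\<in>C. \<Sum>c\<in>C. integral (coords d) (\<lambda>y. r d d y * (partition_derivative Z c d y * dens d y)))"
    by (subst sum.swap) simp
  also have "\<dots> = - (\<Sum>d\<in>C. integral (coords d) (\<lambda>y. \<Sum>c\<in>C. r d d y * (partition_derivative Z c d y * dens d y)))"
    using iZr C(1) by (simp add: integral_sum)
  also have "\<dots> = - (\<Sum>d\<in>C. integral (coords d) (\<lambda>y. 0))"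
  proof -
    have "integral (coords d) (\<lambda>y. \<Sum>c\<in>C. r d d y * (partition_derivative Z c d y * dens d y)) = integral (coords d) (\<lambda>y. 0)"
      if "d \<in> C" for d
      by (rule integral_cong)
        (simp add: sum_distrib_left[symmetric] sum_distrib_right[symmetric] zero[OF C(2)[OF that]])
    then show ?thesis by simp
  qed
  finally show ?thesis by simp
qed

end

end

section \<open>The moment map\<close>

lemma trace_scaleR: "trace (t *\<^sub>R M :: real^'m::finite^'m) = t * trace M"
  by (simp add: trace_def sum_distrib_left)

lemma trace_sum: "trace (\<Sum>a\<in>I. F a :: real^'m::finite^'m) = (\<Sum>a\<in>I. trace (F a))"
  by (simp add: trace_def) (rule sum.swap)

lemma trace_uminus: "trace (- M :: real^'m::finite^'m) = - trace M"
  by (simp add: trace_def sum_negf)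

lemma pd_trace:
  assumes "mdiff F x" shows "pd i (\<lambda>y. trace (F y)) x = trace (pdm i F x)"
  using assms unfolding trace_def mdiff_def by (subst pd_sum) (simp_all add: pdm_def)

lemma smooth_on_trace_mult:
  fixes F G :: "real^'m::finite \<Rightarrow> real^'m^'m"
  assumes "open S" "\<And>k j. smooth_on S (\<lambda>x. F x $ k $ j)" "\<And>k j. smooth_on S (\<lambda>x. G x $ k $ j)"
  shows "smooth_on S (\<lambda>x. trace (F x ** G x))"
  unfolding trace_def matrix_matrix_mult_def by (simp, intro smooth_intros assms)

lemma trace_sandwich:
  fixes M L Y :: "real^'m::finite^'m"
  shows "(\<Sum>j\<in>UNIV. \<Sum>k\<in>UNIV. M $ j $ k * (\<Sum>b\<in>UNIV. \<Sum>d\<in>UNIV. L $ j $ b * L $ k $ d * Y $ b $ d))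
    = trace (transpose M ** (L ** Y ** transpose L))"
proof -
  have "(\<Sum>b\<in>UNIV. \<Sum>d\<in>UNIV. L $ j $ b * L $ k $ d * Y $ b $ d) = (L ** Y ** transpose L) $ j $ k" for j k
    unfolding matrix_triple_component by (simp add: transpose_def sum_distrib_left mult_ac)
  moreover have "trace (transpose M ** P) = (\<Sum>j\<in>UNIV. \<Sum>k\<in>UNIV. M $ j $ k * P $ j $ k)" for P :: "real^'m^'m"
    by (simp add: trace_def matrix_matrix_mult_def transpose_def) (rule sum.swap)
  ultimately show ?thesis by (simp only:)
qed

context compact_symplectic
begin

definition N_matrix :: "('a,'m) chart \<Rightarrow> real^'m \<Rightarrow> real^'m^'m" where
  "N_matrix c x = (\<chi> i j. N c x i j)"

lemma form_matrix_rules: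
  assumes c: "c \<in> A" "x \<in> coords c"
  shows "form_matrix \<Omega> c x ** N_matrix c x = - mat 1" "N_matrix c x ** form_matrix \<Omega> c x = - mat 1"
    and "transpose (form_matrix \<Omega> c x) = - form_matrix \<Omega> c x" "transpose (N_matrix c x) = - N_matrix c x"
proof -
  show "form_matrix \<Omega> c x ** N_matrix c x = - mat 1" "N_matrix c x ** form_matrix \<Omega> c x = - mat 1"
    using W_N[OF c] by (auto simp: form_matrix_def N_matrix_def matrix_matrix_mult_def mat_def vec_eq_iff)
  show "transpose (form_matrix \<Omega> c x) = - form_matrix \<Omega> c x"
    by (simp add: transpose_def form_matrix_def vec_eq_iff) (intro allI W_anti[OF c])
  show "transpose (N_matrix c x) = - N_matrix c x"
    by (simp add: transpose_def N_matrix_def vec_eq_iff) (intro allI N_anti[OF c])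
qed

lemma lower_index_matrix:
  "lower_index \<Omega> T c x [] [i,j,k] = (transpose (conn_matrix T c x i) ** form_matrix \<Omega> c x) $ j $ k"
  "lower_index \<Omega> \<alpha> c x [] [j,k] = (transpose (endo_matrix \<alpha> c x) ** form_matrix \<Omega> c x) $ j $ k"
  by (simp_all add: lower_index_def matrix_matrix_mult_def transpose_def conn_matrix_def form_matrix_def endo_matrix_def)

lemma symp_connections_affine: "D \<in> symp_connections A \<Omega> \<Longrightarrow> affine_connection A D"
  by (simp add: symp_connections_def)

lemma gauge_algebra_tensor: "\<alpha> \<in> gauge_algebra A \<Omega> \<Longrightarrow> tensor_field A 1 1 \<alpha>"
  by (simp add: gauge_algebra_def)

lemma symp_model_tensor: "P \<in> symp_model A \<Omega> \<Longrightarrow> tensor_field A 1 2 P"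
  by (simp add: symp_model_def)


subsection \<open>The pairing as an integral of a function\<close>

definition pairing_density :: "('a,'m) tfield \<Rightarrow> ('a,'m) tfield \<Rightarrow> ('a,'m) chart \<Rightarrow> real^'m \<Rightarrow> real" where
  "pairing_density D \<alpha> c x = (\<Sum>i\<in>UNIV. \<Sum>j\<in>UNIV. N c x i j * trace (curv (conn_matrix D c) x i j ** endo_matrix \<alpha> c x)) / 2"

lemma curvature_pairing_eq:
  assumes D: "affine_connection A D"
  shows "curvature_pairing X A n \<Omega> D \<alpha> = Liouville_integral (pairing_density D \<alpha>)"
  unfolding curvature_pairing_def
proof (rule form_integral_eq_Liouville_integral)
  fix c x assume c: "c \<in> A" "x \<in> coords c"
  have "trace_form (curvature A D) \<alpha> c x [] [i,j] = trace (curv (conn_matrix D c) x i j ** endo_matrix \<alpha> c x)" for i j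
  proof -
    have "trace_form (curvature A D) \<alpha> c x [] [i,j]
        = (\<Sum>p\<in>UNIV. \<Sum>q\<in>UNIV. curv (conn_matrix D c) x i j $ q $ p * \<alpha> c x [p] [q])"
      by (simp add: trace_form_def curvature_eq[OF D c])
    also have "\<dots> = trace (curv (conn_matrix D c) x i j ** endo_matrix \<alpha> c x)"
      by (subst sum.swap) (simp add: trace_def matrix_matrix_mult_def endo_matrix_def)
    finally show ?thesis .
  qed
  then show "wedge 2 (2 * (n - 1)) (trace_form (curvature A D) \<alpha>) (divided_power \<Omega> (n - 1)) c x [] en = pairing_density D \<alpha> c x * vol c x"
    unfolding wedge_divided_power[OF c] pairing_density_def by simp
qed

lemma continuous_N_trace:
  fixes F G :: "real^'m \<Rightarrow> 'm \<Rightarrow> 'm \<Rightarrow> real^'m^'m"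
  assumes c: "c \<in> A" and F: "\<And>i j k l. smooth_on (coords c) (\<lambda>x. F x i j $ k $ l)"
    and G: "\<And>i j k l. smooth_on (coords c) (\<lambda>x. G x i j $ k $ l)"
  shows "continuous_on (coords c) (\<lambda>x. \<Sum>i\<in>UNIV. \<Sum>j\<in>UNIV. N c x i j * trace (F x i j ** G x i j))"
  by (intro smooth_on_continuous smooth_intros smooth_N smooth_on_trace_mult open_coords c F G)

lemma smooth_endo: "tensor_field A 1 1 \<alpha> \<Longrightarrow> c \<in> A \<Longrightarrow> smooth_on (coords c) (\<lambda>x. endo_matrix \<alpha> c x $ k $ j)"
  using smooth_11 by (simp add: endo_matrix_def)

lemma smooth_conn: "tensor_field A 1 2 P \<Longrightarrow> c \<in> A \<Longrightarrow> smooth_on (coords c) (\<lambda>x. conn_matrix P c x i $ k $ j)"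
  unfolding conn_matrix_def vec_lambda_beta by (rule smooth_12)

lemma smooth_affine: "affine_connection A D \<Longrightarrow> c \<in> A \<Longrightarrow> smooth_on (coords c) (\<lambda>x. conn_matrix D c x i $ k $ j)"
  unfolding conn_matrix_def vec_lambda_beta by (rule affine_smooth)

lemma continuous_pairing_density:
  assumes "affine_connection A D" "tensor_field A 1 1 \<alpha>" "c \<in> A"
  shows "continuous_on (coords c) (pairing_density D \<alpha> c)"
proof -
  have "continuous_on (coords c) (\<lambda>x. (\<Sum>i\<in>UNIV. \<Sum>j\<in>UNIV. N c x i j * trace (curv (conn_matrix D c) x i j ** endo_matrix \<alpha> c x)) / 2)"
    by (intro continuous_on_divide continuous_on_const continuous_N_trace smooth_curv smooth_endo assms) simp
  then show ?thesis by (simp add: pairing_density_def[abs_def])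
qed

lemma pairing_linear:
  assumes D: "D \<in> symp_connections A \<Omega>" and \<alpha>: "\<alpha> \<in> gauge_algebra A \<Omega>" and \<beta>: "\<beta> \<in> gauge_algebra A \<Omega>"
  shows "curvature_pairing X A n \<Omega> D (\<lambda>c x us ls. a * \<alpha> c x us ls + b * \<beta> c x us ls)
    = a * curvature_pairing X A n \<Omega> D \<alpha> + b * curvature_pairing X A n \<Omega> D \<beta>"
proof -
  note aff = symp_connections_affine[OF D]
  have "endo_matrix (\<lambda>c x us ls. a * \<alpha> c x us ls + b * \<beta> c x us ls) c x
      = a *\<^sub>R endo_matrix \<alpha> c x + b *\<^sub>R endo_matrix \<beta> c x" for c x
    by (simp add: endo_matrix_def vec_eq_iff)
  then have "pairing_density D (\<lambda>c x us ls. a * \<alpha> c x us ls + b * \<beta> c x us ls) c x = a * pairing_density D \<alpha> c x + b * pairing_density D \<beta> c x" for c x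
    unfolding pairing_density_def
    by (simp add: matrix_distribs matrix_mult.scaleR_right trace_add trace_scaleR distrib_left sum.distrib
        sum_distrib_left add_divide_distrib mult_ac)
  then have "Liouville_integral (pairing_density D (\<lambda>c x us ls. a * \<alpha> c x us ls + b * \<beta> c x us ls))
      = Liouville_integral (\<lambda>c x. a * pairing_density D \<alpha> c x + b * pairing_density D \<beta> c x)"
    by (intro Liouville_integral_cong)
  also have "\<dots> = a * Liouville_integral (pairing_density D \<alpha>) + b * Liouville_integral (pairing_density D \<beta>)"
    by (intro Liouville_integral_linear continuous_pairing_density[OF aff] gauge_algebra_tensor \<alpha> \<beta>)
  finally show ?thesis unfolding curvature_pairing_eq[OF aff] .
qed


subsection \<open>Equivariance\<close>

text \<open>An endomorphism that preserves a nondegenerate form is injective; here, by taking determinants.\<close>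

lemma gauge_group_invertible:
  assumes g: "g \<in> gauge_group A \<Omega>" and c: "c \<in> A" "x \<in> coords c"
  shows "invertible (endo_matrix g c x)"
proof -
  let ?G = "endo_matrix g c x" and ?W = "form_matrix \<Omega> c x"
  have "(transpose ?G ** ?W ** ?G) $ i $ j = ?W $ i $ j" for i j
  proof -
    have "(transpose ?G ** ?W ** ?G) $ i $ j = (\<Sum>p\<in>UNIV. \<Sum>q\<in>UNIV. g c x [p] [i] * g c x [q] [j] * \<Omega> c x [] [p,q])"
      unfolding matrix_triple_component
      by (simp add: transpose_def endo_matrix_def form_matrix_def sum_distrib_left mult_ac)
    then show ?thesis using g c by (simp add: gauge_group_def form_matrix_def)
  qed
  then have "transpose ?G ** ?W ** ?G = ?W" unfolding vec_eq_iff by blast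
  then have "det (transpose ?G ** ?W ** ?G) = det ?W" by (simp only:)
  moreover have "det ?W \<noteq> 0" using form_invertible[OF c] invertible_det_nz by blast
  ultimately have "det ?G \<noteq> 0" by (auto simp: det_mul)
  then show ?thesis by (simp add: invertible_det_nz)
qed

text \<open>The integrands agree: the curvature is conjugated by \<open>g\<close>, which can be moved to \<open>\<alpha>\<close> under the trace.\<close>

lemma pairing_equivariant:
  assumes D: "D \<in> symp_connections A \<Omega>" and g: "g \<in> gauge_group A \<Omega>"
  shows "curvature_pairing X A n \<Omega> (gauge_act g D) \<alpha>
    = curvature_pairing X A n \<Omega> D (endo_comp (endo_comp g \<alpha>) (endo_inv g))"
proof -
  note aff = symp_connections_affine[OF D]
  have gt: "tensor_field A 1 1 g" using g by (simp add: gauge_group_def)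
  have act: "affine_connection A (gauge_act g D)"
    by (rule gauge_act_affine[OF aff gt]) (rule gauge_group_invertible[OF g])
  have "pairing_density (gauge_act g D) \<alpha> c x = pairing_density D (endo_comp (endo_comp g \<alpha>) (endo_inv g)) c x"
    if c: "c \<in> A" "x \<in> coords c" for c x
  proof -
    let ?G = "endo_matrix g c x" and ?a = "endo_matrix \<alpha> c x"
    have "trace (curv (conn_matrix (gauge_act g D) c) x i j ** ?a)
        = trace (curv (conn_matrix D c) x i j ** (?G ** ?a ** matrix_inv ?G))" for i j
    proof -
      let ?R = "curv (conn_matrix D c) x i j"
      have "trace (matrix_inv ?G ** (?R ** ?G ** ?a)) = trace ((?R ** ?G ** ?a) ** matrix_inv ?G)"
        by (rule trace_mul_sym)
      moreover have "curv (conn_matrix (gauge_act g D) c) x i j = matrix_inv ?G ** ?R ** ?G"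
        by (rule gauge_act_curv(2)[OF aff gt _ c]) (rule gauge_group_invertible[OF g])
      ultimately show ?thesis by (simp add: matrix_mul_assoc)
    qed
    then show ?thesis by (simp add: pairing_density_def endo_matrix_comp endo_matrix_inv)
  qed
  then show ?thesis
    unfolding curvature_pairing_eq[OF act] curvature_pairing_eq[OF aff] by (intro Liouville_integral_cong)
qed


subsection \<open>The Hamiltonian vector field\<close>

lemma tensor_field_12_cong:
  assumes T: "tensor_field A 1 2 T"
    and E: "\<And>c x k i j. c \<in> A \<Longrightarrow> x \<in> coords c \<Longrightarrow> T' c x [k] [i,j] = T c x [k] [i,j]"
  shows "tensor_field A 1 2 T'"
  unfolding tensor_field_12
proof (intro conjI ballI allI)
  show "smooth_on (coords c) (\<lambda>x. T' c x [k] [i,j])" if c: "c \<in> A" for c k i j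
    using smooth_12[OF T c] by (subst smooth_on_cong[OF open_coords[OF c] E[OF c]])
  fix c d p i assume c: "c \<in> A" and d: "d \<in> A" and p: "p \<in> fst c \<inter> fst d"
  have x: "snd c p \<in> coords c" "snd d p \<in> coords d" using p by (auto simp: coords_def)
  have "conn_matrix T' b z i = conn_matrix T b z i" if "b \<in> A" "z \<in> coords b" for b z i
    using E[OF that] by (simp add: conn_matrix_def)
  moreover have "conn_matrix T d (snd d p) i = (\<Sum>a\<in>UNIV. jac d c (snd d p) a i *\<^sub>R
          (jacm c d (snd c p) ** conn_matrix T c (snd c p) a ** jacm d c (snd d p)))"
    using T c d p unfolding tensor_field_12 by blast
  ultimately show "conn_matrix T' d (snd d p) i = (\<Sum>a\<in>UNIV. jac d c (snd d p) a i *\<^sub>R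
          (jacm c d (snd c p) ** conn_matrix T' c (snd c p) a ** jacm d c (snd d p)))"
    using c d x by simp
qed

text \<open>The covariant derivative of an infinitesimal gauge transformation stays symmetric, because
  lowering an index commutes with \<open>\<nabla>\<close>.\<close>

lemma cov_gauge_symmetric:
  assumes D: "D \<in> symp_connections A \<Omega>" and \<alpha>: "\<alpha> \<in> gauge_algebra A \<Omega>" and c: "c \<in> A" "x \<in> coords c"
  shows "transpose (transpose (conn_matrix (cov D \<alpha>) c x i) ** form_matrix \<Omega> c x)
    = transpose (conn_matrix (cov D \<alpha>) c x i) ** form_matrix \<Omega> c x"
proof -
  let ?a = "endo_matrix \<alpha> c" and ?W = "form_matrix \<Omega> c" and ?D = "conn_matrix D c x i"
  let ?S = "\<lambda>y. transpose (?a y) ** ?W y"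
  note o = open_coords[OF c(1)]
  have da: "mdiff (\<lambda>y. transpose (?a y)) x" and dW: "mdiff ?W x"
    using smooth_on_differentiable[OF smooth_endo[OF gauge_algebra_tensor[OF \<alpha>] c(1)] c(2)]
      smooth_on_differentiable[OF smooth_W[OF c(1)] c(2)]
    by (auto simp: mdiff_def transpose_def form_matrix_def)
  have ta: "pdm i (\<lambda>y. transpose (?a y)) x = transpose (pdm i ?a x)"
    by (simp add: pdm_def transpose_def vec_eq_iff)
  have pW: "pdm i ?W x = transpose ?D ** ?W x + ?W x ** ?D"
  proof -
    have "pd i (\<lambda>y. W c y j k) x = (\<Sum>p\<in>UNIV. D c x [p] [i,j] * W c x p k) + (\<Sum>p\<in>UNIV. D c x [p] [i,k] * W c x j p)" for j k
    proof -
      have "cov D \<Omega> c x [] [i,j,k] = 0" using D c by (simp add: symp_connections_def)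
      then show ?thesis by (simp add: cov_def[of D \<Omega>] Let_def lessThan_Suc numeral_2_eq_2)
    qed
    then show ?thesis
      by (simp add: pdm_def vec_eq_iff form_matrix_def matrix_matrix_mult_def transpose_def conn_matrix_def mult.commute)
  qed
  have S: "transpose (?S y) = ?S y" if "y \<in> coords c" for y
  proof -
    have "?S y $ j $ k = ?S y $ k $ j" for j k
      using \<alpha> c(1) that unfolding gauge_algebra_def lower_index_matrix by blast
    then show ?thesis by (simp add: transpose_def vec_eq_iff)
  qed
  have "pdm i (\<lambda>y. transpose (?S y)) x = pdm i ?S x"
    by (rule pdm_cong[OF o c(2)]) (rule S)
  moreover have "pdm i (\<lambda>y. transpose (?S y)) x = transpose (pdm i ?S x)"
    by (simp add: pdm_def transpose_def vec_eq_iff)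
  ultimately have pS: "transpose (pdm i ?S x) = pdm i ?S x" by simp
  have "pdm i ?S x = transpose (pdm i ?a x) ** ?W x + transpose (?a x) ** (transpose ?D ** ?W x + ?W x ** ?D)"
    by (simp add: pdm_mult[OF da dW] ta pW)
  moreover have tr: "transpose (M - L) = transpose M - transpose L" "transpose (M + L) = transpose M + transpose L"
    for M L :: "real^'m^'m" by (simp_all add: transpose_def vec_eq_iff)
  ultimately have eq: "transpose (conn_matrix (cov D \<alpha>) c x i) ** ?W x = pdm i ?S x - ?S x ** ?D - transpose ?D ** ?S x"
    unfolding cov_endo by (simp add: matrix_transpose_mul matrix_distribs matrix_mul_assoc)
  have "transpose (?S x ** ?D) = transpose ?D ** ?S x" "transpose (transpose ?D ** ?S x) = ?S x ** ?D"
    using S[OF c(2)] by (simp_all only: matrix_transpose_mul transpose_transpose)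
  then show ?thesis unfolding eq by (simp add: tr pS)
qed

lemma gauge_vector_field_model:
  assumes D: "D \<in> symp_connections A \<Omega>" and \<alpha>: "\<alpha> \<in> gauge_algebra A \<Omega>"
  shows "gauge_vector_field \<alpha> D \<in> symp_model A \<Omega>"
    and "c \<in> A \<Longrightarrow> x \<in> coords c \<Longrightarrow> conn_matrix (gauge_vector_field \<alpha> D) c x i = - conn_matrix (cov D \<alpha>) c x i"
proof -
  note aff = symp_connections_affine[OF D] and t = gauge_algebra_tensor[OF \<alpha>]
  have m: "conn_matrix (gauge_vector_field \<alpha> D) c x i = - conn_matrix (cov D \<alpha>) c x i"
    if c: "c \<in> A" "x \<in> coords c" for c x i
    using gauge_vector_field_eq[OF aff t c] by (simp add: conn_matrix_def vec_eq_iff)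
  then show "c \<in> A \<Longrightarrow> x \<in> coords c \<Longrightarrow> conn_matrix (gauge_vector_field \<alpha> D) c x i = - conn_matrix (cov D \<alpha>) c x i" .
  have "tensor_field A 1 2 (gauge_vector_field \<alpha> D)"
    by (rule tensor_field_12_cong[OF tensor_scale_12[OF tensor_cov[OF aff t], of "-1"]])
      (simp add: gauge_vector_field_eq[OF aff t])
  moreover have "lower_index \<Omega> (gauge_vector_field \<alpha> D) c x [] [i,j,k] = lower_index \<Omega> (gauge_vector_field \<alpha> D) c x [] [i,k,j]"
    if c: "c \<in> A" "x \<in> coords c" for c x i j k
  proof -
    let ?Y = "transpose (conn_matrix (cov D \<alpha>) c x i) ** form_matrix \<Omega> c x"
    have "?Y $ j $ k = transpose ?Y $ j $ k" using cov_gauge_symmetric[OF D \<alpha> c, of i] by simp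
    then have "?Y $ j $ k = ?Y $ k $ j" by (simp add: transpose_def)
    moreover have "transpose (conn_matrix (gauge_vector_field \<alpha> D) c x i) ** form_matrix \<Omega> c x = - ?Y"
    proof -
      have "transpose (- M) = - transpose M" for M :: "real^'m^'m" by (simp add: transpose_def vec_eq_iff)
      then show ?thesis by (simp add: m[OF c] matrix_distribs)
    qed
    ultimately show ?thesis unfolding lower_index_matrix by simp
  qed
  ultimately show "gauge_vector_field \<alpha> D \<in> symp_model A \<Omega>" by (simp add: symp_model_def)
qed

text \<open>Lowering an index is multiplication by the matrix of \<open>\<Omega>\<close>, and raising it by the negative inverse. The
  symmetry of the lowered \<open>H\<close> removes the transposition that comes with lowering, so that only the
  trace of a product of endomorphisms is left, and a sign.\<close>

lemma symp_contract_trace: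
  assumes H: "\<And>a. transpose (transpose (conn_matrix H c x a) ** form_matrix \<Omega> c x) = transpose (conn_matrix H c x a) ** form_matrix \<Omega> c x"
    and c: "c \<in> A" "x \<in> coords c"
  shows "symp_contract \<Omega> P H c x = - (\<Sum>i\<in>UNIV. \<Sum>a\<in>UNIV. N c x i a * trace (conn_matrix P c x i ** conn_matrix H c x a))"
proof -
  let ?W = "form_matrix \<Omega> c x" and ?N = "N_matrix c x"
  let ?P = "\<lambda>i. transpose (conn_matrix P c x i) ** ?W" and ?H = "\<lambda>a. transpose (conn_matrix H c x a) ** ?W"
  note rules = form_matrix_rules[OF c]
  have "symp_contract \<Omega> P H c x = (\<Sum>i\<in>UNIV. \<Sum>j\<in>UNIV. \<Sum>k\<in>UNIV. \<Sum>a\<in>UNIV.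
      ?P i $ j $ k * (N c x i a * (\<Sum>b\<in>UNIV. \<Sum>d\<in>UNIV. ?N $ j $ b * ?N $ k $ d * ?H a $ b $ d)))"
    unfolding symp_contract_def lower_index_matrix by (simp add: N_matrix_def sum_distrib_left mult_ac)
  also have "\<dots> = (\<Sum>i\<in>UNIV. \<Sum>j\<in>UNIV. \<Sum>a\<in>UNIV. \<Sum>k\<in>UNIV.
      ?P i $ j $ k * (N c x i a * (\<Sum>b\<in>UNIV. \<Sum>d\<in>UNIV. ?N $ j $ b * ?N $ k $ d * ?H a $ b $ d)))"
    by (intro sum.cong[OF refl] sum.swap)
  also have "\<dots> = (\<Sum>i\<in>UNIV. \<Sum>a\<in>UNIV. \<Sum>j\<in>UNIV. \<Sum>k\<in>UNIV.
      ?P i $ j $ k * (N c x i a * (\<Sum>b\<in>UNIV. \<Sum>d\<in>UNIV. ?N $ j $ b * ?N $ k $ d * ?H a $ b $ d)))"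
    by (intro sum.cong[OF refl] sum.swap)
  also have "\<dots> = (\<Sum>i\<in>UNIV. \<Sum>a\<in>UNIV. N c x i a * trace (transpose (?P i) ** (?N ** ?H a ** transpose ?N)))"
    unfolding trace_sandwich[symmetric] by (simp add: sum_distrib_left mult.left_commute)
  also have "\<dots> = (\<Sum>i\<in>UNIV. \<Sum>a\<in>UNIV. N c x i a * - trace (conn_matrix P c x i ** conn_matrix H c x a))"
  proof (intro sum.cong[OF refl] arg_cong2[of _ _ _ _ "(*)"])
    fix i a
    let ?p = "conn_matrix P c x i" and ?h = "conn_matrix H c x a"
    have tP: "transpose (?P i) = - (?W ** ?p)" by (simp add: matrix_transpose_mul rules matrix_distribs)
    have "?H a = transpose (?H a)" by (rule H[symmetric])
    also have "\<dots> = - (?W ** ?h)" by (simp add: matrix_transpose_mul rules matrix_distribs)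
    finally have tH: "?H a = - (?W ** ?h)" .
    have NW: "?N ** (?W ** M) = - M" for M :: "real^'m^'m" by (simp add: matrix_mul_assoc rules matrix_distribs)
    have "transpose (?P i) ** (?N ** ?H a ** transpose ?N) = ?W ** (?p ** ?h ** ?N)"
      unfolding tP tH rules(4) by (simp add: matrix_distribs matrix_mul_assoc[symmetric] NW)
    moreover have "trace (?W ** (?p ** ?h ** ?N)) = trace (?p ** ?h ** (?N ** ?W))"
      by (subst trace_mul_sym) (simp add: matrix_mul_assoc)
    ultimately show "trace (transpose (?P i) ** (?N ** ?H a ** transpose ?N)) = - trace (?p ** ?h)"
      by (simp add: rules matrix_distribs trace_uminus)
  qed simp
  finally show ?thesis by (simp add: sum_negf)
qed

text \<open>For every fixed \<open>j\<close> this is the covariant derivative of the endomorphism \<open>\<Pi>\<^sub>j\<close>. No connection term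
  acts on the index \<open>j\<close>, since the curvature involves \<open>\<Pi>\<close> as an endomorphism-valued one-form and only
  its exterior covariant derivative.\<close>

definition endo_cov :: "('a,'m) tfield \<Rightarrow> ('a,'m) tfield \<Rightarrow> ('a,'m) chart \<Rightarrow> real^'m \<Rightarrow> 'm \<Rightarrow> 'm \<Rightarrow> real^'m^'m" where
  "endo_cov D P c x i j = pdm i (\<lambda>y. conn_matrix P c y j) x + conn_matrix D c x i ** conn_matrix P c x j
    - conn_matrix P c x j ** conn_matrix D c x i"

lemma curv_translate:
  assumes D: "affine_connection A D" and P: "tensor_field A 1 2 P" and c: "c \<in> A" "x \<in> coords c"
  shows "curv (conn_matrix (translate D t P) c) x i j = curv (conn_matrix D c) x i j
    + t *\<^sub>R (endo_cov D P c x i j - endo_cov D P c x j i)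
    + (t * t) *\<^sub>R (conn_matrix P c x i ** conn_matrix P c x j - conn_matrix P c x j ** conn_matrix P c x i)"
proof -
  have m: "conn_matrix (translate D t P) c = (\<lambda>y i. conn_matrix D c y i + t *\<^sub>R conn_matrix P c y i)"
    by (simp add: conn_matrix_def translate_def vec_eq_iff fun_eq_iff)
  have dP: "mdiff (\<lambda>y. conn_matrix P c y i) x" for i
    unfolding mdiff_def using smooth_on_differentiable[OF smooth_conn[OF P c(1)] c(2)] by blast
  have "pdm i (\<lambda>y. conn_matrix D c y j + t *\<^sub>R conn_matrix P c y j) x
      = pdm i (\<lambda>y. conn_matrix D c y j) x + t *\<^sub>R pdm i (\<lambda>y. conn_matrix P c y j) x" for i j
    using affine_mdiff[OF D c] dP by (simp add: pdm_add pdm_scaleR mdiff_scaleR)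
  then show ?thesis
    unfolding curv_def m endo_cov_def
    by (simp add: matrix_distribs matrix_mult.scaleR_left matrix_mult.scaleR_right algebra_simps)
qed

definition trace_one_form :: "('a,'m) tfield \<Rightarrow> ('a,'m) tfield \<Rightarrow> ('a,'m) chart \<Rightarrow> real^'m \<Rightarrow> 'm \<Rightarrow> real" where
  "trace_one_form P \<alpha> c x j = trace (conn_matrix P c x j ** endo_matrix \<alpha> c x)"

definition trace_vector :: "('a,'m) tfield \<Rightarrow> ('a,'m) tfield \<Rightarrow> ('a,'m) chart \<Rightarrow> real^'m \<Rightarrow> 'm \<Rightarrow> real" where
  "trace_vector P \<alpha> c x i = (\<Sum>j\<in>UNIV. N c x i j * trace_one_form P \<alpha> c x j)"

definition pairing_density_diff :: "('a,'m) tfield \<Rightarrow> ('a,'m) tfield \<Rightarrow> ('a,'m) tfield \<Rightarrow> ('a,'m) chart \<Rightarrow> real^'m \<Rightarrow> real" where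
  "pairing_density_diff D P \<alpha> c x = (\<Sum>i\<in>UNIV. \<Sum>j\<in>UNIV. N c x i j * trace (endo_cov D P c x i j ** endo_matrix \<alpha> c x))"

lemma smooth_trace_one_form: "tensor_field A 1 2 P \<Longrightarrow> tensor_field A 1 1 \<alpha> \<Longrightarrow> c \<in> A \<Longrightarrow> smooth_on (coords c) (\<lambda>x. trace_one_form P \<alpha> c x j)"
  unfolding trace_one_form_def by (intro smooth_on_trace_mult open_coords smooth_conn smooth_endo)

lemma smooth_trace_vector: "tensor_field A 1 2 P \<Longrightarrow> tensor_field A 1 1 \<alpha> \<Longrightarrow> c \<in> A \<Longrightarrow> smooth_on (coords c) (\<lambda>x. trace_vector P \<alpha> c x i)"
  unfolding trace_vector_def by (intro smooth_intros open_coords smooth_N smooth_trace_one_form)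

lemma smooth_endo_cov:
  assumes D: "affine_connection A D" and P: "tensor_field A 1 2 P" and c: "c \<in> A"
  shows "smooth_on (coords c) (\<lambda>x. endo_cov D P c x i j $ k $ l)"
  unfolding endo_cov_def pdm_def matrix_matrix_mult_def
  using open_coords[OF c] by simp (intro smooth_intros smooth_conn[OF P c] smooth_affine[OF D c])

text \<open>Conjugation does not change the trace, so \<open>tr(\<Pi>\<^sub>j \<alpha>)\<close> is a one-form; raising its index gives a vector
  field on the whole manifold, to which the divergence theorem applies.\<close>

lemma trace_vector_change:
  assumes P: "tensor_field A 1 2 P" and \<alpha>: "tensor_field A 1 1 \<alpha>"
    and cd: "c \<in> A" "d \<in> A" "x \<in> overlap c d"
  shows "trace_vector P \<alpha> d (transition c d x) k = (\<Sum>i\<in>UNIV. jac c d x k i * trace_vector P \<alpha> c x i)"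
  using cd(3,1)
proof (rule overlapE)
  fix p assume p: "p \<in> fst c" "p \<in> fst d" "x = snd c p" "transition c d x = snd d p"
  let ?y = "snd d p" and ?K = "jacm c d (snd c p)" and ?J = "jacm d c (snd d p)"
  let ?a = "endo_matrix \<alpha> c (snd c p)" and ?N = "N_matrix c (snd c p)" and ?W = "form_matrix \<Omega> c (snd c p)"
  have pp: "p \<in> fst c \<inter> fst d" using p by simp
  have x: "snd c p \<in> coords c" and y: "?y \<in> coords d" and yo: "?y \<in> overlap d c"
    using p by (auto simp: coords_def overlap_def)
  note f = frame_change(1,2)[OF cd(1,2) yo, unfolded transition_at[OF cd(2) pp]]
  have JK: "?J ** (?K ** M) = M" for M :: "real^'m^'m" by (simp add: matrix_mul_assoc f(2))
  have trace_one_form: "trace_one_form P \<alpha> d ?y j = (\<Sum>a\<in>UNIV. jac d c ?y a j * trace_one_form P \<alpha> c (snd c p) a)" for j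
  proof -
    have tr: "trace ((?K ** conn_matrix P c (snd c p) a ** ?J) ** (?K ** ?a ** ?J))
        = trace (conn_matrix P c (snd c p) a ** ?a)" for a
    proof -
      have "(?K ** conn_matrix P c (snd c p) a ** ?J) ** (?K ** ?a ** ?J) = ?K ** (conn_matrix P c (snd c p) a ** ?a ** ?J)"
        by (simp add: matrix_mul_assoc[symmetric] JK)
      also have "trace \<dots> = trace ((conn_matrix P c (snd c p) a ** ?a ** ?J) ** ?K)" by (rule trace_mul_sym)
      also have "(conn_matrix P c (snd c p) a ** ?a ** ?J) ** ?K = conn_matrix P c (snd c p) a ** ?a"
        by (simp add: matrix_mul_assoc[symmetric] f(2))
      finally show ?thesis .
    qed
    have "conn_matrix P d ?y j = (\<Sum>a\<in>UNIV. jac d c ?y a j *\<^sub>R (?K ** conn_matrix P c (snd c p) a ** ?J))"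
      using P cd(1,2) pp unfolding tensor_field_12 by blast
    moreover have "endo_matrix \<alpha> d ?y = ?K ** ?a ** ?J"
      using \<alpha> cd(1,2) pp unfolding tensor_field_11 by blast
    ultimately have "trace_one_form P \<alpha> d ?y j = trace (\<Sum>a\<in>UNIV. jac d c ?y a j *\<^sub>R
        ((?K ** conn_matrix P c (snd c p) a ** ?J) ** (?K ** ?a ** ?J)))"
      by (simp add: trace_one_form_def matrix_mult.sum_left matrix_mult.scaleR_left)
    also have "\<dots> = (\<Sum>a\<in>UNIV. jac d c ?y a j * trace ((?K ** conn_matrix P c (snd c p) a ** ?J) ** (?K ** ?a ** ?J)))"
      by (simp add: trace_sum trace_scaleR)
    finally show ?thesis by (simp only: tr trace_one_form_def)
  qed
  have NN: "N_matrix d ?y = ?K ** ?N ** transpose ?K"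
  proof -
    have Wd: "form_matrix \<Omega> d ?y = transpose ?J ** ?W ** ?J"
      unfolding vec_eq_iff matrix_triple_component
      using tensor_field_02(2)[OF tensor_\<Omega> cd(1,2) pp]
      by (simp add: form_matrix_def transpose_def sum_distrib_left mult_ac)
    have KJt: "transpose ?K ** (transpose ?J ** M) = M" for M :: "real^'m^'m"
      by (simp add: matrix_mul_assoc matrix_transpose_mul[symmetric] f(2) transpose_mat)
    have NW: "?N ** (?W ** M) = - M" for M :: "real^'m^'m"
      using form_matrix_rules(2)[OF cd(1) x] by (simp add: matrix_mul_assoc matrix_distribs)
    have "(- (?K ** ?N ** transpose ?K)) ** form_matrix \<Omega> d ?y = mat 1"
      unfolding Wd by (simp add: matrix_distribs matrix_mul_assoc[symmetric] KJt NW f(1))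
    then have "matrix_inv (form_matrix \<Omega> d ?y) = - (?K ** ?N ** transpose ?K)" by (rule matrix_inv_unique)
    then show ?thesis by (simp add: N_matrix_def N_eq vec_eq_iff)
  qed
  have v: "(\<chi> i. trace_vector P \<alpha> b z i) = N_matrix b z *v (\<chi> j. trace_one_form P \<alpha> b z j)" for b z
    by (simp add: trace_vector_def N_matrix_def matrix_vector_mult_def vec_eq_iff)
  have "(\<chi> j. trace_one_form P \<alpha> d ?y j) = transpose ?J *v (\<chi> j. trace_one_form P \<alpha> c (snd c p) j)"
    by (simp add: trace_one_form matrix_vector_mult_def transpose_def jacm_def vec_eq_iff)
  then have "(\<chi> i. trace_vector P \<alpha> d ?y i) = (?K ** ?N ** (transpose ?K ** transpose ?J)) *v (\<chi> j. trace_one_form P \<alpha> c (snd c p) j)"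
    unfolding v NN by (simp only: matrix_vector_mul_assoc matrix_mul_assoc)
  also have "transpose ?K ** transpose ?J = mat 1"
    by (simp add: matrix_transpose_mul[symmetric] f(2) transpose_mat)
  finally have "(\<chi> i. trace_vector P \<alpha> d ?y i) = ?K *v (\<chi> i. trace_vector P \<alpha> c (snd c p) i)"
    unfolding v by (simp add: matrix_vector_mul_assoc)
  then have "(\<chi> i. trace_vector P \<alpha> d ?y i) $ k = (?K *v (\<chi> i. trace_vector P \<alpha> c (snd c p) i)) $ k" by simp
  then show ?thesis using p by (simp add: matrix_vector_mult_def jacm_def)
qed

text \<open>The bivector \<open>\<Omega>\<^sup>i\<^sup>j\<close> is divergence free for the Liouville density: the derivative of the density is
  half a trace of \<open>\<partial>\<Omega>\<close>, the derivative of the inverse matrix gives another contraction of \<open>\<partial>\<Omega>\<close>, and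
  \<open>d\<Omega> = 0\<close> relates the two contractions.\<close>

lemma N_divergence_free:
  assumes c: "c \<in> A" "x \<in> coords c"
  shows "(\<Sum>i\<in>UNIV. pd i (\<lambda>y. N c y i j * dens c y) x) = 0"
proof -
  let ?w = "\<lambda>i a b. pd i (\<lambda>y. W c y a b) x"
  note o = open_coords[OF c(1)]
  have dN: "(\<lambda>y. N c y i j) differentiable (at x)" for i j
    by (rule smooth_on_differentiable[OF smooth_N[OF c(1)] c(2)])
  have wanti: "?w i a b = - ?w i b a" for i a b
  proof -
    have "?w i a b = pd i (\<lambda>y. - W c y b a) x" by (rule pd_cong[OF o c(2)]) (rule W_anti[OF c(1)])
    then show ?thesis using pd_uminus[OF smooth_on_differentiable[OF smooth_W[OF c(1)] c(2)]] by simp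
  qed
  have closed: "?w i a b = ?w a i b - ?w b i a" for i a b
  proof -
    have "ext_deriv \<Omega> c x [] [i,a,b] = 0" using symplectic c unfolding symplectic_form_def by blast
    then show ?thesis by (simp add: ext_deriv_def lessThan_Suc numeral_3_eq_3 numeral_2_eq_2)
  qed
  have pN: "pd i (\<lambda>y. N c y k j) x = (\<Sum>a\<in>UNIV. \<Sum>b\<in>UNIV. N c x k a * ?w i a b * N c x b j)" for i k
  proof -
    let ?I = "\<lambda>y. matrix_inv (form_matrix \<Omega> c y)"
    have dW: "mdiff (form_matrix \<Omega> c) x"
      using smooth_on_differentiable[OF smooth_W[OF c(1)] c(2)] by (simp add: mdiff_def form_matrix_def)
    have dI: "mdiff ?I x"
    proof -
      have "?I y $ i $ j = - N c y i j" for y i j by (simp add: N_eq)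
      then show ?thesis unfolding mdiff_def using dN by simp
    qed
    have "pdm i ?I x = - (?I x ** pdm i (form_matrix \<Omega> c) x ** ?I x)"
      by (rule pdm_inverse[OF o c(2) _ matrix_inv_mult(1)[OF form_invertible[OF c]] dI dW])
        (rule matrix_inv_mult(2)[OF form_invertible[OF c(1)]])
    then have "pdm i ?I x $ k $ j = - (?I x ** pdm i (form_matrix \<Omega> c) x ** ?I x) $ k $ j" by simp
    moreover have "pd i (\<lambda>y. N c y k j) x = - pdm i ?I x $ k $ j"
      unfolding N_eq pdm_component by (rule pd_uminus) (use dI in \<open>simp add: mdiff_def\<close>)
    ultimately show ?thesis
      unfolding matrix_triple_component by (simp add: pdm_def form_matrix_def N_eq sum_distrib_left mult_ac)
  qed
  have half: "2 * (\<Sum>i\<in>UNIV. \<Sum>a\<in>UNIV. N c x i a * ?w i a b) = - (\<Sum>i\<in>UNIV. \<Sum>a\<in>UNIV. N c x i a * ?w b i a)" for b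
  proof -
    have "(\<Sum>i\<in>UNIV. \<Sum>a\<in>UNIV. N c x i a * ?w a i b) = (\<Sum>i\<in>UNIV. \<Sum>a\<in>UNIV. N c x a i * ?w i a b)"
      by (rule sum.swap)
    also have "\<dots> = (\<Sum>i\<in>UNIV. \<Sum>a\<in>UNIV. - (N c x i a * ?w i a b))"
    proof (intro sum.cong[OF refl])
      fix i a show "N c x a i * ?w i a b = - (N c x i a * ?w i a b)" using N_anti[OF c, of a i] by simp
    qed
    finally have 1: "(\<Sum>i\<in>UNIV. \<Sum>a\<in>UNIV. N c x i a * ?w a i b) = - (\<Sum>i\<in>UNIV. \<Sum>a\<in>UNIV. N c x i a * ?w i a b)"
      by (simp add: sum_negf)
    have "(\<Sum>i\<in>UNIV. \<Sum>a\<in>UNIV. N c x i a * ?w i a b)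
      = (\<Sum>i\<in>UNIV. \<Sum>a\<in>UNIV. N c x i a * ?w a i b - N c x i a * ?w b i a)"
      by (intro sum.cong[OF refl]) (subst closed, rule right_diff_distrib)
    then show ?thesis using 1 by (simp add: sum_subtractf)
  qed
  define s where "s b = (\<Sum>i\<in>UNIV. \<Sum>a\<in>UNIV. N c x i a * ?w b i a)" for b
  have pdd: "pd i (dens c) x = s i / 2 * dens c x" for i
    by (simp only: dens_derivative(1)[OF c] s_def)
  have "(\<Sum>i\<in>UNIV. pd i (\<lambda>y. N c y i j * dens c y) x)
    = (\<Sum>i\<in>UNIV. pd i (\<lambda>y. N c y i j) x) * dens c x + (\<Sum>i\<in>UNIV. N c x i j * pd i (dens c) x)"
    by (simp add: pd_mult[OF dN dens_derivative(2)[OF c]] sum.distrib sum_distrib_right)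
  also have "(\<Sum>i\<in>UNIV. N c x i j * pd i (dens c) x) = (\<Sum>b\<in>UNIV. N c x b j * (s b / 2)) * dens c x"
    by (simp add: pdd sum_distrib_left sum_distrib_right mult_ac)
  also have "(\<Sum>i\<in>UNIV. pd i (\<lambda>y. N c y i j) x) = (\<Sum>b\<in>UNIV. N c x b j * (\<Sum>i\<in>UNIV. \<Sum>a\<in>UNIV. N c x i a * ?w i a b))"
  proof -
    let ?g = "\<lambda>i a b. N c x i a * ?w i a b * N c x b j"
    have "(\<Sum>i\<in>UNIV. \<Sum>a\<in>UNIV. \<Sum>b\<in>UNIV. ?g i a b) = (\<Sum>i\<in>UNIV. \<Sum>b\<in>UNIV. \<Sum>a\<in>UNIV. ?g i a b)"
      by (intro sum.cong[OF refl] sum.swap)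
    also have "\<dots> = (\<Sum>b\<in>UNIV. \<Sum>i\<in>UNIV. \<Sum>a\<in>UNIV. ?g i a b)" by (rule sum.swap)
    finally show ?thesis unfolding pN by (simp add: sum_distrib_left mult_ac)
  qed
  also have "\<dots> = (\<Sum>b\<in>UNIV. N c x b j * - (s b / 2))"
  proof (intro sum.cong[OF refl] arg_cong2[of _ _ _ _ "(*)"])
    fix b show "(\<Sum>i\<in>UNIV. \<Sum>a\<in>UNIV. N c x i a * ?w i a b) = - (s b / 2)" using half[of b] by (simp add: s_def)
  qed simp
  finally show ?thesis by (simp add: sum_negf)
qed

text \<open>The product rule for \<open>\<Omega>\<^sup>i\<^sup>j \<partial>\<^sub>i tr(\<Pi>\<^sub>j \<alpha>)\<close>. The connection terms in \<open>\<nabla>\<^sub>i \<Pi>\<^sub>j\<close> and \<open>\<nabla>\<^sub>i \<alpha>\<close> cancel under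
  the trace, and \<open>N_divergence_free\<close> allows \<open>\<Omega>\<^sup>i\<^sup>j\<close> and the density to be moved under the derivative.\<close>

lemma pairing_density_diff_minus_contract:
  assumes D: "D \<in> symp_connections A \<Omega>" and \<alpha>: "\<alpha> \<in> gauge_algebra A \<Omega>" and P: "P \<in> symp_model A \<Omega>"
    and c: "c \<in> A" "x \<in> coords c"
  shows "(pairing_density_diff D P \<alpha> c x - symp_contract \<Omega> P (gauge_vector_field \<alpha> D) c x) * dens c x
    = (\<Sum>i\<in>UNIV. pd i (\<lambda>y. trace_vector P \<alpha> c y i * dens c y) x)"
    and "symp_contract \<Omega> P (gauge_vector_field \<alpha> D) c x
      = (\<Sum>i\<in>UNIV. \<Sum>a\<in>UNIV. N c x i a * trace (conn_matrix P c x i ** conn_matrix (cov D \<alpha>) c x a))"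
proof -
  note aff = symp_connections_affine[OF D] and t\<alpha> = gauge_algebra_tensor[OF \<alpha>] and tP = symp_model_tensor[OF P]
  let ?a = "endo_matrix \<alpha> c" and ?P = "\<lambda>j y. conn_matrix P c y j" and ?D = "\<lambda>i. conn_matrix D c x i"
  let ?A = "\<lambda>a. conn_matrix (cov D \<alpha>) c x a" and ?H = "\<lambda>a. conn_matrix (gauge_vector_field \<alpha> D) c x a"
  have Hm: "?H a = - ?A a" for a by (rule gauge_vector_field_model(2)[OF D \<alpha> c])
  have tm: "transpose (- M) = - transpose M" for M :: "real^'m^'m" by (simp add: transpose_def vec_eq_iff)
  have "transpose (transpose (?H a) ** form_matrix \<Omega> c x) = transpose (?H a) ** form_matrix \<Omega> c x" for a
    using cov_gauge_symmetric[OF D \<alpha> c, of a] by (simp add: Hm tm matrix_distribs)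
  from symp_contract_trace[OF this c, of P]
  show sc: "symp_contract \<Omega> P (gauge_vector_field \<alpha> D) c x = (\<Sum>i\<in>UNIV. \<Sum>a\<in>UNIV. N c x i a * trace (?P i x ** ?A a))"
    by (simp add: Hm matrix_distribs trace_uminus sum_negf)
  have da: "mdiff ?a x" and dP: "mdiff (?P j) x" for j
    unfolding mdiff_def
    using smooth_on_differentiable[OF smooth_endo[OF t\<alpha> c(1)] c(2)] smooth_on_differentiable[OF smooth_conn[OF tP c(1)] c(2)]
    by blast+
  have dlam: "pd i (\<lambda>y. trace_one_form P \<alpha> c y j) x = trace (endo_cov D P c x i j ** ?a x) + trace (?P j x ** ?A i)" for i j
  proof -
    have "pd i (\<lambda>y. trace_one_form P \<alpha> c y j) x = trace (pdm i (?P j) x ** ?a x) + trace (?P j x ** pdm i ?a x)"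
      unfolding trace_one_form_def pd_trace[OF mdiff_mult[OF dP da]] pdm_mult[OF dP da] by (rule trace_add)
    moreover have "trace (?D i ** (?P j x ** ?a x)) = trace ((?P j x ** ?a x) ** ?D i)" by (rule trace_mul_sym)
    ultimately show ?thesis
      unfolding endo_cov_def cov_endo
      by (simp add: matrix_distribs matrix_mul_assoc trace_add trace_sub)
  qed
  have swapped: "(\<Sum>i\<in>UNIV. \<Sum>j\<in>UNIV. N c x i j * trace (?P j x ** ?A i)) = - (\<Sum>i\<in>UNIV. \<Sum>a\<in>UNIV. N c x i a * trace (?P i x ** ?A a))"
  proof -
    have "(\<Sum>i\<in>UNIV. \<Sum>j\<in>UNIV. N c x i j * trace (?P j x ** ?A i)) = (\<Sum>i\<in>UNIV. \<Sum>a\<in>UNIV. N c x a i * trace (?P i x ** ?A a))"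
      by (rule sum.swap)
    also have "\<dots> = (\<Sum>i\<in>UNIV. \<Sum>a\<in>UNIV. - (N c x i a * trace (?P i x ** ?A a)))"
    proof (intro sum.cong[OF refl])
      fix i a show "N c x a i * trace (?P i x ** ?A a) = - (N c x i a * trace (?P i x ** ?A a))" using N_anti[OF c, of a i] by simp
    qed
    finally show ?thesis by (simp add: sum_negf)
  qed
  have grad: "pairing_density_diff D P \<alpha> c x - symp_contract \<Omega> P (gauge_vector_field \<alpha> D) c x
      = (\<Sum>i\<in>UNIV. \<Sum>j\<in>UNIV. N c x i j * pd i (\<lambda>y. trace_one_form P \<alpha> c y j) x)"
    unfolding dlam sc pairing_density_diff_def using swapped by (simp add: distrib_left sum.distrib)
  have dl: "(\<lambda>y. trace_one_form P \<alpha> c y j) differentiable (at x)" for j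
    by (rule smooth_on_differentiable[OF smooth_trace_one_form[OF tP t\<alpha> c(1)] c(2)])
  have dNm: "(\<lambda>y. N c y i j * dens c y) differentiable (at x)" for i j
    by (intro differentiable_mult smooth_on_differentiable[OF smooth_N[OF c(1)] c(2)] dens_derivative(2)[OF c])
  have "pd i (\<lambda>y. trace_vector P \<alpha> c y i * dens c y) x
      = (\<Sum>j\<in>UNIV. pd i (\<lambda>y. N c y i j * dens c y) x * trace_one_form P \<alpha> c x j + N c x i j * dens c x * pd i (\<lambda>y. trace_one_form P \<alpha> c y j) x)" for i
  proof -
    have "(\<lambda>y. trace_vector P \<alpha> c y i * dens c y) = (\<lambda>y. \<Sum>j\<in>UNIV. (N c y i j * dens c y) * trace_one_form P \<alpha> c y j)"
      by (simp add: trace_vector_def sum_distrib_left mult_ac)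
    then show ?thesis
      using dNm dl by (simp only:) (subst pd_sum, auto intro!: differentiable_mult simp: pd_mult)
  qed
  then have "(\<Sum>i\<in>UNIV. pd i (\<lambda>y. trace_vector P \<alpha> c y i * dens c y) x)
      = (\<Sum>i\<in>UNIV. \<Sum>j\<in>UNIV. pd i (\<lambda>y. N c y i j * dens c y) x * trace_one_form P \<alpha> c x j)
        + (\<Sum>i\<in>UNIV. \<Sum>j\<in>UNIV. N c x i j * pd i (\<lambda>y. trace_one_form P \<alpha> c y j) x) * dens c x"
    by (simp add: sum.distrib sum_distrib_left sum_distrib_right mult_ac)
  also have "(\<Sum>i\<in>UNIV. \<Sum>j\<in>UNIV. pd i (\<lambda>y. N c y i j * dens c y) x * trace_one_form P \<alpha> c x j) = 0"
    by (subst sum.swap) (simp add: sum_distrib_right[symmetric] N_divergence_free[OF c])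
  finally show "(pairing_density_diff D P \<alpha> c x - symp_contract \<Omega> P (gauge_vector_field \<alpha> D) c x) * dens c x
    = (\<Sum>i\<in>UNIV. pd i (\<lambda>y. trace_vector P \<alpha> c y i * dens c y) x)"
    unfolding grad by simp
qed

text \<open>The pairing is a quadratic polynomial in \<open>t\<close>. Its linear coefficient differs from the symplectic form
  by the integral of a divergence.\<close>

lemma pairing_derivative:
  assumes D: "D \<in> symp_connections A \<Omega>" and \<alpha>: "\<alpha> \<in> gauge_algebra A \<Omega>" and P: "P \<in> symp_model A \<Omega>"
  shows "((\<lambda>t. curvature_pairing X A n \<Omega> (translate D t P) \<alpha>) has_real_derivative
    conn_symp X A n \<Omega> P (gauge_vector_field \<alpha> D)) (at 0)"
proof -
  note aff = symp_connections_affine[OF D] and t\<alpha> = gauge_algebra_tensor[OF \<alpha>] and tP = symp_model_tensor[OF P]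
  let ?sc = "symp_contract \<Omega> P (gauge_vector_field \<alpha> D)"
  define q where "q c x = (\<Sum>i\<in>UNIV. \<Sum>j\<in>UNIV. N c x i j * trace ((conn_matrix P c x i ** conn_matrix P c x j
    - conn_matrix P c x j ** conn_matrix P c x i) ** endo_matrix \<alpha> c x)) / 2" for c x
  have pairing_density: "pairing_density (translate D t P) \<alpha> c x = 1 * pairing_density D \<alpha> c x + 1 * (t * pairing_density_diff D P \<alpha> c x + (t * t) * q c x)"
    if c: "c \<in> A" "x \<in> coords c" for c x t
  proof -
    let ?u = "\<lambda>i j. trace (endo_cov D P c x i j ** endo_matrix \<alpha> c x)"
    have "(\<Sum>i\<in>UNIV. \<Sum>j\<in>UNIV. N c x i j * ?u j i) = (\<Sum>i\<in>UNIV. \<Sum>j\<in>UNIV. N c x j i * ?u i j)" by (rule sum.swap)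
    also have "\<dots> = (\<Sum>i\<in>UNIV. \<Sum>j\<in>UNIV. - (N c x i j * ?u i j))"
    proof (intro sum.cong[OF refl])
      fix i j show "N c x j i * ?u i j = - (N c x i j * ?u i j)" using N_anti[OF c, of j i] by simp
    qed
    finally have "(\<Sum>i\<in>UNIV. \<Sum>j\<in>UNIV. N c x i j * (?u i j - ?u j i)) = 2 * pairing_density_diff D P \<alpha> c x"
      by (simp add: right_diff_distrib sum_subtractf sum_negf pairing_density_diff_def)
    moreover have "pairing_density (translate D t P) \<alpha> c x = pairing_density D \<alpha> c x
        + t * (\<Sum>i\<in>UNIV. \<Sum>j\<in>UNIV. N c x i j * (?u i j - ?u j i)) / 2 + (t * t) * q c x"
      unfolding pairing_density_def q_def curv_translate[OF aff tP c]
      by (simp add: matrix_mult.add_left matrix_mult.diff_left matrix_mult.scaleR_left trace_add trace_sub trace_scaleR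
          distrib_left right_diff_distrib sum.distrib sum_subtractf sum_distrib_left add_divide_distrib diff_divide_distrib mult_ac)
    ultimately show ?thesis by simp
  qed
  have cont_pr: "continuous_on (coords c) (pairing_density D \<alpha> c)" if "c \<in> A" for c
    by (rule continuous_pairing_density[OF aff t\<alpha> that])
  have cont_dpr: "continuous_on (coords c) (pairing_density_diff D P \<alpha> c)" if c: "c \<in> A" for c
    using continuous_N_trace[OF c smooth_endo_cov[OF aff tP c], of "\<lambda>x i j. endo_matrix \<alpha> c x"] smooth_endo[OF t\<alpha> c]
    by (simp add: pairing_density_diff_def[abs_def])
  have cont_q: "continuous_on (coords c) (q c)" if c: "c \<in> A" for c
  proof -
    have "smooth_on (coords c) (\<lambda>x. (conn_matrix P c x i ** conn_matrix P c x j - conn_matrix P c x j ** conn_matrix P c x i) $ k $ l)"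
      for i j k l
      unfolding matrix_matrix_mult_def using open_coords[OF c]
      by simp (intro smooth_intros smooth_conn[OF tP c])
    from continuous_N_trace[OF c this, of "\<lambda>x i j. endo_matrix \<alpha> c x"] smooth_endo[OF t\<alpha> c]
    have "continuous_on (coords c) (\<lambda>x. (\<Sum>i\<in>UNIV. \<Sum>j\<in>UNIV. N c x i j * trace ((conn_matrix P c x i ** conn_matrix P c x j
    - conn_matrix P c x j ** conn_matrix P c x i) ** endo_matrix \<alpha> c x)) / 2)"
      by (intro continuous_on_divide continuous_on_const) simp_all
    then show ?thesis by (simp add: q_def[abs_def])
  qed
  have cont_sc: "continuous_on (coords c) (?sc c)" if c: "c \<in> A" for c
  proof -
    have "continuous_on (coords c) (\<lambda>x. \<Sum>i\<in>UNIV. \<Sum>a\<in>UNIV. N c x i a * trace (conn_matrix P c x i ** conn_matrix (cov D \<alpha>) c x a))"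
      by (rule continuous_N_trace[OF c]) (rule smooth_conn[OF tP c], rule smooth_conn[OF tensor_cov[OF aff t\<alpha>] c])
    then show ?thesis
      by (rule continuous_on_eq) (rule pairing_density_diff_minus_contract(2)[OF D \<alpha> P c, symmetric])
  qed
  have F: "curvature_pairing X A n \<Omega> (translate D t P) \<alpha> = Liouville_integral (pairing_density D \<alpha>) + t * Liouville_integral (pairing_density_diff D P \<alpha>) + t * t * Liouville_integral q" for t
  proof -
    have "curvature_pairing X A n \<Omega> (translate D t P) \<alpha>
        = Liouville_integral (\<lambda>c x. 1 * pairing_density D \<alpha> c x + 1 * (t * pairing_density_diff D P \<alpha> c x + (t * t) * q c x))"
      unfolding curvature_pairing_eq[OF affine_translate[OF aff tP]] by (rule Liouville_integral_cong) (rule pairing_density)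
    also have "\<dots> = 1 * Liouville_integral (pairing_density D \<alpha>) + 1 * Liouville_integral (\<lambda>c x. t * pairing_density_diff D P \<alpha> c x + (t * t) * q c x)"
      by (rule Liouville_integral_linear) (intro cont_pr continuous_on_add continuous_on_mult continuous_on_const cont_dpr cont_q, assumption)+
    also have "Liouville_integral (\<lambda>c x. t * pairing_density_diff D P \<alpha> c x + (t * t) * q c x) = t * Liouville_integral (pairing_density_diff D P \<alpha>) + (t * t) * Liouville_integral q"
      by (rule Liouville_integral_linear) (intro cont_dpr cont_q, assumption)+
    finally show ?thesis by simp
  qed
  have "Liouville_integral (pairing_density_diff D P \<alpha>) = Liouville_integral ?sc"
  proof -
    have "Liouville_integral (\<lambda>c x. 1 * pairing_density_diff D P \<alpha> c x + (-1) * ?sc c x) = 1 * Liouville_integral (pairing_density_diff D P \<alpha>) + (-1) * Liouville_integral ?sc"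
      by (rule Liouville_integral_linear) (intro cont_dpr cont_sc, assumption)+
    moreover have "Liouville_integral (\<lambda>c x. 1 * pairing_density_diff D P \<alpha> c x + (-1) * ?sc c x)
      = (\<Sum>c\<in>C. integral (coords c) (\<lambda>x. r c c x * (\<Sum>i\<in>UNIV. pd i (\<lambda>y. trace_vector P \<alpha> c y i * dens c y) x)))"
      unfolding Liouville_integral_def
    proof (intro sum.cong[OF refl] integral_cong)
      fix c x assume "c \<in> C" "x \<in> coords c"
      then show "r c c x * ((1 * pairing_density_diff D P \<alpha> c x + (-1) * ?sc c x) * dens c x)
        = r c c x * (\<Sum>i\<in>UNIV. pd i (\<lambda>y. trace_vector P \<alpha> c y i * dens c y) x)"
        using pairing_density_diff_minus_contract(1)[OF D \<alpha> P C(2), of c x] by simp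
    qed
    moreover have "\<dots> = 0"
      by (rule divergence_theorem) (rule smooth_trace_vector[OF tP t\<alpha>], assumption, rule trace_vector_change[OF tP t\<alpha>])
    ultimately show ?thesis by simp
  qed
  moreover have "conn_symp X A n \<Omega> P (gauge_vector_field \<alpha> D) = Liouville_integral ?sc"
    unfolding conn_symp_def by (rule form_integral_eq_Liouville_integral) (simp add: vol_def)
  moreover have "((\<lambda>t. Liouville_integral (pairing_density D \<alpha>) + t * Liouville_integral (pairing_density_diff D P \<alpha>) + t * t * Liouville_integral q) has_real_derivative Liouville_integral (pairing_density_diff D P \<alpha>)) (at 0)"
    by (auto intro!: derivative_eq_intros)
  ultimately show ?thesis unfolding F by simp
qed

theorem moment_map: "is_moment_map X A n \<Omega> (curvature_pairing X A n \<Omega>)"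
  unfolding is_moment_map_def is_hamiltonian_vector_field_def
  using pairing_linear gauge_vector_field_model(1) pairing_derivative pairing_equivariant by blast

end

theorem theorem5p1:
  fixes X :: "'a topology" and A :: "('a, 'm::finite) chart set"
    and n :: nat and \<Omega> :: "('a, 'm) tfield"
  assumes "compact_symplectic_manifold X A n \<Omega>"
  shows "is_moment_map X A n \<Omega> (curvature_pairing X A n \<Omega>)"
proof -
  interpret compact_symplectic X A n \<Omega>
    by standard (use assms in \<open>simp_all add: compact_symplectic_manifold_def\<close>)
  show ?thesis by (rule moment_map)
qed

end
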